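(* Let $m=d\ge1$, let $T>0$, and let $X_0\in\mathbb{R}^m$ be fixed. Let $g\equiv I_m$ (the identity matrix), and let $f:\mathbb{R}^m\to\mathbb{R}^m$ be differentiable and such that there exist constants $\alpha>0$ and $\gamma,\mu,q>0$ with, for all $x,y\in\mathbb{R}^m$, $$\langle x-y,f(x)-f(y)\rangle\le\tfrac12\alpha\|x-y\|^2,$$ $$\|f(x)-f(y)\|+\|\nabla f(x)-\nabla f(y)\|\le\left(\gamma(\|x\|^q+\|y\|^q)+\mu\right)\|x-y\| .$$ Let $h:\mathbb{R}^m\to(0,\infty)$ be continuous and strictly positive, and suppose there exist constants $\alpha',\beta'>0$ such that for all $x\in\mathbb{R}^m$ $$\langle x,f(x)\rangle+\tfrac12h(x)\|f(x)\|^2\le\alpha'\|x\|^2+\beta' .$$ For each $0<\delta\le1$ let $h^\delta:\mathbb{R}^m\to(0,\infty)$ be a Borel measurable function such that for all $x\in\mathbb{R}^m$ $$\delta\min(T,h(x))\le h^\delta(x)\le\min(\delta T,h(x)).$$ Let $X$ be the solution of $dX_t=f(X_t)\,dt+dW_t$ with initial value $X_0$, and let $\widehat X$ (depending on $\delta$) be the continuous interpolant of the adaptive Euler-Maruyama scheme with timestep function $h^\delta$ (defined in the context). Then for all $p\in(0,\infty)$ there exists a constant $C_{p,T}$, independent of $\delta$, such that for all $0<\delta\le1$ $$\mathbb{E}\left[\sup_{0\le t\le T}\|\widehat X_t-X_t\|^p\right]\le C_{p,T}\,\delta^{p}.$$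
   Context: $W$ is a standard $m$-dimensional Brownian motion on a probability space $(\Omega,\mathcal F,\mathbb P)$ with corresponding normal filtration $(\mathcal F_t)$. $\|\cdot\|$ is the Euclidean norm on vectors and the Frobenius norm on matrices; $\langle\cdot,\cdot\rangle$ is the Euclidean inner product; $\nabla f$ is the Jacobian matrix of $f$. The SDE $dX_t=f(X_t)\,dt+dW_t$ with fixed (deterministic) initial value $X_0$ has, under the stated hypotheses, a unique strong solution on $[0,T]$. Adaptive Euler-Maruyama scheme with timestep function $h^\delta$: $t_0=0$, $\widehat X_0=X_0$, and for $n\ge0$ $$h_n=h^\delta(\widehat X_{t_n}),\quad t_{n+1}=t_n+h_n,\quad \widehat X_{t_{n+1}}=\widehat X_{t_n}+f(\widehat X_{t_n})h_n+\Delta W_n,\quad \Delta W_n=W_{t_{n+1}}-W_{t_n}.$$ For $t\ge0$ put $\underline t=\max\{t_n:t_n\le t\}$. The continuous interpolant is $$\widehat X_t=\widehat X_{\underline t}+f(\widehat X_{\underline t})(t-\underline t)+(W_t-W_{\underline t}),$$ defined for all $t<\lim_n t_n$; under the stated hypotheses, almost surely some $t_N\ge T$, so $\widehat X_t$ is almost surely defined on $[0,T]$. The numerical and exact solutions use the same Brownian motion $W$. *)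

theory Defs
  imports "HOL-Probability.Probability"
begin

(* Time is the half-line of nonnegative reals: the values of a filtration or of a process at
   negative times carry no information and are left unconstrained. *)

definition normal_filtration :: "'w measure \<Rightarrow> (real \<Rightarrow> 'w measure) \<Rightarrow> bool" where
  "normal_filtration M F \<longleftrightarrow>
     (\<forall>t\<ge>0. subalgebra M (F t)) \<and>
     (\<forall>s t. 0 \<le> s \<longrightarrow> s \<le> t \<longrightarrow> sets (F s) \<subseteq> sets (F t)) \<and>
     null_sets M \<subseteq> sets (F 0) \<and>
     (\<forall>t\<ge>0. sets (F t) = (\<Inter>u\<in>{t<..}. sets (F u)))"

(* The product of one-dimensional normal densities of variance t - s is the density of the
   Gaussian law with mean zero and covariance matrix (t - s) times the identity. *)

definition standard_brownian_motion ::
  "'w measure \<Rightarrow> (real \<Rightarrow> 'w measure) \<Rightarrow> (real \<Rightarrow> 'w \<Rightarrow> real ^ 'm) \<Rightarrow> bool" where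
  "standard_brownian_motion M F W \<longleftrightarrow>
     (\<forall>t\<ge>0. W t \<in> borel_measurable (F t)) \<and>
     (AE \<omega> in M. W 0 \<omega> = 0) \<and>
     (AE \<omega> in M. continuous_on {0..} (\<lambda>t. W t \<omega>)) \<and>
     (\<forall>s t. 0 \<le> s \<longrightarrow> s < t \<longrightarrow>
        distributed M lborel (\<lambda>\<omega>. W t \<omega> - W s \<omega>)
          (\<lambda>x. ennreal (\<Prod>i\<in>UNIV. normal_density 0 (sqrt (t - s)) (x $ i))) \<and>
        prob_space.indep_set M (sets (F s))
          (sets (vimage_algebra (space M) (\<lambda>\<omega>. W t \<omega> - W s \<omega>) borel)))"

(* Strong solution on [0,T] of dX = f(X) dt + dW started at x0.  The diffusion coefficient is the
   identity matrix, so the stochastic integral over [0,t] is W t - W 0. *)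

definition additive_sde_solution ::
  "'w measure \<Rightarrow> (real \<Rightarrow> 'w measure) \<Rightarrow> (real \<Rightarrow> 'w \<Rightarrow> real ^ 'm) \<Rightarrow>
   (real ^ 'm \<Rightarrow> real ^ 'm) \<Rightarrow> real ^ 'm \<Rightarrow> real \<Rightarrow> (real \<Rightarrow> 'w \<Rightarrow> real ^ 'm) \<Rightarrow> bool" where
  "additive_sde_solution M F W f x0 T X \<longleftrightarrow>
     (\<forall>t\<in>{0..T}. X t \<in> borel_measurable (F t)) \<and>
     (AE \<omega> in M. continuous_on {0..T} (\<lambda>t. X t \<omega>)) \<and>
     (AE \<omega> in M. (\<lambda>s. f (X s \<omega>)) absolutely_integrable_on {0..T} \<and>
        (\<forall>t\<in>{0..T}. X t \<omega> = x0 + integral {0..t} (\<lambda>s. f (X s \<omega>)) + (W t \<omega> - W 0 \<omega>)))"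

(* The adaptive Euler-Maruyama scheme along a single driving path w, with timestep function h:
   em_grid f h w x0 n is the pair of the n-th grid time and the numerical value there. *)

primrec em_grid ::
  "(real ^ 'm \<Rightarrow> real ^ 'm) \<Rightarrow> (real ^ 'm \<Rightarrow> real) \<Rightarrow> (real \<Rightarrow> real ^ 'm) \<Rightarrow> real ^ 'm \<Rightarrow>
   nat \<Rightarrow> real \<times> (real ^ 'm)" where
  "em_grid f h w x0 0 = (0, x0)"
| "em_grid f h w x0 (Suc n) =
     (let (t, x) = em_grid f h w x0 n; t' = t + h x
      in (t', x + h x *\<^sub>R f x + (w t' - w t)))"

(* The index n below is that of the last grid time not exceeding t.  It is meaningful only for t
   smaller than the limit of the grid times; beyond it the set of indices is infinite, and the
   interpolant has an unspecified value. *)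

definition em_interpolant ::
  "(real ^ 'm \<Rightarrow> real ^ 'm) \<Rightarrow> (real ^ 'm \<Rightarrow> real) \<Rightarrow> (real \<Rightarrow> real ^ 'm) \<Rightarrow> real ^ 'm \<Rightarrow>
   real \<Rightarrow> real ^ 'm" where
  "em_interpolant f h w x0 t =
     (let n = Max {n. fst (em_grid f h w x0 n) \<le> t};
          s = fst (em_grid f h w x0 n);
          x = snd (em_grid f h w x0 n)
      in x + (t - s) *\<^sub>R f x + (w t - w s))"

end

theory Submission
  imports Defs
begin

text \<open>
The noise is additive, so the error \<open>e = Xhat - X\<close> is absolutely continuous along every path and the
whole comparison of \<open>Xhat\<close> with \<open>X\<close> can be made pathwise. Let \<open>A\<close> be the defect of the scheme: the
integral over \<open>[0,t]\<close> of \<open>f (Xhat s) - f (Xhat s')\<close>, where \<open>s'\<close> is the last grid time before \<open>s\<close>. Then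
\<open>y = e + A\<close> satisfies \<open>y' = f Xhat - f X\<close> with \<open>X = Xhat + A - y\<close>. Comparing \<open>f\<close> at \<open>Xhat + A\<close> with \<open>f\<close> at \<open>X\<close>
by the one-sided Lipschitz condition, and at \<open>Xhat\<close> with \<open>Xhat + A\<close> by the local Lipschitz condition,
Gronwall's lemma gives \<open>sup |e| \<le> C * sup |A|\<close> with \<open>C\<close> polynomial in \<open>sup |Xhat|\<close> and \<open>sup |A|\<close>.

The defect is of order \<open>\<delta>\<close> and not merely \<open>\<delta>\<close> to the power one half. Expanding \<open>f\<close> to first order at
the grid values \<open>x n\<close>, the leading term of \<open>A\<close> is the sum of \<open>J (x n)\<close> applied to the integral of
\<open>W s - W (t n)\<close> over the \<open>n\<close>-th step, which is \<open>\<delta>\<close> times a martingale \<open>m n\<close> with moments bounded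
uniformly in \<open>\<delta>\<close>. What remains is controlled by \<open>\<delta> * t n\<close> and by \<open>\<delta> * r n\<close>, where \<open>\<delta> * r n\<close> is the integral of
\<open>|W s - W s'|\<^sup>2\<close> up to \<open>t n\<close>. Hence, if \<open>K\<close> bounds \<open>|x n|\<close> and \<open>|m n|\<close>, and up to a constant \<open>r n\<close>, at all grid times up to \<open>T\<close>
and bounds \<open>|W|\<close> on \<open>[0,T]\<close>, then \<open>sup |e| \<le> \<delta> * P K\<close> for a polynomially bounded \<open>P\<close> independent of \<open>\<delta>\<close>
(\<open>em_path.error_bound\<close>, \<open>poly_bounded_error_factor\<close>).

It remains to see that the best such \<open>K\<close> has tails decaying faster than every power, uniformly in
\<open>\<delta>\<close>. Grid times are stopping times and each step length is known at the start of the step, so over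
one step the Brownian increment has the conditional moments of a Gaussian with that variance. This
version of the strong Markov property (\<open>increment_moment\<close>, \<open>increment_mean_zero\<close>) is proved by
approximating the two ends of the step from above by dyadic times. Expanding even powers of the
norm to second order then shows that \<open>V = 1 + |x|\<^sup>2\<^sup>N + |m|\<^sup>2\<^sup>n\<close> grows in conditional mean by at most the factor
\<open>exp (C h)\<close> in a step of length \<open>h\<close>, the drift being harmless by the condition that ties the step
length to \<open>f\<close>. Thus \<open>exp (- C * t n) * V\<close> is a supermartingale, and stopping it when \<open>V\<close> first exceeds a
level yields the tails of \<open>x\<close> and \<open>m\<close> (\<open>lyapunov_maximal\<close>, \<open>exceeds_tail\<close>); those of \<open>r\<close> follow from
Markov's inequality (\<open>quad_exceeds_tail\<close>). The supremum of \<open>|W|\<close> is the case \<open>f = 0\<close> with dyadic steps.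
\<close>

section \<open>Polynomially bounded functions\<close>

text \<open>Bounds are only needed for \<open>K \<ge> 1\<close>, where powers of \<open>K\<close> are monotone in the exponent; this makes the
class closed under sums and products without tracking degrees.\<close>

definition poly_bounded :: "(real \<Rightarrow> real) \<Rightarrow> bool" where
  "poly_bounded g \<longleftrightarrow> (\<exists>C k. \<forall>K\<ge>1. 0 \<le> g K \<and> g K \<le> C * K ^ k)"

lemma poly_bounded_const: "0 \<le> c \<Longrightarrow> poly_bounded (\<lambda>_. c)"
  unfolding poly_bounded_def by (intro exI[of _ c] exI[of _ 0]) simp

lemma poly_bounded_ident: "poly_bounded (\<lambda>K. K)"
  unfolding poly_bounded_def by (intro exI[of _ 1] exI[of _ 1]) simp

lemma poly_bounded_mult:
  assumes "poly_bounded g" "poly_bounded h" shows "poly_bounded (\<lambda>K. g K * h K)"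
proof -
  obtain C k D l where *: "\<And>K. K \<ge> 1 \<Longrightarrow> 0 \<le> g K \<and> g K \<le> C * K ^ k" "\<And>K. K \<ge> 1 \<Longrightarrow> 0 \<le> h K \<and> h K \<le> D * K ^ l"
    using assms unfolding poly_bounded_def by metis
  have "g K * h K \<le> (C * D) * K ^ (k + l)" if "K \<ge> 1" for K
  proof -
    have "g K * h K \<le> (C * K ^ k) * (D * K ^ l)"
      using *[OF that] by (intro mult_mono) auto
    then show ?thesis by (simp add: power_add mult_ac)
  qed
  then show ?thesis unfolding poly_bounded_def using * by (meson mult_nonneg_nonneg)
qed

lemma poly_bounded_add:
  assumes "poly_bounded g" "poly_bounded h" shows "poly_bounded (\<lambda>K. g K + h K)"
proof -
  obtain C k D l where *: "\<And>K. K \<ge> 1 \<Longrightarrow> 0 \<le> g K \<and> g K \<le> C * K ^ k" "\<And>K. K \<ge> 1 \<Longrightarrow> 0 \<le> h K \<and> h K \<le> D * K ^ l"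
    using assms unfolding poly_bounded_def by metis
  have "g K + h K \<le> (\<bar>C\<bar> + \<bar>D\<bar>) * K ^ (k + l)" if "K \<ge> 1" for K
  proof -
    have "C * K ^ k \<le> \<bar>C\<bar> * K ^ (k + l)" "D * K ^ l \<le> \<bar>D\<bar> * K ^ (k + l)"
      using that by (auto intro!: mult_mono power_increasing)
    then show ?thesis using *[OF that] by (simp add: algebra_simps)
  qed
  then show ?thesis unfolding poly_bounded_def using * by (meson add_nonneg_nonneg)
qed

lemma poly_bounded_power: "poly_bounded g \<Longrightarrow> poly_bounded (\<lambda>K. g K ^ n)"
  by (induction n) (auto intro: poly_bounded_mult poly_bounded_const)

lemmas poly_bounded_intros = poly_bounded_const poly_bounded_ident poly_bounded_mult
  poly_bounded_add poly_bounded_power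

section \<open>The error along one path\<close>

abbreviation em_time where "em_time f h w x0 n \<equiv> fst (em_grid f h w x0 n)"
abbreviation em_val where "em_val f h w x0 n \<equiv> snd (em_grid f h w x0 n)"

lemma em_time_Suc: "em_time f h w x0 (Suc n) = em_time f h w x0 n + h (em_val f h w x0 n)"
  by (simp add: Let_def split_beta)

lemma em_val_Suc: "em_val f h w x0 (Suc n) = em_val f h w x0 n
   + h (em_val f h w x0 n) *\<^sub>R f (em_val f h w x0 n)
   + (w (em_time f h w x0 (Suc n)) - w (em_time f h w x0 n))"
  by (simp add: Let_def split_beta)

text \<open>Rescaling the step to the unit interval makes its length, which is random along the scheme, an
argument of the integrand: \<open>h\<close> times this mean is the integral of \<open>w s - w t\<close> over the step.\<close>

definition mean_increment :: "(real \<Rightarrow> real ^ 'm) \<Rightarrow> real \<Rightarrow> real \<Rightarrow> real ^ 'm" where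
  "mean_increment w t h = (LBINT s:{0..1}. w (t + s * h) - w t)"

definition mean_sq_increment :: "(real \<Rightarrow> real ^ 'm) \<Rightarrow> real \<Rightarrow> real \<Rightarrow> real" where
  "mean_sq_increment w t h = (LBINT s:{0..1}. (norm (w (t + s * h) - w t))\<^sup>2)"

text \<open>The part of the defect that is linear in the Brownian increments, divided by \<open>\<delta>\<close>. Its summands
carry the factor \<open>h / \<delta>\<close>, which is at most \<open>T\<close>.\<close>

primrec em_mart ::
  "real \<Rightarrow> (real ^ 'm \<Rightarrow> real ^ 'm ^ 'm) \<Rightarrow> (real ^ 'm \<Rightarrow> real ^ 'm) \<Rightarrow> (real ^ 'm \<Rightarrow> real) \<Rightarrow>
   (real \<Rightarrow> real ^ 'm) \<Rightarrow> real ^ 'm \<Rightarrow> nat \<Rightarrow> real ^ 'm" where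
  "em_mart \<delta> J f h w x0 0 = 0"
| "em_mart \<delta> J f h w x0 (Suc n) = em_mart \<delta> J f h w x0 n +
     (h (em_val f h w x0 n) / \<delta>) *\<^sub>R
       (J (em_val f h w x0 n) *v mean_increment w (em_time f h w x0 n) (h (em_val f h w x0 n)))"

text \<open>The integral up to the \<open>n\<close>-th grid time of the squared distance of \<open>w\<close> from its value at the
preceding grid time, divided by \<open>\<delta>\<close>.\<close>

primrec em_quad ::
  "real \<Rightarrow> (real ^ 'm \<Rightarrow> real ^ 'm) \<Rightarrow> (real ^ 'm \<Rightarrow> real) \<Rightarrow>
   (real \<Rightarrow> real ^ 'm) \<Rightarrow> real ^ 'm \<Rightarrow> nat \<Rightarrow> real" where
  "em_quad \<delta> f h w x0 0 = 0"
| "em_quad \<delta> f h w x0 (Suc n) = em_quad \<delta> f h w x0 n +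
     h (em_val f h w x0 n) / \<delta> *
       mean_sq_increment w (em_time f h w x0 n) (h (em_val f h w x0 n))"

lemma norm_matrix_vector_mult_le: "norm (A *v x) \<le> norm A * norm x"
  for A :: "real ^ 'n ^ 'm" and x :: "real ^ 'n"
proof -
  have "norm (A *v x) = L2_set (\<lambda>i. norm ((A *v x) $ i)) UNIV" by (simp add: norm_vec_def)
  also have "\<dots> \<le> L2_set (\<lambda>i. norm (A $ i) * norm x) UNIV"
    by (intro L2_set_mono) (auto simp: matrix_vector_mul_component Cauchy_Schwarz_ineq2)
  also have "\<dots> = L2_set (\<lambda>i. norm (A $ i)) UNIV * norm x"
    by (simp add: L2_set_left_distrib)
  also have "\<dots> = norm A * norm x" by (simp add: norm_vec_def)
  finally show ?thesis .
qed

lemma onorm_matrix_le_norm: "onorm ((*v) A) \<le> norm A" for A :: "real ^ 'n ^ 'm"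
  by (rule onorm_bound) (auto simp: norm_matrix_vector_mult_le)

lemma mean_increment_eq:
  assumes w: "continuous_on UNIV w" and h: "0 < h"
  shows "h *\<^sub>R mean_increment w t h = integral {t..t + h} (\<lambda>s. w s - w t)"
    and "h * mean_sq_increment w t h = integral {t..t + h} (\<lambda>s. (norm (w s - w t))\<^sup>2)"
proof -
  have *: "h *\<^sub>R (LBINT s:{0..1}. g (t + s * h)) = integral {t..t + h} g"
    if g: "continuous_on UNIV g" for g :: "real \<Rightarrow> 'c::euclidean_space"
  proof -
    have c: "continuous_on {0..1} (\<lambda>s. g (t + s * h))"
      by (rule continuous_on_compose2[OF g]) (auto intro!: continuous_intros)
    have 1: "(LBINT s:{0..1}. g (t + s * h)) = integral {0..1} (\<lambda>s. g (t + s * h))"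
      by (rule set_borel_integral_eq_integral(2)) (rule borel_integrable_atLeastAtMost'[OF c])
    have "(g has_integral integral {t..t + h} g) (cbox t (t + h))"
      using integrable_continuous_interval[OF continuous_on_subset[OF g]]
      by (simp add: has_integral_integral)
    have img: "(\<lambda>x. (x - t) / h) ` {t..t + h} = {0..1}"
    proof (intro set_eqI iffI)
      fix s assume "s \<in> {0..1::real}"
      then show "s \<in> (\<lambda>x. (x - t) / h) ` {t..t + h}"
        using h by (intro image_eqI[of _ _ "s * h + t"]) (auto simp: mult_left_le_one_le)
    qed (use h in \<open>auto simp: field_simps\<close>)
    from has_integral_affinity[OF \<open>(g has_integral _) _\<close>, of h t] h
    have "((\<lambda>s. g (h * s + t)) has_integral (1 / h) *\<^sub>R integral {t..t + h} g) {0..1}"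
      using img by (simp add: diff_divide_distrib)
    then have "integral {0..1} (\<lambda>s. g (t + s * h)) = (1 / h) *\<^sub>R integral {t..t + h} g"
      by (simp add: integral_unique algebra_simps)
    with 1 h show ?thesis by simp
  qed
  show "h *\<^sub>R mean_increment w t h = integral {t..t + h} (\<lambda>s. w s - w t)"
    unfolding mean_increment_def by (rule *) (intro continuous_intros w)
  show "h * mean_sq_increment w t h = integral {t..t + h} (\<lambda>s. (norm (w s - w t))\<^sup>2)"
    unfolding mean_sq_increment_def
    using *[of "\<lambda>s. (norm (w s - w t))\<^sup>2", OF continuous_on_power[OF continuous_on_norm[OF continuous_on_diff[OF w continuous_on_const]]]]
    by simp
qed

lemma mean_sq_increment_nonneg: "0 \<le> mean_sq_increment w t h"
  unfolding mean_sq_increment_def set_lebesgue_integral_def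
  by (intro integral_nonneg_AE) auto

text \<open>The forcing term is absorbed by \<open>2 * |y| * B \<le> |y|\<^sup>2 + B\<^sup>2\<close>, which raises the rate by one; then
\<open>exp (- (\<alpha> + 1) * s) * |y s|\<^sup>2 - B\<^sup>2 * s\<close> is nonincreasing.\<close>

lemma one_sided_gronwall:
  fixes y y' :: "real \<Rightarrow> 'a::real_inner"
  assumes d: "\<And>t. t \<in> {0..T} \<Longrightarrow> (y has_vector_derivative y' t) (at t within {0..T})"
    and y0: "y 0 = 0" and B: "0 \<le> B" and \<alpha>: "0 \<le> \<alpha>"
    and le: "\<And>t. t \<in> {0..T} \<Longrightarrow> y t \<bullet> y' t \<le> \<alpha> / 2 * (norm (y t))\<^sup>2 + norm (y t) * B"
    and t: "t \<in> {0..T}"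
  shows "norm (y t) \<le> B * sqrt (T * exp ((\<alpha> + 1) * T))"
proof -
  define u where "u s = exp (- (\<alpha> + 1) * s) * (y s \<bullet> y s) - B\<^sup>2 * s" for s
  define u' where "u' s = exp (- (\<alpha> + 1) * s) * (2 * (y s \<bullet> y' s)) - (\<alpha> + 1) * exp (- (\<alpha> + 1) * s) * (y s \<bullet> y s) - B\<^sup>2" for s
  have du: "(u has_real_derivative u' s) (at s within {0..t})" if "s \<in> {0..t}" for s
  proof -
    have "(y has_vector_derivative y' s) (at s within {0..t})"
      using d[of s] that t by (auto intro: has_vector_derivative_within_subset)
    from bounded_bilinear.has_vector_derivative[OF bounded_bilinear_inner this this]
    have "((\<lambda>s. y s \<bullet> y s) has_real_derivative (2 * (y s \<bullet> y' s))) (at s within {0..t})"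
      by (simp add: has_real_derivative_iff_has_vector_derivative inner_commute)
    then show ?thesis unfolding u_def u'_def
      by (auto intro!: derivative_eq_intros simp: algebra_simps)
  qed
  have u'_le: "u' s \<le> 0" if s: "s \<in> {0..t}" for s
  proof -
    have "2 * (y s \<bullet> y' s) \<le> \<alpha> * (norm (y s))\<^sup>2 + 2 * (norm (y s) * B)"
      using le[of s] s t by auto
    also have "2 * (norm (y s) * B) \<le> (norm (y s))\<^sup>2 + B\<^sup>2"
      using sum_squares_bound[of "norm (y s)" B] by simp
    finally have *: "2 * (y s \<bullet> y' s) \<le> (\<alpha> + 1) * (norm (y s))\<^sup>2 + B\<^sup>2"
      by (simp add: algebra_simps)
    have "u' s = exp (- (\<alpha> + 1) * s) * (2 * (y s \<bullet> y' s) - (\<alpha> + 1) * (norm (y s))\<^sup>2) - B\<^sup>2"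
      by (simp add: u'_def algebra_simps power2_norm_eq_inner)
    also have "\<dots> \<le> exp (- (\<alpha> + 1) * s) * B\<^sup>2 - B\<^sup>2"
      using * by (intro diff_right_mono mult_left_mono) auto
    also have "\<dots> \<le> 0"
    proof -
      have "exp (- (\<alpha> + 1) * s) \<le> 1"
        using s \<alpha> by (simp add: mult_nonpos_nonneg)
      from mult_right_mono[OF this, of "B\<^sup>2"] show ?thesis by simp
    qed
    finally show ?thesis .
  qed
  have cont: "continuous_on {0..t} u"
    by (rule DERIV_continuous_on) (use du in auto)
  have "u t \<le> u 0"
  proof (rule DERIV_nonpos_imp_decreasing_open[where f = u and a = 0 and b = t])
    show "\<exists>y. DERIV u s :> y \<and> y \<le> 0" if "0 < s" "s < t" for s
      using du[of s] u'_le[of s] that by (auto simp: at_within_Icc_at)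
  qed (use t cont in auto)
  then have "exp (- (\<alpha> + 1) * t) * (y t \<bullet> y t) \<le> B\<^sup>2 * t"
    by (simp add: u_def y0)
  then have "y t \<bullet> y t \<le> B\<^sup>2 * t * exp ((\<alpha> + 1) * t)"
    by (simp add: exp_minus field_simps exp_diff exp_add mult_exp_exp[symmetric])
  also have "\<dots> \<le> B\<^sup>2 * T * exp ((\<alpha> + 1) * T)"
    using t \<alpha> by (intro mult_mono) auto
  finally have "(norm (y t))\<^sup>2 \<le> B\<^sup>2 * (T * exp ((\<alpha> + 1) * T))"
    by (simp add: power2_norm_eq_inner)
  from real_sqrt_le_mono[OF this] show ?thesis
    using B by (simp add: real_sqrt_mult)
qed


text \<open>With \<open>K\<close> as in \<open>em_path\<close> below, the following are, in turn: a bound for the interpolant; a bound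
on the ball of that radius for \<open>f\<close>, its Jacobian and their Lipschitz constants; the factor in front
of the remainder of the first-order expansion of \<open>f\<close>; and bounds for the defect and for the error,
both divided by \<open>\<delta>\<close>.\<close>

definition path_radius :: "real \<Rightarrow> real \<Rightarrow> nat \<Rightarrow> real \<Rightarrow> real" where
  "path_radius T L l K = (3 + T * L) * K ^ l"

definition path_growth :: "real \<Rightarrow> real \<Rightarrow> nat \<Rightarrow> real \<Rightarrow> real" where
  "path_growth T L l K = L * path_radius T L l K ^ l"

definition path_remainder :: "real \<Rightarrow> real \<Rightarrow> nat \<Rightarrow> real \<Rightarrow> real" where
  "path_remainder T L l K = (3 + 2 * T) * path_growth T L l K ^ 3"

definition defect_factor :: "real \<Rightarrow> real \<Rightarrow> nat \<Rightarrow> real \<Rightarrow> real" where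
  "defect_factor T L l K = K + path_remainder T L l K * (T\<^sup>2 + (T + 1) * K) + 2 * path_growth T L l K * T"

definition error_factor :: "real \<Rightarrow> real \<Rightarrow> nat \<Rightarrow> real \<Rightarrow> real \<Rightarrow> real" where
  "error_factor T L l \<alpha> K = defect_factor T L l K *
    (1 + L * (path_radius T L l K + defect_factor T L l K) ^ l * sqrt (T * exp ((\<alpha> + 1) * T)))"

lemma poly_bounded_error_factor:
  assumes "0 \<le> T" "0 \<le> L" shows "poly_bounded (error_factor T L l \<alpha>)"
  unfolding error_factor_def defect_factor_def path_remainder_def path_growth_def path_radius_def
  using assms by (intro poly_bounded_intros) auto

text \<open>One realisation \<open>w\<close> of the driving path, with a single bound \<open>K\<close> for everything that is random.
The factor \<open>T + 1\<close> in the bound for \<open>em_quad\<close> comes from its tail estimate, where a term \<open>T * K\<close> is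
split off.\<close>

locale em_path =
  fixes f :: "real ^ 'm \<Rightarrow> real ^ 'm" and J :: "real ^ 'm \<Rightarrow> real ^ 'm ^ 'm"
    and h :: "real ^ 'm \<Rightarrow> real" and w :: "real \<Rightarrow> real ^ 'm" and x0 :: "real ^ 'm"
    and \<delta> T L \<alpha> K :: real and l :: nat
  assumes \<delta>: "0 < \<delta>" "\<delta> \<le> 1" and T: "0 < T" and L: "1 \<le> L" and l: "1 \<le> l"
    and \<alpha>: "0 < \<alpha>" and K: "1 \<le> K"
    and step_pos: "\<And>x. 0 < h x" and step_le: "\<And>x. h x \<le> \<delta> * T"
    and step_lower: "\<exists>c>0. \<forall>x. norm x \<le> K \<longrightarrow> c \<le> h x"
    and w: "continuous_on UNIV w" and w0: "w 0 = 0"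
    and deriv: "\<And>x. (f has_derivative ((*v) (J x))) (at x)"
    and growth: "\<And>R x. 1 \<le> R \<Longrightarrow> norm x \<le> R \<Longrightarrow> norm (f x) \<le> L * R ^ l"
      "\<And>R x. 1 \<le> R \<Longrightarrow> norm x \<le> R \<Longrightarrow> norm (J x) \<le> L * R ^ l"
    and lipschitz: "\<And>R x y. 1 \<le> R \<Longrightarrow> norm x \<le> R \<Longrightarrow> norm y \<le> R \<Longrightarrow>
        norm (f x - f y) \<le> L * R ^ l * norm (x - y)"
      "\<And>R x y. 1 \<le> R \<Longrightarrow> norm x \<le> R \<Longrightarrow> norm y \<le> R \<Longrightarrow>
        norm (J x - J y) \<le> L * R ^ l * norm (x - y)"
    and one_sided: "\<And>x y. (x - y) \<bullet> (f x - f y) \<le> \<alpha> / 2 * (norm (x - y))\<^sup>2"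
    and val_le: "\<And>n. em_time f h w x0 n \<le> T \<Longrightarrow> norm (em_val f h w x0 n) \<le> K"
    and mart_le: "\<And>n. em_time f h w x0 n \<le> T \<Longrightarrow> norm (em_mart \<delta> J f h w x0 n) \<le> K"
    and quad_le: "\<And>n. em_time f h w x0 n \<le> T \<Longrightarrow> em_quad \<delta> f h w x0 n \<le> (T + 1) * K"
    and w_le: "\<And>s. s \<in> {0..T} \<Longrightarrow> norm (w s) \<le> K"
begin

abbreviation "t n \<equiv> em_time f h w x0 n"
abbreviation "x n \<equiv> em_val f h w x0 n"
abbreviation "m n \<equiv> em_mart \<delta> J f h w x0 n"
abbreviation "r n \<equiv> em_quad \<delta> f h w x0 n"
abbreviation "Y \<equiv> em_interpolant f h w x0"

lemma t_step: "t n < t (Suc n)"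
  by (simp add: em_time_Suc step_pos del: em_grid.simps)

lemma t_mono: "n \<le> k \<Longrightarrow> t n \<le> t k"
  by (rule lift_Suc_mono_le[of t]) (use t_step less_imp_le in blast)

lemma t_nonneg: "0 \<le> t n"
  using t_mono[of 0 n] by simp

text \<open>The grid values stay in the ball of radius \<open>K\<close> as long as the grid has not passed \<open>T\<close>, and there the
step lengths are bounded away from zero.\<close>

lemma exceeds_T: "\<exists>n. T < t n"
proof (rule ccontr)
  assume "\<not> ?thesis"
  then have le: "t n \<le> T" for n by (simp add: not_less)
  obtain c where c: "c > 0" "\<And>x. norm x \<le> K \<Longrightarrow> c \<le> h x" using step_lower by blast
  have "real n * c \<le> t n" for n
  proof (induction n)
    case (Suc n)
    then show ?case using c(2)[OF val_le[OF le[of n]]]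
      by (simp add: em_time_Suc algebra_simps del: em_grid.simps)
  qed simp
  moreover obtain n where "T < real n * c" using c(1) reals_Archimedean3 by blast
  ultimately show False using le[of n] by (meson leD order_trans)
qed

lemma grid_interval:
  assumes "0 \<le> s" "s \<le> T" obtains n where "t n \<le> s" "s < t (Suc n)"
proof -
  obtain N where N: "T < t N" using exceeds_T by blast
  define n where "n = (LEAST n. s < t n)"
  have n: "s < t n" unfolding n_def by (rule LeastI[of _ N]) (use N assms in simp)
  then obtain k where k: "n = Suc k" using assms by (cases n) auto
  have "\<not> s < t k" using not_less_Least[of k "\<lambda>n. s < t n"] k n_def by simp
  then show thesis using that[of k] n k by (simp del: em_grid.simps)
qed

lemma Y_eq_left:
  assumes "t n \<le> s" "s < t (Suc n)"
  shows "Y s = x n + (s - t n) *\<^sub>R f (x n) + (w s - w (t n))"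
proof -
  have "{k. t k \<le> s} = {..n}"
  proof (intro set_eqI iffI; simp)
    fix k assume k: "t k \<le> s"
    show "k \<le> n"
    proof (rule ccontr)
      assume "\<not> k \<le> n"
      then have "t (Suc n) \<le> t k" by (intro t_mono) simp
      then show False using k assms by linarith
    qed
  next
    fix k assume "k \<le> n"
    then have "t k \<le> t n" by (rule t_mono)
    then show "t k \<le> s" using assms by simp
  qed
  then have "Max {k. t k \<le> s} = n" by (auto intro!: Max_eqI)
  then show ?thesis unfolding em_interpolant_def Let_def by simp
qed

lemma Y_grid: "Y (t n) = x n"
  using Y_eq_left[of n "t n"] t_step by (simp del: em_grid.simps)

text \<open>At the right end of the step the definition of the interpolant already refers to the next grid
point, whose value continues the formula of the current step.\<close>

lemma Y_eq:
  assumes "t n \<le> s" "s \<le> t (Suc n)"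
  shows "Y s = x n + (s - t n) *\<^sub>R f (x n) + (w s - w (t n))"
proof (cases "s = t (Suc n)")
  case True
  then show ?thesis using Y_grid[of "Suc n"] em_val_Suc[of f h w x0 n] em_time_Suc[of f h w x0 n]
    by (simp del: em_grid.simps)
qed (use Y_eq_left assms in auto)

lemma Y_continuous_grid: "continuous_on {0..t n} Y"
proof (induction n)
  case (Suc n)
  have "continuous_on {t n..t (Suc n)} (\<lambda>s. x n + (s - t n) *\<^sub>R f (x n) + (w s - w (t n)))"
    by (intro continuous_intros continuous_on_subset[OF w]) auto
  then have "continuous_on {t n..t (Suc n)} Y"
    by (rule continuous_on_eq) (rule Y_eq[symmetric], auto simp del: em_grid.simps)
  from continuous_on_closed_Un[OF _ _ Suc this] show ?case
    using t_nonneg[of n] t_step[of n]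
    by (simp add: ivl_disj_un_two_touch del: em_grid.simps)
qed simp

lemma Y_continuous: "continuous_on {0..T} Y"
proof -
  obtain N where N: "T < t N" using exceeds_T by blast
  then show ?thesis by (intro continuous_on_subset[OF Y_continuous_grid[of N]]) auto
qed

lemma f_continuous: "continuous_on UNIV f"
  by (meson deriv continuous_at_imp_continuous_on has_derivative_continuous)

abbreviation "R1 \<equiv> path_radius T L l K"
abbreviation "Q \<equiv> path_growth T L l K"
abbreviation "P \<equiv> path_remainder T L l K"
abbreviation "a \<equiv> defect_factor T L l K"

lemma pow_ge: "1 \<le> K ^ l" "K \<le> K ^ l"
  using K l by (auto intro: self_le_power)

lemma R1_ge: "K \<le> R1" "1 \<le> R1"
proof -
  have "1 * K ^ l \<le> R1" unfolding path_radius_def using T L K by (intro mult_right_mono) auto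
  then show "K \<le> R1" "1 \<le> R1" using pow_ge K by auto
qed

lemma Q_ge: "1 \<le> Q" "L * K ^ l \<le> Q"
proof -
  have "1 * 1 \<le> Q" unfolding path_growth_def using L R1_ge by (intro mult_mono) (auto intro: one_le_power)
  then show "1 \<le> Q" by simp
  show "L * K ^ l \<le> Q" unfolding path_growth_def using L R1_ge K by (intro mult_left_mono power_mono) auto
qed

lemma step_le_T: "h y \<le> T"
proof -
  have "\<delta> * T \<le> 1 * T" using \<delta> T by (intro mult_right_mono) auto
  then show ?thesis using step_le[of y] by simp
qed

text \<open>The interpolant leaves \<open>x n\<close> by a drift term of size \<open>(s - t n) * |f (x n)|\<close> and a Brownian term. In
the expansion of \<open>f\<close> at \<open>x n\<close> the Brownian term is kept to first order, everything else being of
first order in \<open>s - t n\<close> or quadratic in the Brownian increment.\<close>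

lemma Y_local:
  assumes n: "t n \<le> s" "s \<le> t (Suc n)" and s: "s \<le> T"
  shows "norm (Y s) \<le> R1"
    and "norm (f (x n)) \<le> Q" "norm (J (x n)) \<le> Q"
    and "norm (f (Y s) - f (x n)) \<le> 2 * Q"
    and "norm (f (Y s) - f (x n) - J (x n) *v (w s - w (t n)))
      \<le> (3 + 2 * T) * Q ^ 3 * ((s - t n) + (norm (w s - w (t n)))\<^sup>2)"
proof -
  have tn: "t n \<le> T" "0 \<le> t n" "t n \<in> {0..T}" "s \<in> {0..T}" using n s t_nonneg[of n] by auto
  have xn: "norm (x n) \<le> K" using val_le tn by auto
  have st: "0 \<le> s - t n" "s - t n \<le> T"
    using n step_le_T[of "x n"] by (auto simp: em_time_Suc simp del: em_grid.simps)
  have f1: "norm (f (x n)) \<le> L * K ^ l" using growth(1)[OF K xn] .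
  have w1: "norm (w s) \<le> K" "norm (w (t n)) \<le> K" using w_le tn by blast+
  have Yx: "Y s - x n = (s - t n) *\<^sub>R f (x n) + (w s - w (t n))"
    using Y_eq[OF n] by simp
  have sf: "norm ((s - t n) *\<^sub>R f (x n)) \<le> (s - t n) * Q" "norm ((s - t n) *\<^sub>R f (x n)) \<le> T * (L * K ^ l)"
    using st f1 Q_ge mult_mono[OF st(2) f1] T by (auto intro!: mult_left_mono order_trans[OF f1])
  have "norm (Y s) \<le> norm (x n) + norm ((s - t n) *\<^sub>R f (x n)) + (norm (w s) + norm (w (t n)))"
    unfolding Y_eq[OF n] by (intro order_trans[OF norm_triangle_ineq] add_mono norm_triangle_ineq norm_triangle_ineq4)
  also have "\<dots> \<le> K + T * (L * K ^ l) + (K + K)"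
    using xn sf w1 by (intro add_mono) auto
  also have "\<dots> \<le> R1" unfolding path_radius_def using pow_ge by (simp add: algebra_simps)
  finally show Y1: "norm (Y s) \<le> R1" .
  have x1: "norm (x n) \<le> R1" using xn R1_ge by simp
  show fQ: "norm (f (x n)) \<le> Q" using f1 Q_ge by simp
  show JQ: "norm (J (x n)) \<le> Q" using growth(2)[OF K xn] Q_ge by simp
  have "norm (f (Y s)) \<le> Q" unfolding path_growth_def by (rule growth(1)[OF R1_ge(2) Y1])
  then show "norm (f (Y s) - f (x n)) \<le> 2 * Q"
    using norm_triangle_ineq4[of "f (Y s)" "f (x n)"] fQ by simp
  define a where "a = norm (w s - w (t n))"
  define d where "d = s - t n"
  have seg: "norm z \<le> R1" "norm (z - x n) \<le> norm (Y s - x n)" if "z \<in> closed_segment (x n) (Y s)" for z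
  proof -
    have "closed_segment (x n) (Y s) \<subseteq> cball 0 R1"
      using x1 Y1 by (intro closed_segment_subset) auto
    then show "norm z \<le> R1" using that by auto
    show "norm (z - x n) \<le> norm (Y s - x n)"
      using segment_bound1[OF that] .
  qed
  have "norm (f (Y s) - f (x n) - J (x n) *v (Y s - x n)) \<le> norm (Y s - x n) * (Q * norm (Y s - x n))"
  proof (rule differentiable_bound_linearization[where S = "closed_segment (x n) (Y s)" and f' = "\<lambda>z. (*v) (J z)"])
    show "x n + u *\<^sub>R (Y s - x n) \<in> closed_segment (x n) (Y s)" if "u \<in> {0..1}" for u
      using that by (auto simp: closed_segment_def algebra_simps intro!: exI[of _ u])
    show "(f has_derivative (*v) (J z)) (at z within closed_segment (x n) (Y s))" for z
      by (rule has_derivative_at_withinI[OF deriv])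
    fix z assume z: "z \<in> closed_segment (x n) (Y s)"
    have "onorm ((*v) (J z) - (*v) (J (x n))) \<le> norm (J z - J (x n))"
    proof -
      have "(*v) (J z) - (*v) (J (x n)) = (*v) (J z - J (x n))"
        by (simp add: fun_eq_iff matrix_vector_mult_diff_rdistrib)
      then show ?thesis using onorm_matrix_le_norm[of "J z - J (x n)"] by simp
    qed
    also have "\<dots> \<le> Q * norm (z - x n)" unfolding path_growth_def by (rule lipschitz(2)[OF R1_ge(2) seg(1)[OF z] x1])
    also have "\<dots> \<le> Q * norm (Y s - x n)" using seg(2)[OF z] Q_ge by (intro mult_left_mono) auto
    finally show "onorm ((*v) (J z) - (*v) (J (x n))) \<le> Q * norm (Y s - x n)" .
  qed auto
  also have "\<dots> = Q * (norm (Y s - x n))\<^sup>2" by (simp add: power2_eq_square)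
  also have "\<dots> \<le> Q * (2 * (T * Q\<^sup>2 * d) + 2 * a\<^sup>2)"
  proof (intro mult_left_mono)
    have "norm (Y s - x n) \<le> d * Q + a"
      unfolding Yx a_def d_def using sf by (intro order_trans[OF norm_triangle_ineq] add_mono) auto
    then have "(norm (Y s - x n))\<^sup>2 \<le> (d * Q + a)\<^sup>2" by (rule power_mono) simp
    also have "\<dots> \<le> 2 * (d * Q)\<^sup>2 + 2 * a\<^sup>2"
      using sum_squares_bound[of "d * Q" a] by (simp add: power2_sum)
    also have "(d * Q)\<^sup>2 \<le> T * Q\<^sup>2 * d"
    proof -
      have "d * d \<le> T * d" using st by (intro mult_right_mono) (auto simp: d_def)
      from mult_right_mono[OF this, of "Q\<^sup>2"] show ?thesis by (simp add: power2_eq_square mult_ac)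
    qed
    finally show "(norm (Y s - x n))\<^sup>2 \<le> 2 * (T * Q\<^sup>2 * d) + 2 * a\<^sup>2" by simp
  qed (use Q_ge in simp)
  finally have 1: "norm (f (Y s) - f (x n) - J (x n) *v (Y s - x n)) \<le> 2 * T * Q ^ 3 * d + 2 * Q * a\<^sup>2"
    by (simp add: algebra_simps power3_eq_cube power2_eq_square)
  have 2: "norm (J (x n) *v (d *\<^sub>R f (x n))) \<le> Q ^ 2 * d"
  proof -
    have "norm (J (x n) *v (d *\<^sub>R f (x n))) \<le> Q * (d * Q)"
      using sf(1) JQ Q_ge by (intro order_trans[OF norm_matrix_vector_mult_le] mult_mono) (auto simp: d_def)
    then show ?thesis by (simp add: power2_eq_square mult_ac)
  qed
  have eq: "f (Y s) - f (x n) - J (x n) *v (w s - w (t n)) =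
    (f (Y s) - f (x n) - J (x n) *v (Y s - x n)) + J (x n) *v (d *\<^sub>R f (x n))"
    unfolding Yx d_def by (simp add: matrix_vector_right_distrib)
  have "norm (f (Y s) - f (x n) - J (x n) *v (w s - w (t n)))
      \<le> 2 * T * Q ^ 3 * d + 2 * Q * a\<^sup>2 + Q ^ 2 * d"
    unfolding eq by (intro order_trans[OF norm_triangle_ineq] add_mono 1 2)
  also have "\<dots> \<le> 2 * T * Q ^ 3 * d + 2 * Q ^ 3 * a\<^sup>2 + Q ^ 3 * d"
  proof -
    have "Q \<le> Q ^ 3" "Q\<^sup>2 \<le> Q ^ 3" using Q_ge by (auto intro: self_le_power power_increasing)
    then show ?thesis using st by (intro add_mono mult_right_mono mult_left_mono) (auto simp: d_def)
  qed
  also have "\<dots> \<le> (3 + 2 * T) * Q ^ 3 * (d + a\<^sup>2)"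
  proof -
    have "0 \<le> Q ^ 3 * d" "0 \<le> Q ^ 3 * a\<^sup>2" "0 \<le> T * (Q ^ 3 * a\<^sup>2)" using st Q_ge T by (auto simp: d_def)
    then show ?thesis by (simp add: algebra_simps)
  qed
  finally show "norm (f (Y s) - f (x n) - J (x n) *v (w s - w (t n)))
      \<le> (3 + 2 * T) * Q ^ 3 * ((s - t n) + (norm (w s - w (t n)))\<^sup>2)"
    by (simp add: a_def d_def)
qed


text \<open>Since \<open>Y s - x0 - w s\<close> is the integral of the frozen drift, \<open>A\<close> is the defect of the scheme.\<close>

definition "A s = integral {0..s} (\<lambda>u. f (Y u)) - (Y s - x0 - w s)"

lemma P_nonneg: "0 \<le> P" unfolding path_remainder_def using T Q_ge by auto

lemma fY_continuous: "S \<subseteq> {0..T} \<Longrightarrow> continuous_on S (\<lambda>u. f (Y u))"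
  by (rule continuous_on_compose2[OF f_continuous continuous_on_subset[OF Y_continuous]]) auto

lemma A_local:
  assumes n: "t n \<le> s" "s \<le> t (Suc n)" and s: "s \<le> T"
  shows "A s - A (t n) = integral {t n..s} (\<lambda>u. f (Y u) - f (x n))"
proof -
  have i: "(\<lambda>u. f (Y u)) integrable_on {a..b}" if "0 \<le> a" "b \<le> T" for a b
    by (rule integrable_continuous_interval[OF fY_continuous]) (use that in auto)
  have "integral {0..s} (\<lambda>u. f (Y u)) = integral {0..t n} (\<lambda>u. f (Y u)) + integral {t n..s} (\<lambda>u. f (Y u))"
    by (rule Henstock_Kurzweil_Integration.integral_combine[symmetric]) (use n s t_nonneg[of n] i in auto)
  moreover have "integral {t n..s} (\<lambda>u. f (Y u) - f (x n)) = integral {t n..s} (\<lambda>u. f (Y u)) - (s - t n) *\<^sub>R f (x n)"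
    using n s t_nonneg[of n] i by (subst Henstock_Kurzweil_Integration.integral_diff) auto
  ultimately show ?thesis unfolding A_def Y_grid Y_eq[OF n] by simp
qed

lemma A_grid_step:
  assumes n: "t (Suc n) \<le> T"
  shows "norm (A (t (Suc n)) - A (t n) - \<delta> *\<^sub>R (m (Suc n) - m n))
    \<le> P * \<delta> * (T * (t (Suc n) - t n) + (r (Suc n) - r n))"
proof -
  define v where "v u = w u - w (t n)" for u
  define d where "d = h (x n)"
  have tS: "t (Suc n) = t n + d" by (simp add: em_time_Suc d_def del: em_grid.simps)
  have tn: "t n \<le> t (Suc n)" "0 \<le> t n" using t_step[of n] t_nonneg[of n] by auto
  have v: "continuous_on S v" for S unfolding v_def by (intro continuous_intros continuous_on_subset[OF w]) auto
  have vi: "v integrable_on {t n..t (Suc n)}" by (rule integrable_continuous_interval[OF v])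
  have v2i: "(\<lambda>u. (norm (v u))\<^sup>2) integrable_on {t n..t (Suc n)}"
    by (intro integrable_continuous_interval continuous_on_power continuous_on_norm v)
  have lin: "bounded_linear ((*v) (J (x n)))" by (rule matrix_vector_mul_bounded_linear)
  have "{t n..t (Suc n)} \<subseteq> {0..T}" using tn n by (auto simp del: em_grid.simps)
  then have fc: "continuous_on {t n..t (Suc n)} (\<lambda>u. f (Y u) - f (x n))"
    by (intro continuous_on_diff continuous_on_const fY_continuous)
  have Jc: "continuous_on {t n..t (Suc n)} (\<lambda>u. J (x n) *v v u)"
    by (rule bounded_linear.continuous_on[OF lin v])
  have "\<delta> *\<^sub>R (m (Suc n) - m n) = J (x n) *v (d *\<^sub>R mean_increment w (t n) d)"
    using \<delta> by (simp add: d_def matrix_vector_mult_scaleR)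
  also have "\<dots> = J (x n) *v integral {t n..t (Suc n)} v"
    using mean_increment_eq(1)[OF w step_pos, of "x n" "t n"] tS unfolding v_def d_def by (simp del: em_grid.simps)
  also have "\<dots> = integral {t n..t (Suc n)} (\<lambda>u. J (x n) *v v u)"
    using integral_linear[OF vi lin] by (simp add: o_def)
  finally have "A (t (Suc n)) - A (t n) - \<delta> *\<^sub>R (m (Suc n) - m n)
     = integral {t n..t (Suc n)} (\<lambda>u. f (Y u) - f (x n)) - integral {t n..t (Suc n)} (\<lambda>u. J (x n) *v v u)"
    using A_local[OF tn(1) order_refl n] by (simp del: em_grid.simps em_mart.simps)
  also have "\<dots> = integral {t n..t (Suc n)} (\<lambda>u. f (Y u) - f (x n) - J (x n) *v v u)"
    by (rule Henstock_Kurzweil_Integration.integral_diff[OF fc[THEN integrable_continuous_interval]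
          Jc[THEN integrable_continuous_interval], symmetric])
  finally have eq: "A (t (Suc n)) - A (t n) - \<delta> *\<^sub>R (m (Suc n) - m n)
     = integral {t n..t (Suc n)} (\<lambda>u. f (Y u) - f (x n) - J (x n) *v v u)" .
  have "norm (A (t (Suc n)) - A (t n) - \<delta> *\<^sub>R (m (Suc n) - m n)) \<le> integral {t n..t (Suc n)} (\<lambda>u. P * (\<delta> * T + (norm (v u))\<^sup>2))"
    unfolding eq
  proof (rule integral_norm_bound_integral)
    show "(\<lambda>u. f (Y u) - f (x n) - J (x n) *v v u) integrable_on {t n..t (Suc n)}"
      by (intro integrable_continuous_interval continuous_on_diff[OF fc Jc])
    show "(\<lambda>u. P * (\<delta> * T + (norm (v u))\<^sup>2)) integrable_on {t n..t (Suc n)}"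
      by (intro integrable_continuous_interval continuous_on_mult continuous_on_const continuous_on_add
          continuous_on_power continuous_on_norm v)
    fix u assume u: "u \<in> {t n..t (Suc n)}"
    have "norm (f (Y u) - f (x n) - J (x n) *v v u) \<le> P * ((u - t n) + (norm (v u))\<^sup>2)"
      unfolding v_def path_remainder_def using u n by (intro Y_local(5)) auto
    also have "\<dots> \<le> P * (\<delta> * T + (norm (v u))\<^sup>2)"
      using u tS step_le[of "x n"] P_nonneg by (intro mult_left_mono) (auto simp: d_def simp del: em_grid.simps)
    finally show "norm (f (Y u) - f (x n) - J (x n) *v v u) \<le> P * (\<delta> * T + (norm (v u))\<^sup>2)" .
  qed
  also have "\<dots> = P * (d * (\<delta> * T) + integral {t n..t (Suc n)} (\<lambda>u. (norm (v u))\<^sup>2))"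
  proof -
    have "integral {t n..t (Suc n)} (\<lambda>u. \<delta> * T + (norm (v u))\<^sup>2)
        = integral {t n..t (Suc n)} (\<lambda>u. \<delta> * T) + integral {t n..t (Suc n)} (\<lambda>u. (norm (v u))\<^sup>2)"
      by (rule Henstock_Kurzweil_Integration.integral_add[OF integrable_const_ivl v2i])
    moreover have "integral {t n..t (Suc n)} (\<lambda>u. \<delta> * T) = d * (\<delta> * T)"
      unfolding tS using step_pos[of "x n"] by (simp add: d_def)
    ultimately show ?thesis by (simp only: Henstock_Kurzweil_Integration.integral_mult_right)
  qed
  also have "integral {t n..t (Suc n)} (\<lambda>u. (norm (v u))\<^sup>2) = \<delta> * (r (Suc n) - r n)"
    using mean_increment_eq(2)[OF w step_pos, of "x n" "t n"] tS \<delta> unfolding v_def d_def by (simp del: em_grid.simps)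
  also have "P * (d * (\<delta> * T) + \<delta> * (r (Suc n) - r n)) = P * \<delta> * (T * (t (Suc n) - t n) + (r (Suc n) - r n))"
    unfolding tS by (simp add: algebra_simps)
  finally show ?thesis .
qed

lemma A_0: "A 0 = 0"
  using Y_grid[of 0] w0 by (simp add: A_def)

lemma A_grid: "t n \<le> T \<Longrightarrow> norm (A (t n) - \<delta> *\<^sub>R m n) \<le> P * \<delta> * (T * t n + r n)"
proof (induction n)
  case (Suc n)
  have tn: "t n \<le> T" using Suc.prems t_step[of n] by simp
  have eq: "A (t (Suc n)) - \<delta> *\<^sub>R m (Suc n) = (A (t n) - \<delta> *\<^sub>R m n) + (A (t (Suc n)) - A (t n) - \<delta> *\<^sub>R (m (Suc n) - m n))"
    by (simp add: algebra_simps del: em_grid.simps em_mart.simps)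
  have "norm (A (t (Suc n)) - \<delta> *\<^sub>R m (Suc n)) \<le> P * \<delta> * (T * t n + r n) + P * \<delta> * (T * (t (Suc n) - t n) + (r (Suc n) - r n))"
    unfolding eq by (intro order_trans[OF norm_triangle_ineq] add_mono Suc.IH tn A_grid_step Suc.prems)
  also have "\<dots> = P * \<delta> * (T * t (Suc n) + r (Suc n))" by (simp add: algebra_simps del: em_grid.simps em_quad.simps)
  finally show ?case .
qed (simp add: A_0)

lemma a_nonneg: "0 \<le> a" unfolding defect_factor_def using K T Q_ge P_nonneg by auto

text \<open>At grid times the leading part is \<open>\<delta> * m n\<close>. Inside the last, incomplete step no cancellation is
needed, because the step itself is no longer than \<open>\<delta> * T\<close>.\<close>

lemma A_bound:
  assumes s: "s \<in> {0..T}" shows "norm (A s) \<le> \<delta> * a"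
proof -
  obtain n where n: "t n \<le> s" "s < t (Suc n)" using grid_interval[of s] s by auto
  then have tn: "t n \<le> T" using s by auto
  have "norm (A s - A (t n)) \<le> (2 * Q) * (s - t n)"
    unfolding A_local[OF n(1) less_imp_le[OF n(2)] atLeastAtMost_iff[THEN iffD1, THEN conjunct2, OF s]]
  proof (rule integral_bound)
    show "continuous_on {t n..s} (\<lambda>u. f (Y u) - f (x n))"
      using n s t_nonneg[of n] by (intro continuous_intros fY_continuous) auto
    show "norm (f (Y u) - f (x n)) \<le> 2 * Q" if "u \<in> {t n..s}" for u
      by (rule Y_local(4)) (use that n s in auto)
  qed (use n in auto)
  also have "\<dots> \<le> (2 * Q) * (\<delta> * T)"
    using n step_le[of "x n"] Q_ge by (intro mult_left_mono) (auto simp: em_time_Suc simp del: em_grid.simps)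
  finally have 1: "norm (A s - A (t n)) \<le> (2 * Q) * (\<delta> * T)" .
  have 2: "norm (A (t n) - \<delta> *\<^sub>R m n) \<le> P * \<delta> * (T * T + (T + 1) * K)"
    using A_grid[OF tn] quad_le[OF tn] tn T P_nonneg \<delta>
    by (elim order_trans) (intro mult_left_mono add_mono, auto)
  have 3: "norm (\<delta> *\<^sub>R m n) \<le> \<delta> * K" using mart_le[OF tn] \<delta> by (auto intro: mult_left_mono)
  have eq: "A s = (A s - A (t n)) + (A (t n) - \<delta> *\<^sub>R m n) + \<delta> *\<^sub>R m n" by simp
  have "norm (A s) \<le> (2 * Q) * (\<delta> * T) + P * \<delta> * (T * T + (T + 1) * K) + \<delta> * K"
    by (subst eq) (intro order_trans[OF norm_triangle_ineq] add_mono 1 2 3)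
  also have "\<dots> = \<delta> * a" unfolding defect_factor_def by (simp add: algebra_simps power2_eq_square)
  finally show ?thesis .
qed

lemma Y_bound: "s \<in> {0..T} \<Longrightarrow> norm (Y s) \<le> R1"
  using grid_interval[of s] Y_local(1)[of _ s] by (metis atLeastAtMost_iff less_imp_le)

text \<open>With \<open>y = (Y - X) + A\<close> one has \<open>X = Y + A - y\<close>. The one-sided condition is applied to the pair \<open>Y + A\<close>, \<open>X\<close>,
whose difference is exactly \<open>y\<close>; replacing \<open>f Y\<close> by \<open>f (Y + A)\<close> costs a Lipschitz constant on a ball
that does not depend on \<open>X\<close>.\<close>

lemma error_bound:
  fixes X :: "real \<Rightarrow> real ^ 'm"
  assumes X: "continuous_on {0..T} X"
    and X_eq: "\<And>s. s \<in> {0..T} \<Longrightarrow> X s = x0 + integral {0..s} (\<lambda>u. f (X u)) + w s"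
    and s: "s \<in> {0..T}"
  shows "norm (Y s - X s) \<le> \<delta> * error_factor T L l \<alpha> K"
proof -
  define y where "y s = integral {0..s} (\<lambda>u. f (Y u) - f (X u))" for s
  define B where "B = L * (R1 + a) ^ l * (\<delta> * a)"
  have B: "0 \<le> B" unfolding B_def using L R1_ge a_nonneg \<delta> by auto
  have fX: "S \<subseteq> {0..T} \<Longrightarrow> continuous_on S (\<lambda>u. f (X u))" for S
    by (rule continuous_on_compose2[OF f_continuous continuous_on_subset[OF X]]) auto
  have YX: "Y s - X s = y s - A s" if "s \<in> {0..T}" for s
  proof -
    have "y s = integral {0..s} (\<lambda>u. f (Y u)) - integral {0..s} (\<lambda>u. f (X u))"
      unfolding y_def using that
      by (intro Henstock_Kurzweil_Integration.integral_diff integrable_continuous_interval fX fY_continuous) auto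
    then show ?thesis unfolding A_def using X_eq[OF that] by simp
  qed
  have "norm (y s) \<le> B * sqrt (T * exp ((\<alpha> + 1) * T))"
  proof (rule one_sided_gronwall[where y' = "\<lambda>u. f (Y u) - f (X u)", OF _ _ B _ _ s])
    show "(y has_vector_derivative f (Y u) - f (X u)) (at u within {0..T})" if "u \<in> {0..T}" for u
      unfolding y_def by (rule integral_has_vector_derivative[OF _ that]) (intro continuous_intros fX fY_continuous order_refl)
    show "y u \<bullet> (f (Y u) - f (X u)) \<le> \<alpha> / 2 * (norm (y u))\<^sup>2 + norm (y u) * B" if u: "u \<in> {0..T}" for u
    proof -
      have Xu: "X u = Y u + A u - y u" using YX[OF u] by (simp add: algebra_simps)
      have Au: "norm (A u) \<le> a"
        using A_bound[OF u] mult_right_mono[OF \<delta>(2) a_nonneg] by simp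
      have R: "1 \<le> R1 + a" "norm (Y u) \<le> R1 + a" "norm (Y u + A u) \<le> R1 + a"
        using R1_ge a_nonneg Y_bound[OF u] Au norm_triangle_ineq[of "Y u" "A u"] by auto
      \<comment> \<open>The ball contains \<open>Y\<close> and \<open>Y + A\<close>; the point \<open>X\<close> enters only through the one-sided condition.\<close>
      have "norm (f (Y u) - f (Y u + A u)) \<le> L * (R1 + a) ^ l * norm (Y u - (Y u + A u))"
        by (rule lipschitz(1)[OF R])
      also have "\<dots> \<le> B" unfolding B_def using A_bound[OF u] L R by (intro mult_left_mono) auto
      finally have 1: "norm (f (Y u) - f (Y u + A u)) \<le> B" .
      have "y u \<bullet> (f (Y u) - f (X u)) = y u \<bullet> (f (Y u + A u) - f (X u)) + y u \<bullet> (f (Y u) - f (Y u + A u))"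
        by (simp add: inner_diff_right)
      also have "y u \<bullet> (f (Y u + A u) - f (X u)) \<le> \<alpha> / 2 * (norm (y u))\<^sup>2"
        using one_sided[of "Y u + A u" "X u"] by (simp add: Xu)
      also have "y u \<bullet> (f (Y u) - f (Y u + A u)) \<le> norm (y u) * B"
        using 1 by (intro order_trans[OF norm_cauchy_schwarz] mult_left_mono) auto
      finally show ?thesis by simp
    qed
  qed (use \<alpha> in \<open>auto simp: y_def\<close>)
  then have "norm (Y s - X s) \<le> B * sqrt (T * exp ((\<alpha> + 1) * T)) + \<delta> * a"
    unfolding YX[OF s] using A_bound[OF s] by (intro order_trans[OF norm_triangle_ineq4] add_mono)
  also have "\<dots> = \<delta> * error_factor T L l \<alpha> K" unfolding error_factor_def B_def by (simp add: algebra_simps)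
  finally show ?thesis .
qed

end

section \<open>Gaussian increments\<close>

lemma borel_measurable_vec_nth [measurable (raw)]:
  fixes D :: "'w \<Rightarrow> real ^ 'm"
  assumes "D \<in> borel_measurable M" shows "(\<lambda>\<omega>. D \<omega> $ i) \<in> borel_measurable M"
  using borel_measurable_inner[OF assms borel_measurable_const[of "axis i 1"]] by (simp add: inner_axis)

lemma Basis_real_vec: "(Basis :: (real ^ 'm) set) = range (\<lambda>i. axis i 1)"
  by (auto simp: Basis_vec_def)

text \<open>The other coordinates of the product density integrate to one.\<close>

lemma distributed_component:
  fixes D :: "'w \<Rightarrow> real ^ 'm"
  assumes D: "distributed M lborel D (\<lambda>x. ennreal (\<Prod>i\<in>UNIV. normal_density 0 \<sigma> (x $ i)))" and \<sigma>: "0 < \<sigma>"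
  shows "distributed M lborel (\<lambda>\<omega>. D \<omega> $ i) (\<lambda>x. ennreal (normal_density 0 \<sigma> x))"
proof -
  have [measurable]: "D \<in> borel_measurable M" using distributed_measurable[OF D] by simp
  have "distr M lborel (\<lambda>\<omega>. D \<omega> $ i) = density lborel (\<lambda>x. ennreal (normal_density 0 \<sigma> x))"
  proof (rule measure_eqI)
    fix A assume "A \<in> sets (distr M lborel (\<lambda>\<omega>. D \<omega> $ i))"
    then have A[measurable]: "A \<in> sets borel" by simp
    define g where "g b x = ennreal (normal_density 0 \<sigma> x) * (if b = axis i 1 then indicator A x else 1)"
      for b :: "real ^ 'm" and x :: real
    have inj: "inj (\<lambda>j. axis j (1::real) :: real ^ 'm)" by (auto simp: inj_on_def axis_eq_axis)
    have [measurable]: "\<And>b. g b \<in> borel_measurable borel"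
      unfolding g_def by measurable
    have "emeasure (distr M lborel (\<lambda>\<omega>. D \<omega> $ i)) A = (\<integral>\<^sup>+\<omega>. indicator A (D \<omega> $ i) \<partial>M)"
    proof -
      have "emeasure (distr M lborel (\<lambda>\<omega>. D \<omega> $ i)) A = (\<integral>\<^sup>+x. indicator A x \<partial>distr M lborel (\<lambda>\<omega>. D \<omega> $ i))"
        by simp
      also have "\<dots> = (\<integral>\<^sup>+\<omega>. indicator A (D \<omega> $ i) \<partial>M)"
        by (rule nn_integral_distr) measurable
      finally show ?thesis .
    qed
    also have "\<dots> = (\<integral>\<^sup>+x. ennreal (\<Prod>j\<in>UNIV. normal_density 0 \<sigma> (x $ j)) * indicator A (x $ i) \<partial>lborel)"
      by (rule distributed_nn_integral[OF D, symmetric]) measurable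
    also have "\<dots> = (\<integral>\<^sup>+x. (\<Prod>b\<in>Basis. g b (x \<bullet> b)) \<partial>lborel)"
    proof (rule nn_integral_cong)
      fix x :: "real ^ 'm"
      have "(\<Prod>b\<in>Basis. g b (x \<bullet> b)) = (\<Prod>j\<in>UNIV. g (axis j 1) (x $ j))"
        unfolding Basis_real_vec by (subst prod.reindex[OF inj]) (simp add: inner_axis)
      also have "\<dots> = (\<Prod>j\<in>UNIV. ennreal (normal_density 0 \<sigma> (x $ j))) * (\<Prod>j\<in>UNIV. if j = i then indicator A (x $ j) else 1)"
        unfolding g_def by (simp add: prod.distrib axis_eq_axis)
      also have "\<dots> = ennreal (\<Prod>j\<in>UNIV. normal_density 0 \<sigma> (x $ j)) * indicator A (x $ i)"
        by (simp add: prod_ennreal prod.delta)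
      finally show "ennreal (\<Prod>j\<in>UNIV. normal_density 0 \<sigma> (x $ j)) * indicator A (x $ i) = (\<Prod>b\<in>Basis. g b (x \<bullet> b))" by simp
    qed
    also have "\<dots> = (\<Prod>b\<in>Basis. \<integral>\<^sup>+x. g b x \<partial>lborel)"
      by (rule nn_integral_lborel_prod) auto
    also have "\<dots> = (\<Prod>j\<in>UNIV. \<integral>\<^sup>+x. g (axis j (1::real)) x \<partial>lborel)"
      unfolding Basis_real_vec by (subst prod.reindex[OF inj]) simp
    also have "\<dots> = (\<Prod>j\<in>UNIV. if j = i then \<integral>\<^sup>+x. ennreal (normal_density 0 \<sigma> x) * indicator A x \<partial>lborel else 1)"
    proof (rule prod.cong[OF refl])
      fix j :: 'm
      have "(\<integral>\<^sup>+x. ennreal (normal_density 0 \<sigma> x) \<partial>lborel) = 1"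
        using \<sigma> by (subst nn_integral_eq_integral) auto
      then show "(\<integral>\<^sup>+x. g (axis j (1::real)) x \<partial>lborel) = (if j = i then \<integral>\<^sup>+x. ennreal (normal_density 0 \<sigma> x) * indicator A x \<partial>lborel else 1)"
        unfolding g_def by (simp add: axis_eq_axis)
    qed
    also have "\<dots> = emeasure (density lborel (\<lambda>x. ennreal (normal_density 0 \<sigma> x))) A"
      by (simp add: emeasure_density)
    finally show "emeasure (distr M lborel (\<lambda>\<omega>. D \<omega> $ i)) A = emeasure (density lborel (\<lambda>x. ennreal (normal_density 0 \<sigma> x))) A" .
  qed simp
  then show ?thesis unfolding distributed_def by auto
qed

text \<open>The \<open>2 * k\<close>-th moment of a real standard Gaussian, times the loss in passing from the norm to
the coordinates by \<open>sum_power_le\<close>.\<close>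

definition gauss_moment :: "'m itself \<Rightarrow> nat \<Rightarrow> real" where
  "gauss_moment _ k = real CARD('m) ^ k * (real CARD('m) * (fact (2 * k) / (2 ^ k * fact k)))"

lemma gauss_moment_nonneg: "0 \<le> gauss_moment TYPE('m::finite) k"
  unfolding gauss_moment_def by simp

lemma sum_power_le:
  fixes a :: "'i \<Rightarrow> real"
  assumes "finite I" "\<And>i. i \<in> I \<Longrightarrow> 0 \<le> a i" "I \<noteq> {}"
  shows "(\<Sum>i\<in>I. a i) ^ k \<le> real (card I) ^ k * (\<Sum>i\<in>I. a i ^ k)"
proof -
  define b where "b = Max (a ` I)"
  have "b \<in> a ` I" unfolding b_def using assms by (intro Max_in) auto
  then obtain j where j: "j \<in> I" "b = a j" by auto
  have "(\<Sum>i\<in>I. a i) \<le> real (card I) * b"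
    using assms by (intro sum_bounded_above) (auto simp: b_def)
  then have "(\<Sum>i\<in>I. a i) ^ k \<le> (real (card I) * b) ^ k"
    using assms by (intro power_mono sum_nonneg) auto
  also have "\<dots> = real (card I) ^ k * a j ^ k" by (simp add: power_mult_distrib j)
  also have "\<dots> \<le> real (card I) ^ k * (\<Sum>i\<in>I. a i ^ k)"
    using assms j by (intro mult_left_mono member_le_sum) auto
  finally show ?thesis .
qed

lemma gaussian_norm_moment:
  fixes D :: "'w \<Rightarrow> real ^ 'm"
  assumes D: "distributed M lborel D (\<lambda>x. ennreal (\<Prod>i\<in>UNIV. normal_density 0 \<sigma> (x $ i)))" and \<sigma>: "0 < \<sigma>"
  shows "(\<integral>\<^sup>+\<omega>. ennreal (norm (D \<omega>) ^ (2 * k)) \<partial>M) \<le> ennreal (gauss_moment TYPE('m) k * (\<sigma>\<^sup>2) ^ k)"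
proof -
  have [measurable]: "D \<in> borel_measurable M" using distributed_measurable[OF D] by simp
  define c where "c = real CARD('m) ^ k"
  define e where "e = (\<sigma>\<^sup>2) ^ k * (fact (2 * k) / (2 ^ k * fact k))"
  have c0: "0 \<le> c" "0 \<le> e" unfolding c_def e_def by auto
  have comp: "(\<integral>\<^sup>+\<omega>. ennreal ((D \<omega> $ i) ^ (2 * k)) \<partial>M) = ennreal e" for i
  proof -
    have "(\<integral>\<^sup>+\<omega>. ennreal ((D \<omega> $ i) ^ (2 * k)) \<partial>M)
       = (\<integral>\<^sup>+x. ennreal (normal_density 0 \<sigma> x) * ennreal (x ^ (2 * k)) \<partial>lborel)"
      by (rule distributed_nn_integral[OF distributed_component[OF D \<sigma>], symmetric]) measurable
    also have "\<dots> = (\<integral>\<^sup>+x. ennreal (normal_density 0 \<sigma> x * x ^ (2 * k)) \<partial>lborel)"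
      by (simp add: ennreal_mult)
    also have "\<dots> = ennreal (fact (2 * k) / ((2 / \<sigma>\<^sup>2) ^ k * fact k))"
      using normal_moment_even[OF \<sigma>, of 0 k]
      by (intro nn_integral_eq_integral[THEN trans])
        (auto simp: has_bochner_integral_iff)
    also have "fact (2 * k) / ((2 / \<sigma>\<^sup>2) ^ k * fact k) = e"
      using \<sigma> by (simp add: e_def power_divide)
    finally show ?thesis .
  qed
  have "norm (D \<omega>) ^ (2 * k) \<le> c * (\<Sum>i\<in>UNIV. (D \<omega> $ i) ^ (2 * k))" for \<omega>
  proof -
    have "norm (D \<omega>) ^ (2 * k) = (\<Sum>i\<in>UNIV. (D \<omega> $ i)\<^sup>2) ^ k"
      by (simp add: power_mult norm_vec_def L2_set_def sum_nonneg)
    also have "\<dots> \<le> c * (\<Sum>i\<in>UNIV. ((D \<omega> $ i)\<^sup>2) ^ k)"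
      unfolding c_def by (rule sum_power_le) auto
    finally show ?thesis by (simp add: power_mult)
  qed
  then have "(\<integral>\<^sup>+\<omega>. ennreal (norm (D \<omega>) ^ (2 * k)) \<partial>M)
      \<le> (\<integral>\<^sup>+\<omega>. ennreal c * (\<Sum>i\<in>UNIV. ennreal ((D \<omega> $ i) ^ (2 * k))) \<partial>M)"
    using c0 by (intro nn_integral_mono) (simp add: sum_nonneg sum_ennreal flip: ennreal_mult)
  also have "\<dots> = ennreal c * (\<Sum>i\<in>(UNIV::'m set). ennreal e)"
  proof -
    have "(\<integral>\<^sup>+\<omega>. (\<Sum>i\<in>UNIV. ennreal ((D \<omega> $ i) ^ (2 * k))) \<partial>M) = (\<Sum>i\<in>(UNIV::'m set). ennreal e)"
      by (subst nn_integral_sum) (measurable, simp add: comp)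
    moreover have "(\<lambda>\<omega>. (\<Sum>i\<in>UNIV. ennreal ((D \<omega> $ i) ^ (2 * k)))) \<in> borel_measurable M" by measurable
    ultimately show ?thesis by (simp only: nn_integral_cmult)
  qed
  also have "\<dots> = ennreal (c * (real CARD('m) * e))"
    using c0 by (simp add: ennreal_of_nat_eq_real_of_nat flip: ennreal_mult)
  also have "c * (real CARD('m) * e) = gauss_moment TYPE('m) k * (\<sigma>\<^sup>2) ^ k"
    by (simp add: c_def e_def gauss_moment_def)
  finally show ?thesis .
qed

lemma gaussian_mean_zero:
  fixes D :: "'w \<Rightarrow> real ^ 'm"
  assumes M: "prob_space M" and D: "distributed M lborel D (\<lambda>x. ennreal (\<Prod>i\<in>UNIV. normal_density 0 \<sigma> (x $ i)))" and \<sigma>: "0 < \<sigma>"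
  shows "integrable M (\<lambda>\<omega>. D \<omega> $ i)" "(\<integral>\<omega>. D \<omega> $ i \<partial>M) = 0"
proof -
  note c = distributed_component[OF D \<sigma>, of i]
  show "integrable M (\<lambda>\<omega>. D \<omega> $ i)"
    by (rule distributed_integrable_var[OF c]) (use integrable_normal_moment_nz_1[OF \<sigma>] in auto)
  show "(\<integral>\<omega>. D \<omega> $ i \<partial>M) = 0"
    using prob_space.normal_distributed_expectation[OF M \<sigma> c] .
qed

section \<open>Measurability at random times\<close>

text \<open>The approximation is strictly from above: whether a stopping time \<open>\<tau>\<close> is rounded to \<open>s\<close> is then
decided at time \<open>s\<close>.\<close>

definition dyadic_above :: "nat \<Rightarrow> real \<Rightarrow> real" where
  "dyadic_above i x = (real_of_int \<lfloor>x * 2 ^ i\<rfloor> + 1) / 2 ^ i"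

lemma dyadic_above_bounds: "x < dyadic_above i x" "dyadic_above i x \<le> x + 1 / 2 ^ i"
proof -
  have "x * 2 ^ i / 2 ^ i < (real_of_int \<lfloor>x * 2 ^ i\<rfloor> + 1) / 2 ^ i"
    by (intro divide_strict_right_mono) (linarith, simp)
  then show "x < dyadic_above i x" by (simp add: dyadic_above_def)
  have "(real_of_int \<lfloor>x * 2 ^ i\<rfloor> + 1) / 2 ^ i \<le> (x * 2 ^ i + 1) / 2 ^ i"
    by (intro divide_right_mono) auto
  then show "dyadic_above i x \<le> x + 1 / 2 ^ i" by (simp add: dyadic_above_def add_divide_distrib)
qed

lemma dyadic_above_mono: "x \<le> y \<Longrightarrow> dyadic_above i x \<le> dyadic_above i y"
  unfolding dyadic_above_def by (intro divide_right_mono add_right_mono) (auto intro!: floor_mono)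

lemma dyadic_above_tendsto: "(\<lambda>i. dyadic_above i x) \<longlonglongrightarrow> x"
proof (rule real_tendsto_sandwich[where f = "\<lambda>_. x" and h = "\<lambda>i. x + 1 / 2 ^ i"])
  show "(\<lambda>i. x + 1 / 2 ^ i) \<longlonglongrightarrow> x"
    using tendsto_add[OF tendsto_const LIMSEQ_power_zero[of "1 / 2 :: real"], of x] by (simp add: power_divide)
  show "\<forall>\<^sub>F i in sequentially. x \<le> dyadic_above i x"
    using dyadic_above_bounds(1)[of x] less_imp_le by (intro always_eventually) blast
qed (use dyadic_above_bounds(2) in \<open>auto intro!: always_eventually\<close>)

lemma dyadic_above_measurable [measurable]: "dyadic_above i \<in> borel_measurable borel"
  unfolding dyadic_above_def by measurable

text \<open>A process that is continuous in time is the limit of processes that use only countably many times.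
This allows evaluation at random times and integration over time.\<close>

lemma caratheodory_measurable:
  fixes Z :: "real \<Rightarrow> 'a \<Rightarrow> 'b::metric_space"
  assumes m: "\<And>s. Z s \<in> borel_measurable N"
    and c: "\<And>\<omega>. \<omega> \<in> space N \<Longrightarrow> continuous_on UNIV (\<lambda>s. Z s \<omega>)"
  shows "(\<lambda>(s, \<omega>). Z s \<omega>) \<in> borel_measurable (borel \<Otimes>\<^sub>M N)"
proof (rule borel_measurable_LIMSEQ_metric)
  fix n :: nat
  have [measurable]: "Z s \<in> borel_measurable N" for s by fact
  show "(\<lambda>p. Z (dyadic_above n (fst p)) (snd p)) \<in> borel_measurable (borel \<Otimes>\<^sub>M N)"
    unfolding dyadic_above_def
    by (rule measurable_compose_countable[where f = "\<lambda>i p. Z ((real_of_int i + 1) / 2 ^ n) (snd p)"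
          and g = "\<lambda>p. \<lfloor>fst p * (2 :: real) ^ n\<rfloor>"]) measurable
next
  fix p assume p: "p \<in> space ((borel :: real measure) \<Otimes>\<^sub>M N)"
  then have "snd p \<in> space N" by (auto simp: space_pair_measure)
  from continuous_on_tendsto_compose[OF c[OF this] dyadic_above_tendsto[of "fst p"]]
  show "(\<lambda>n. Z (dyadic_above n (fst p)) (snd p)) \<longlonglongrightarrow> (case p of (s, \<omega>) \<Rightarrow> Z s \<omega>)"
    by (simp add: split_beta)
qed

text \<open>Used to condition on the dyadic values of two random times.\<close>

lemma nn_integral_le_countable:
  fixes g :: "'a \<Rightarrow> 'i::countable"
  assumes [measurable]: "H \<in> borel_measurable M" "H' \<in> borel_measurable M" "g \<in> measurable M (count_space UNIV)"
    and le: "\<And>i. (\<integral>\<^sup>+\<omega>. H \<omega> * indicator {\<omega>. g \<omega> = i} \<omega> \<partial>M) \<le> (\<integral>\<^sup>+\<omega>. H' \<omega> * indicator {\<omega>. g \<omega> = i} \<omega> \<partial>M)"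
  shows "(\<integral>\<^sup>+\<omega>. H \<omega> \<partial>M) \<le> (\<integral>\<^sup>+\<omega>. H' \<omega> \<partial>M)"
proof -
  have eq: "(\<integral>\<^sup>+\<omega>. H \<omega> \<partial>M) = (\<Sum>n. \<integral>\<^sup>+\<omega>. H \<omega> * indicator {\<omega>. to_nat (g \<omega>) = n} \<omega> \<partial>M)"
    if [measurable]: "H \<in> borel_measurable M" for H :: "'a \<Rightarrow> ennreal"
  proof -
    have "(\<Sum>n. H \<omega> * indicator {\<omega>. to_nat (g \<omega>) = n} \<omega>) = H \<omega>" for \<omega>
      by (subst suminf_finite[of "{to_nat (g \<omega>)}"]) auto
    then show ?thesis by (subst nn_integral_suminf[symmetric]) auto
  qed
  have "(\<integral>\<^sup>+\<omega>. H \<omega> * indicator {\<omega>. to_nat (g \<omega>) = n} \<omega> \<partial>M)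
      \<le> (\<integral>\<^sup>+\<omega>. H' \<omega> * indicator {\<omega>. to_nat (g \<omega>) = n} \<omega> \<partial>M)" for n
  proof (cases "n \<in> range (to_nat :: 'i \<Rightarrow> nat)")
    case True
    then obtain i :: 'i where "n = to_nat i" by auto
    then show ?thesis using le[of i] by simp
  next
    case False
    then have "{\<omega>. to_nat (g \<omega>) = n} = {}" by auto
    then show ?thesis by simp
  qed
  then show ?thesis unfolding eq[OF assms(1)] eq[OF assms(2)] by (intro suminf_le) auto
qed

context filtration begin

text \<open>The next grid time of an adaptive scheme is a function of the current state; this is why it is
again a stopping time.\<close>

lemma later_stopping_time:
  fixes \<tau> \<rho> :: "'a \<Rightarrow> 't"
  assumes \<tau>: "stopping_time F \<tau>" and \<rho>: "\<rho> \<in> borel_measurable (pre_sigma \<tau>)"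
    and le: "\<And>\<omega>. \<omega> \<in> \<Omega> \<Longrightarrow> \<tau> \<omega> \<le> \<rho> \<omega>"
  shows "stopping_time F \<rho>"
proof
  fix t
  have "{\<omega> \<in> space (pre_sigma \<tau>). \<rho> \<omega> \<le> t} \<in> sets (pre_sigma \<tau>)" using \<rho> by measurable
  from sets_pre_sigmaD[OF \<tau> this, of t]
  have "{\<omega> \<in> {\<omega> \<in> space (pre_sigma \<tau>). \<rho> \<omega> \<le> t}. \<tau> \<omega> \<le> t} \<in> sets (F t)" .
  also have "{\<omega> \<in> {\<omega> \<in> space (pre_sigma \<tau>). \<rho> \<omega> \<le> t}. \<tau> \<omega> \<le> t} = {\<omega> \<in> space (F t). \<rho> \<omega> \<le> t}"
    using le by (auto simp: space_pre_sigma space_F intro: order_trans)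
  finally show "Measurable.pred (F t) (\<lambda>\<omega>. \<rho> \<omega> \<le> t)" by (simp add: pred_def)
qed

text \<open>On the event that \<open>\<tau>\<close> has occurred by time \<open>s\<close>, whatever is known at \<open>\<tau>\<close> is known at \<open>s\<close>. Vanishing
off this event makes the statement global.\<close>

lemma measurable_pre_sigma_before:
  fixes \<phi> :: "'a \<Rightarrow> 'b::{topological_space, zero}"
  assumes \<tau>: "stopping_time F \<tau>" and \<phi>: "\<phi> \<in> borel_measurable (pre_sigma \<tau>)"
    and supp: "\<And>\<omega>. \<omega> \<in> \<Omega> \<Longrightarrow> \<phi> \<omega> \<noteq> 0 \<Longrightarrow> \<tau> \<omega> \<le> s"
  shows "\<phi> \<in> borel_measurable (F s)"
proof (rule measurableI)
  fix A :: "'b set" assume A: "A \<in> sets borel"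
  have 1: "{\<omega> \<in> \<phi> -` A \<inter> \<Omega>. \<tau> \<omega> \<le> s} \<in> sets (F s)"
    using sets_pre_sigmaD[OF \<tau> measurable_sets[OF \<phi> A], of s] by (simp add: space_pre_sigma)
  have 2: "{\<omega> \<in> \<Omega>. \<not> \<tau> \<omega> \<le> s} \<in> sets (F s)"
    using stopping_timeD[OF \<tau>, of s] by (simp add: space_F[symmetric, of s])
  have "\<phi> -` A \<inter> space (F s) = {\<omega> \<in> \<phi> -` A \<inter> \<Omega>. \<tau> \<omega> \<le> s} \<union> (if 0 \<in> A then {\<omega> \<in> \<Omega>. \<not> \<tau> \<omega> \<le> s} else {})"
    using supp by (auto simp: space_F split: if_splits) metis+
  then show "\<phi> -` A \<inter> space (F s) \<in> sets (F s)" using 1 2 by auto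
qed simp

end

section \<open>Brownian increments between stopping times\<close>

text \<open>Continuity and the starting value hold at every sample point, and the filtration is indexed by all
reals, a filtration that starts at time zero being extended to negative times by its value at
zero.\<close>

locale brownian_process = prob_space M + filtration "space M" F
  for M :: "'w measure" and F :: "real \<Rightarrow> 'w measure" +
  fixes W :: "real \<Rightarrow> 'w \<Rightarrow> real ^ 'm"
  assumes F_sub: "sets (F t) \<subseteq> sets M"
    and W_adapted: "W t \<in> borel_measurable (F t)"
    and W_cont: "\<omega> \<in> space M \<Longrightarrow> continuous_on UNIV (\<lambda>t. W t \<omega>)"
    and W_zero: "W 0 \<omega> = 0"
    and W_normal: "0 \<le> s \<Longrightarrow> s < t \<Longrightarrow> distributed M lborel (\<lambda>\<omega>. W t \<omega> - W s \<omega>)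
          (\<lambda>x. ennreal (\<Prod>i\<in>UNIV. normal_density 0 (sqrt (t - s)) (x $ i)))"
    and W_indep: "0 \<le> s \<Longrightarrow> s < t \<Longrightarrow> indep_set (sets (F s))
          (sets (vimage_algebra (space M) (\<lambda>\<omega>. W t \<omega> - W s \<omega>) borel))"
begin

lemma W_measurable[measurable]: "W t \<in> borel_measurable M"
  using measurable_mono[OF order_refl refl F_sub, of t borel] W_adapted space_F by auto

text \<open>Independence of the past and of the increment carries over to functions \<open>\<phi>\<close> and \<open>g\<close> of them; these are
given values in a common type so that products can be formed.\<close>

lemma increment_indep_var:
  fixes \<phi> :: "'w \<Rightarrow> 'b::topological_space"
  assumes st: "0 \<le> s" "s < t" and \<phi>: "\<phi> \<in> borel_measurable (F s)" and g: "g \<in> borel_measurable borel"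
  shows "indep_var borel \<phi> borel (\<lambda>\<omega>. g (W t \<omega> - W s \<omega>))"
proof -
  let ?D = "\<lambda>\<omega>. W t \<omega> - W s \<omega>"
  have \<phi>M: "\<phi> \<in> borel_measurable M"
    using measurable_mono[OF order_refl refl F_sub, of s borel] \<phi> space_F by auto
  have gM: "(\<lambda>\<omega>. g (?D \<omega>)) \<in> borel_measurable M" using g by measurable
  have 1: "sigma_sets (space M) {\<phi> -` A \<inter> space M |A. A \<in> sets borel} \<subseteq> sets (F s)"
    using measurable_sets[OF \<phi>] by (intro sets.sigma_sets_subset[of _ "F s", unfolded space_F]) (auto simp: space_F)
  have 2: "sigma_sets (space M) {(\<lambda>\<omega>. g (?D \<omega>)) -` A \<inter> space M |A. A \<in> sets borel}
      \<subseteq> sets (vimage_algebra (space M) ?D borel)"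
  proof -
    have "(\<lambda>\<omega>. g (?D \<omega>)) \<in> borel_measurable (vimage_algebra (space M) ?D borel)"
      by (rule measurable_compose[OF measurable_vimage_algebra1 g]) auto
    from measurable_sets[OF this] show ?thesis
      by (intro sets.sigma_sets_subset[of _ "vimage_algebra (space M) ?D borel", unfolded space_vimage_algebra]) auto
  qed
  show ?thesis
    unfolding indep_var_eq
  proof (intro conjI \<phi>M gM)
    show "indep_set (sigma_sets (space M) {\<phi> -` A \<inter> space M |A. A \<in> sets borel})
        (sigma_sets (space M) {(\<lambda>\<omega>. g (?D \<omega>)) -` A \<inter> space M |A. A \<in> sets borel})"
      using W_indep[OF st] unfolding indep_set_def
      by (rule indep_sets_mono_sets) (use 1 2 in \<open>simp split: bool.split\<close>)
  qed
qed

lemma nn_integral_increment: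
  fixes \<phi> :: "'w \<Rightarrow> ennreal"
  assumes st: "0 \<le> s" "s < t" and \<phi>: "\<phi> \<in> borel_measurable (F s)" and g: "g \<in> borel_measurable borel"
  shows "(\<integral>\<^sup>+\<omega>. \<phi> \<omega> * g (W t \<omega> - W s \<omega>) \<partial>M) = (\<integral>\<^sup>+\<omega>. \<phi> \<omega> \<partial>M) * (\<integral>\<^sup>+\<omega>. g (W t \<omega> - W s \<omega>) \<partial>M)"
proof -
  let ?D = "\<lambda>\<omega>. g (W t \<omega> - W s \<omega>)"
  note iv = increment_indep_var[OF st \<phi> g]
  have rv: "\<phi> \<in> borel_measurable M" "?D \<in> borel_measurable M"
    using iv by (auto simp: indep_var_eq)
  have joint: "distr M borel \<phi> \<Otimes>\<^sub>M distr M borel ?D = distr M (borel \<Otimes>\<^sub>M borel) (\<lambda>\<omega>. (\<phi> \<omega>, ?D \<omega>))"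
    using iv unfolding indep_var_distribution_eq by auto
  interpret P1: prob_space "distr M borel \<phi>" by (rule prob_space_distr[OF rv(1)])
  interpret P2: prob_space "distr M borel ?D" by (rule prob_space_distr[OF rv(2)])
  have "(\<integral>\<^sup>+\<omega>. \<phi> \<omega> * ?D \<omega> \<partial>M) = (\<integral>\<^sup>+p. fst p * snd p \<partial>distr M (borel \<Otimes>\<^sub>M borel) (\<lambda>\<omega>. (\<phi> \<omega>, ?D \<omega>)))"
    using rv by (subst nn_integral_distr) auto
  also have "\<dots> = (\<integral>\<^sup>+x. \<integral>\<^sup>+y. x * y \<partial>distr M borel ?D \<partial>distr M borel \<phi>)"
    unfolding joint[symmetric] by (subst P2.nn_integral_fst[symmetric]) auto
  also have "\<dots> = (\<integral>\<^sup>+x. x \<partial>distr M borel \<phi>) * (\<integral>\<^sup>+y. y \<partial>distr M borel ?D)"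
    by (simp add: nn_integral_cmult nn_integral_multc)
  also have "\<dots> = (\<integral>\<^sup>+\<omega>. \<phi> \<omega> \<partial>M) * (\<integral>\<^sup>+\<omega>. ?D \<omega> \<partial>M)"
    using rv by (simp add: nn_integral_distr)
  finally show ?thesis .
qed

lemma integral_increment_zero:
  fixes v :: "'w \<Rightarrow> real"
  assumes st: "0 \<le> s" "s < t" and v: "v \<in> borel_measurable (F s)" and B: "\<And>\<omega>. \<bar>v \<omega>\<bar> \<le> B"
  shows "integrable M (\<lambda>\<omega>. v \<omega> * (W t \<omega> - W s \<omega>) $ i)" "(\<integral>\<omega>. v \<omega> * (W t \<omega> - W s \<omega>) $ i \<partial>M) = 0"
proof -
  have iv: "indep_var borel v borel (\<lambda>\<omega>. (W t \<omega> - W s \<omega>) $ i)"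
    by (rule increment_indep_var[OF st v]) measurable
  then have vM: "v \<in> borel_measurable M" by (auto simp: indep_var_eq)
  have vi: "integrable M v"
    by (rule integrable_const_bound[of _ B]) (use B vM in auto)
  note g = gaussian_mean_zero[OF prob_space_axioms W_normal[OF st], of i]
  have pos: "0 < sqrt (t - s)" using st by simp
  show "integrable M (\<lambda>\<omega>. v \<omega> * (W t \<omega> - W s \<omega>) $ i)"
    by (rule indep_var_integrable[OF iv vi g(1)[OF pos]])
  show "(\<integral>\<omega>. v \<omega> * (W t \<omega> - W s \<omega>) $ i \<partial>M) = 0"
    using indep_var_lebesgue_integral[OF iv vi g(1)[OF pos]] g(2)[OF pos] by simp
qed

lemma pre_sigma_measurable:
  assumes "stopping_time F \<tau>" "\<phi> \<in> measurable (pre_sigma \<tau>) N" shows "\<phi> \<in> measurable M N"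
proof -
  have "sets (pre_sigma \<tau>) \<subseteq> sets M"
  proof
    fix A assume A: "A \<in> sets (pre_sigma \<tau>)"
    have "{\<omega> \<in> A. \<tau> \<omega> \<le> real n} \<in> sets M" for n
      using sets_pre_sigmaD[OF assms(1) A] F_sub by blast
    then have "(\<Union>n. {\<omega> \<in> A. \<tau> \<omega> \<le> real n}) \<in> sets M" by auto
    also have "(\<Union>n. {\<omega> \<in> A. \<tau> \<omega> \<le> real n}) = A" by (auto intro: real_arch_simple)
    finally show "A \<in> sets M" .
  qed
  from measurable_mono[OF order_refl refl this] show ?thesis
    using assms(2) by (auto simp: space_pre_sigma)
qed

lemma pre_sigma_later:
  assumes "stopping_time F \<tau>" "stopping_time F \<rho>" "\<And>\<omega>. \<omega> \<in> space M \<Longrightarrow> \<tau> \<omega> \<le> \<rho> \<omega>"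
    and "\<phi> \<in> measurable (pre_sigma \<tau>) N"
  shows "\<phi> \<in> measurable (pre_sigma \<rho>) N"
  using measurable_mono[OF order_refl refl mono_pre_sigma[OF assms(1,2,3)], of N] assms(4)
  by (auto simp: space_pre_sigma)

text \<open>Up to time \<open>t\<close> the variable \<open>W (\<tau> \<omega>) \<omega>\<close> agrees with \<open>W (min (\<tau> \<omega>) t) \<omega>\<close>, which only involves the process
before \<open>t\<close>.\<close>

lemma W_stopped:
  assumes \<tau>: "stopping_time F \<tau>"
  shows "(\<lambda>\<omega>. W (\<tau> \<omega>) \<omega>) \<in> borel_measurable (pre_sigma \<tau>)"
proof (rule measurableI)
  fix A :: "(real ^ 'm) set" assume A: "A \<in> sets borel"
  show "(\<lambda>\<omega>. W (\<tau> \<omega>) \<omega>) -` A \<inter> space (pre_sigma \<tau>) \<in> sets (pre_sigma \<tau>)"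
  proof (rule sets_pre_sigmaI[OF \<tau>])
    fix t
    have m: "(\<lambda>\<omega>. min (\<tau> \<omega>) t) \<in> borel_measurable (F t)"
    proof (rule borel_measurableI_le)
      fix c show "{\<omega> \<in> space (F t). min (\<tau> \<omega>) t \<le> c} \<in> sets (F t)"
        using stopping_time_le_const[OF \<tau>, of c t] by (cases "t \<le> c") (auto simp: min_le_iff_disj pred_def)
    qed
    have "(\<lambda>(s, \<omega>). W (min s t) \<omega>) \<in> borel_measurable (borel \<Otimes>\<^sub>M F t)"
    proof (rule caratheodory_measurable)
      show "W (min s t) \<in> borel_measurable (F t)" for s
        using measurable_mono[OF order_refl refl sets_F_mono[of "min s t" t], of borel] W_adapted[of "min s t"]
        by (auto simp: space_F)
      show "continuous_on UNIV (\<lambda>s. W (min s t) \<omega>)" if "\<omega> \<in> space (F t)" for \<omega>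
        using that by (intro continuous_on_compose2[OF W_cont] continuous_intros) (auto simp: space_F)
    qed
    from measurable_compose[OF measurable_Pair[OF m measurable_ident] this]
    have "(\<lambda>\<omega>. W (min (\<tau> \<omega>) t) \<omega>) \<in> borel_measurable (F t)" by simp
    from measurable_sets[OF this A] stopping_timeD[OF \<tau>, of t]
    have "((\<lambda>\<omega>. W (min (\<tau> \<omega>) t) \<omega>) -` A \<inter> space (F t)) \<inter> {\<omega> \<in> space (F t). \<tau> \<omega> \<le> t} \<in> sets (F t)"
      by (auto simp: pred_def)
    also have "((\<lambda>\<omega>. W (min (\<tau> \<omega>) t) \<omega>) -` A \<inter> space (F t)) \<inter> {\<omega> \<in> space (F t). \<tau> \<omega> \<le> t}
      = {\<omega> \<in> (\<lambda>\<omega>. W (\<tau> \<omega>) \<omega>) -` A \<inter> space (pre_sigma \<tau>). \<tau> \<omega> \<le> t}"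
      by (auto simp: space_F space_pre_sigma min_def)
    finally show "{\<omega> \<in> (\<lambda>\<omega>. W (\<tau> \<omega>) \<omega>) -` A \<inter> space (pre_sigma \<tau>). \<tau> \<omega> \<le> t} \<in> sets (F t)" .
  qed
qed simp


lemma W_random_time:
  assumes "\<rho> \<in> borel_measurable M" shows "(\<lambda>\<omega>. W (\<rho> \<omega>) \<omega>) \<in> borel_measurable M"
  using measurable_compose[OF measurable_Pair[OF assms measurable_ident]
      caratheodory_measurable[of W M, OF W_measurable W_cont]] by simp

text \<open>Conditionally on the rounded values \<open>s\<close> of \<open>\<tau>\<close> and \<open>t\<close> of \<open>\<rho>\<close>, the increment is \<open>W t - W s\<close>. As \<open>\<rho>\<close> is known
at \<open>\<tau>\<close>, this conditioning is an event of \<open>F s\<close> and hence independent of the increment. For \<open>s = t\<close> the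
left-hand side vanishes, which needs \<open>k \<ge> 1\<close>.\<close>

lemma increment_moment_dyadic:
  fixes \<phi> :: "'w \<Rightarrow> ennreal"
  assumes \<tau>: "stopping_time F \<tau>" and \<tau>0: "\<And>\<omega>. \<omega> \<in> space M \<Longrightarrow> 0 \<le> \<tau> \<omega>"
    and \<rho>: "\<rho> \<in> borel_measurable (pre_sigma \<tau>)" and le: "\<And>\<omega>. \<omega> \<in> space M \<Longrightarrow> \<tau> \<omega> \<le> \<rho> \<omega>"
    and \<phi>: "\<phi> \<in> borel_measurable (pre_sigma \<tau>)" and k: "1 \<le> k"
  shows "(\<integral>\<^sup>+\<omega>. \<phi> \<omega> * ennreal (norm (W (dyadic_above i (\<rho> \<omega>)) \<omega> - W (dyadic_above i (\<tau> \<omega>)) \<omega>) ^ (2 * k)) \<partial>M)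
    \<le> (\<integral>\<^sup>+\<omega>. \<phi> \<omega> * ennreal (gauss_moment TYPE('m) k * (dyadic_above i (\<rho> \<omega>) - dyadic_above i (\<tau> \<omega>)) ^ k) \<partial>M)"
proof -
  note \<tau>m = measurable_stopping_time_pre_sigma[OF \<tau>]
  note [measurable] = pre_sigma_measurable[OF \<tau> \<tau>m] pre_sigma_measurable[OF \<tau> \<rho>] pre_sigma_measurable[OF \<tau> \<phi>]
  have [measurable]: "(\<lambda>\<omega>. W (dyadic_above i (\<rho> \<omega>)) \<omega>) \<in> borel_measurable M" "(\<lambda>\<omega>. W (dyadic_above i (\<tau> \<omega>)) \<omega>) \<in> borel_measurable M"
    by (rule W_random_time; measurable)+
  define g where "g \<omega> = (\<lfloor>\<tau> \<omega> * 2 ^ i\<rfloor>, \<lfloor>\<rho> \<omega> * 2 ^ i\<rfloor>)" for \<omega>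
  have [measurable]: "g \<in> measurable M (count_space UNIV)"
    unfolding g_def by measurable
  show ?thesis
  proof (rule nn_integral_le_countable[where g = g])
    fix pq :: "int \<times> int"
    obtain p q where pq: "pq = (p, q)" by force
    define s where "s = (real_of_int p + 1) / 2 ^ i"
    define t where "t = (real_of_int q + 1) / 2 ^ i"
    define \<psi> where "\<psi> \<omega> = \<phi> \<omega> * indicator {\<omega>. g \<omega> = pq} \<omega>" for \<omega>
    have L: "\<phi> \<omega> * ennreal (norm (W (dyadic_above i (\<rho> \<omega>)) \<omega> - W (dyadic_above i (\<tau> \<omega>)) \<omega>) ^ (2 * k)) * indicator {\<omega>. g \<omega> = pq} \<omega>
      = \<psi> \<omega> * ennreal (norm (W t \<omega> - W s \<omega>) ^ (2 * k))" for \<omega>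
      by (auto simp: \<psi>_def g_def pq s_def t_def dyadic_above_def split: split_indicator)
    have R: "\<phi> \<omega> * ennreal (gauss_moment TYPE('m) k * (dyadic_above i (\<rho> \<omega>) - dyadic_above i (\<tau> \<omega>)) ^ k) * indicator {\<omega>. g \<omega> = pq} \<omega>
      = \<psi> \<omega> * ennreal (gauss_moment TYPE('m) k * (t - s) ^ k)" for \<omega>
      by (auto simp: \<psi>_def g_def pq s_def t_def dyadic_above_def split: split_indicator)
    have "(\<integral>\<^sup>+\<omega>. \<psi> \<omega> * ennreal (norm (W t \<omega> - W s \<omega>) ^ (2 * k)) \<partial>M)
        \<le> (\<integral>\<^sup>+\<omega>. \<psi> \<omega> * ennreal (gauss_moment TYPE('m) k * (t - s) ^ k) \<partial>M)"
    proof (cases "0 \<le> p \<and> p < q")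
      case True
      then have st: "0 \<le> s" "s < t" by (auto simp: s_def t_def divide_strict_right_mono)
      have "\<psi> \<in> borel_measurable (F s)"
      proof (rule measurable_pre_sigma_before[OF \<tau>])
        note [measurable] = \<tau>m \<rho> \<phi>
        show "\<psi> \<in> borel_measurable (pre_sigma \<tau>)"
          unfolding \<psi>_def g_def pq by measurable
        fix \<omega> assume "\<psi> \<omega> \<noteq> 0"
        then have "\<lfloor>\<tau> \<omega> * 2 ^ i\<rfloor> = p" by (auto simp: \<psi>_def g_def pq split: split_indicator_asm)
        then show "\<tau> \<omega> \<le> s" using dyadic_above_bounds(1)[of "\<tau> \<omega>" i] by (simp add: s_def dyadic_above_def)
      qed
      note \<psi> = this
      have "(\<integral>\<^sup>+\<omega>. \<psi> \<omega> * ennreal (norm (W t \<omega> - W s \<omega>) ^ (2 * k)) \<partial>M)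
         = (\<integral>\<^sup>+\<omega>. \<psi> \<omega> \<partial>M) * (\<integral>\<^sup>+\<omega>. ennreal (norm (W t \<omega> - W s \<omega>) ^ (2 * k)) \<partial>M)"
        by (rule nn_integral_increment[OF st \<psi>, of "\<lambda>x. ennreal (norm x ^ (2 * k))"]) measurable
      also have "\<dots> \<le> (\<integral>\<^sup>+\<omega>. \<psi> \<omega> \<partial>M) * ennreal (gauss_moment TYPE('m) k * (t - s) ^ k)"
        using gaussian_norm_moment[OF W_normal[OF st], of k] st by (intro mult_left_mono) auto
      also have "\<dots> = (\<integral>\<^sup>+\<omega>. \<psi> \<omega> * ennreal (gauss_moment TYPE('m) k * (t - s) ^ k) \<partial>M)"
        by (rule nn_integral_multc[symmetric]) (simp add: \<psi>_def)
      finally show ?thesis .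
    next
      case False
      have "\<psi> \<omega> * ennreal (norm (W t \<omega> - W s \<omega>) ^ (2 * k)) = 0" if w: "\<omega> \<in> space M" for \<omega>
      proof (cases "g \<omega> = pq")
        case g: True
        then have "0 \<le> p" "p \<le> q" using \<tau>0[OF w] le[OF w] by (auto simp: g_def pq intro!: floor_mono)
        with False have "p = q" by simp
        then show ?thesis using k by (simp add: s_def t_def)
      qed (simp add: \<psi>_def)
      then have "(\<integral>\<^sup>+\<omega>. \<psi> \<omega> * ennreal (norm (W t \<omega> - W s \<omega>) ^ (2 * k)) \<partial>M) = (\<integral>\<^sup>+\<omega>. 0 \<partial>M)"
        by (intro nn_integral_cong) simp
      then show ?thesis by simp
    qed
    then show "(\<integral>\<^sup>+\<omega>. \<phi> \<omega> * ennreal (norm (W (dyadic_above i (\<rho> \<omega>)) \<omega> - W (dyadic_above i (\<tau> \<omega>)) \<omega>) ^ (2 * k)) * indicator {\<omega>. g \<omega> = pq} \<omega> \<partial>M)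
      \<le> (\<integral>\<^sup>+\<omega>. \<phi> \<omega> * ennreal (gauss_moment TYPE('m) k * (dyadic_above i (\<rho> \<omega>) - dyadic_above i (\<tau> \<omega>)) ^ k) * indicator {\<omega>. g \<omega> = pq} \<omega> \<partial>M)"
      unfolding L R .
  qed measurable
qed

text \<open>The moment part of the strong Markov property: letting the mesh of the dyadic times tend to zero,
Fatou's lemma handles the left-hand side, where nothing is known about integrability, and
dominated convergence the right-hand side.\<close>

lemma increment_moment:
  fixes \<phi> :: "'w \<Rightarrow> real"
  assumes \<tau>: "stopping_time F \<tau>" and \<tau>0: "\<And>\<omega>. \<omega> \<in> space M \<Longrightarrow> 0 \<le> \<tau> \<omega>"
    and \<rho>: "\<rho> \<in> borel_measurable (pre_sigma \<tau>)" and le: "\<And>\<omega>. \<omega> \<in> space M \<Longrightarrow> \<tau> \<omega> \<le> \<rho> \<omega>"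
    and \<phi>: "\<phi> \<in> borel_measurable (pre_sigma \<tau>)" and k: "1 \<le> k"
    and b: "\<And>\<omega>. \<omega> \<in> space M \<Longrightarrow> \<rho> \<omega> - \<tau> \<omega> \<le> b"
    and c: "\<And>\<omega>. \<omega> \<in> space M \<Longrightarrow> 0 \<le> \<phi> \<omega>" "\<And>\<omega>. \<omega> \<in> space M \<Longrightarrow> \<phi> \<omega> \<le> c"
  shows "(\<integral>\<^sup>+\<omega>. ennreal (\<phi> \<omega> * norm (W (\<rho> \<omega>) \<omega> - W (\<tau> \<omega>) \<omega>) ^ (2 * k)) \<partial>M)
    \<le> (\<integral>\<^sup>+\<omega>. ennreal (\<phi> \<omega> * (gauss_moment TYPE('m) k * (\<rho> \<omega> - \<tau> \<omega>) ^ k)) \<partial>M)"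
proof -
  note \<tau>m = measurable_stopping_time_pre_sigma[OF \<tau>]
  note [measurable] = pre_sigma_measurable[OF \<tau> \<tau>m] pre_sigma_measurable[OF \<tau> \<rho>] pre_sigma_measurable[OF \<tau> \<phi>]
  have [measurable]: "(\<lambda>\<omega>. W (dyadic_above i (\<rho> \<omega>)) \<omega>) \<in> borel_measurable M" "(\<lambda>\<omega>. W (dyadic_above i (\<tau> \<omega>)) \<omega>) \<in> borel_measurable M" for i
    by (rule W_random_time; measurable)+
  let ?g = "gauss_moment TYPE('m) k"
  define U where "U i \<omega> = ennreal (\<phi> \<omega> * norm (W (dyadic_above i (\<rho> \<omega>)) \<omega> - W (dyadic_above i (\<tau> \<omega>)) \<omega>) ^ (2 * k))" for i \<omega>
  define V where "V i \<omega> = ennreal (\<phi> \<omega> * (?g * (dyadic_above i (\<rho> \<omega>) - dyadic_above i (\<tau> \<omega>)) ^ k))" for i \<omega>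
  have [measurable]: "U i \<in> borel_measurable M" "V i \<in> borel_measurable M" for i
    unfolding U_def V_def by measurable
  have UV: "(\<integral>\<^sup>+\<omega>. U i \<omega> \<partial>M) \<le> (\<integral>\<^sup>+\<omega>. V i \<omega> \<partial>M)" for i
  proof -
    have "(\<lambda>\<omega>. ennreal (\<phi> \<omega>)) \<in> borel_measurable (pre_sigma \<tau>)" using \<phi> by measurable
    note * = increment_moment_dyadic[OF \<tau> \<tau>0 \<rho> le this k, of i]
    have "(\<integral>\<^sup>+\<omega>. V i \<omega> \<partial>M) = (\<integral>\<^sup>+\<omega>. ennreal (\<phi> \<omega>) * ennreal (?g * (dyadic_above i (\<rho> \<omega>) - dyadic_above i (\<tau> \<omega>)) ^ k) \<partial>M)"
      unfolding V_def using c(1) gauss_moment_nonneg[where 'm = 'm] dyadic_above_mono[OF le]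
      by (intro nn_integral_cong ennreal_mult mult_nonneg_nonneg zero_le_power) auto
    moreover have "(\<integral>\<^sup>+\<omega>. U i \<omega> \<partial>M) = (\<integral>\<^sup>+\<omega>. ennreal (\<phi> \<omega>) * ennreal (norm (W (dyadic_above i (\<rho> \<omega>)) \<omega> - W (dyadic_above i (\<tau> \<omega>)) \<omega>) ^ (2 * k)) \<partial>M)"
      unfolding U_def using c(1) by (intro nn_integral_cong ennreal_mult) auto
    ultimately show ?thesis using * by simp
  qed
  have U_lim: "(\<lambda>i. U i \<omega>) \<longlonglongrightarrow> ennreal (\<phi> \<omega> * norm (W (\<rho> \<omega>) \<omega> - W (\<tau> \<omega>) \<omega>) ^ (2 * k))" if w: "\<omega> \<in> space M" for \<omega>
    unfolding U_def
    by (intro tendsto_ennrealI tendsto_intros continuous_on_tendsto_compose[OF W_cont[OF w]] dyadic_above_tendsto) auto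
  have V_lim: "(\<lambda>i. V i \<omega>) \<longlonglongrightarrow> ennreal (\<phi> \<omega> * (?g * (\<rho> \<omega> - \<tau> \<omega>) ^ k))" for \<omega>
    unfolding V_def by (intro tendsto_ennrealI tendsto_intros dyadic_above_tendsto)
  have V_le: "V i \<omega> \<le> ennreal (c * (?g * (b + 1) ^ k))" if w: "\<omega> \<in> space M" for i \<omega>
  proof -
    have "dyadic_above i (\<rho> \<omega>) - dyadic_above i (\<tau> \<omega>) \<le> b + 1"
      using dyadic_above_bounds[where x = "\<rho> \<omega>" and i = i] dyadic_above_bounds[where x = "\<tau> \<omega>" and i = i] b[OF w] divide_le_eq_1[of 1 "2 ^ i :: real"]
      by (smt (verit) one_le_power)
    then show ?thesis unfolding V_def using c[OF w] gauss_moment_nonneg dyadic_above_mono[OF le[OF w], of i]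
      by (intro ennreal_leI mult_mono power_mono) auto
  qed
  have "(\<integral>\<^sup>+\<omega>. ennreal (\<phi> \<omega> * norm (W (\<rho> \<omega>) \<omega> - W (\<tau> \<omega>) \<omega>) ^ (2 * k)) \<partial>M)
     = (\<integral>\<^sup>+\<omega>. liminf (\<lambda>i. U i \<omega>) \<partial>M)"
    using lim_imp_Liminf[OF _ U_lim] by (intro nn_integral_cong) auto
  also have "\<dots> \<le> liminf (\<lambda>i. \<integral>\<^sup>+\<omega>. U i \<omega> \<partial>M)" by (rule nn_integral_liminf) measurable
  also have "\<dots> \<le> liminf (\<lambda>i. \<integral>\<^sup>+\<omega>. V i \<omega> \<partial>M)" by (intro Liminf_mono always_eventually allI UV)
  also have "\<dots> = (\<integral>\<^sup>+\<omega>. ennreal (\<phi> \<omega> * (?g * (\<rho> \<omega> - \<tau> \<omega>) ^ k)) \<partial>M)"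
  proof (rule lim_imp_Liminf)
    show "(\<lambda>i. \<integral>\<^sup>+\<omega>. V i \<omega> \<partial>M) \<longlonglongrightarrow> (\<integral>\<^sup>+\<omega>. ennreal (\<phi> \<omega> * (?g * (\<rho> \<omega> - \<tau> \<omega>) ^ k)) \<partial>M)"
      by (rule nn_integral_dominated_convergence[where w = "\<lambda>_. ennreal (c * (?g * (b + 1) ^ k))"])
        (use V_le V_lim in \<open>auto simp: emeasure_space_1 ennreal_mult_less_top\<close>)
  qed simp
  finally show ?thesis .
qed


lemma increment_moment_integrable:
  assumes \<tau>: "stopping_time F \<tau>" and \<tau>0: "\<And>\<omega>. \<omega> \<in> space M \<Longrightarrow> 0 \<le> \<tau> \<omega>"
    and \<rho>: "\<rho> \<in> borel_measurable (pre_sigma \<tau>)" and le: "\<And>\<omega>. \<omega> \<in> space M \<Longrightarrow> \<tau> \<omega> \<le> \<rho> \<omega>"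
    and k: "1 \<le> k" and b: "\<And>\<omega>. \<omega> \<in> space M \<Longrightarrow> \<rho> \<omega> - \<tau> \<omega> \<le> b"
  shows "integrable M (\<lambda>\<omega>. norm (W (\<rho> \<omega>) \<omega> - W (\<tau> \<omega>) \<omega>) ^ (2 * k))"
    and "(\<integral>\<omega>. norm (W (\<rho> \<omega>) \<omega> - W (\<tau> \<omega>) \<omega>) ^ (2 * k) \<partial>M) \<le> gauss_moment TYPE('m) k * b ^ k"
proof -
  note [measurable] = pre_sigma_measurable[OF \<tau> measurable_stopping_time_pre_sigma[OF \<tau>]] pre_sigma_measurable[OF \<tau> \<rho>]
  have [measurable]: "(\<lambda>\<omega>. W (\<rho> \<omega>) \<omega>) \<in> borel_measurable M" "(\<lambda>\<omega>. W (\<tau> \<omega>) \<omega>) \<in> borel_measurable M"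
    by (rule W_random_time; measurable)+
  have g0: "0 \<le> gauss_moment TYPE('m) k" by (rule gauss_moment_nonneg)
  obtain \<omega>0 where w0: "\<omega>0 \<in> space M" using not_empty by auto
  have b0: "0 \<le> b" using le[OF w0] b[OF w0] by simp
  have "(\<integral>\<^sup>+\<omega>. ennreal (norm (W (\<rho> \<omega>) \<omega> - W (\<tau> \<omega>) \<omega>) ^ (2 * k)) \<partial>M)
    \<le> (\<integral>\<^sup>+\<omega>. ennreal (gauss_moment TYPE('m) k * (\<rho> \<omega> - \<tau> \<omega>) ^ k) \<partial>M)"
    using increment_moment[OF \<tau> \<tau>0 \<rho> le _ k b, of "\<lambda>_. 1" 1] by simp
  also have "\<dots> \<le> (\<integral>\<^sup>+\<omega>. ennreal (gauss_moment TYPE('m) k * b ^ k) \<partial>M)"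
    using le b g0 by (intro nn_integral_mono ennreal_leI mult_left_mono power_mono) auto
  finally have *: "(\<integral>\<^sup>+\<omega>. ennreal (norm (W (\<rho> \<omega>) \<omega> - W (\<tau> \<omega>) \<omega>) ^ (2 * k)) \<partial>M) \<le> ennreal (gauss_moment TYPE('m) k * b ^ k)"
    by (simp add: emeasure_space_1)
  show i: "integrable M (\<lambda>\<omega>. norm (W (\<rho> \<omega>) \<omega> - W (\<tau> \<omega>) \<omega>) ^ (2 * k))"
    by (rule integrableI_bounded) (use * in \<open>auto simp: le_less_trans\<close>)
  show "(\<integral>\<omega>. norm (W (\<rho> \<omega>) \<omega> - W (\<tau> \<omega>) \<omega>) ^ (2 * k) \<partial>M) \<le> gauss_moment TYPE('m) k * b ^ k"
    using * g0 b0 by (subst (asm) nn_integral_eq_integral[OF i]) auto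
qed

text \<open>From \<open>|d| \<le> \<epsilon> + |d|\<^sup>2 / \<epsilon>\<close>, which serves as a substitute for the Cauchy-Schwarz inequality.\<close>

lemma norm_integral_le_second_moment:
  assumes "integrable M (\<lambda>\<omega>. norm (D \<omega>) ^ 2)" "D \<in> borel_measurable M"
  shows "integrable M (\<lambda>\<omega>. norm (D \<omega> :: 'x::{second_countable_topology,real_normed_vector}))"
    and "0 < \<epsilon> \<Longrightarrow> (\<integral>\<omega>. norm (D \<omega>) \<partial>M) \<le> \<epsilon> + (\<integral>\<omega>. norm (D \<omega>) ^ 2 \<partial>M) / \<epsilon>"
proof -
  have *: "norm (D \<omega>) \<le> \<epsilon> + norm (D \<omega>) ^ 2 / \<epsilon>" if "0 < \<epsilon>" for \<omega> \<epsilon>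
  proof (cases "norm (D \<omega>) \<le> \<epsilon>")
    case False
    then have "\<epsilon> * norm (D \<omega>) \<le> norm (D \<omega>) * norm (D \<omega>)" by (intro mult_right_mono) auto
    then show ?thesis using that by (simp add: field_simps power2_eq_square) (smt (verit) zero_le_square)
  qed (use that in \<open>auto intro: add_increasing2\<close>)
  show i: "integrable M (\<lambda>\<omega>. norm (D \<omega>))"
    by (rule Bochner_Integration.integrable_bound[where f = "\<lambda>\<omega>. 1 + norm (D \<omega>) ^ 2 / 1"])
      (use assms *[of 1] in \<open>auto intro!: AE_I2\<close>)
  show "(\<integral>\<omega>. norm (D \<omega>) \<partial>M) \<le> \<epsilon> + (\<integral>\<omega>. norm (D \<omega>) ^ 2 \<partial>M) / \<epsilon>" if "0 < \<epsilon>"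
  proof -
    have "(\<integral>\<omega>. norm (D \<omega>) \<partial>M) \<le> (\<integral>\<omega>. \<epsilon> + norm (D \<omega>) ^ 2 / \<epsilon> \<partial>M)"
      by (rule integral_mono) (use i assms *[OF that] in auto)
    also have "\<dots> = \<epsilon> + (\<integral>\<omega>. norm (D \<omega>) ^ 2 \<partial>M) / \<epsilon>"
      using assms by (subst Bochner_Integration.integral_add) (auto simp: prob_space)
    finally show ?thesis .
  qed
qed

text \<open>For a stopping time with dyadic values the integral is a finite sum of vanishing terms, one for
each value. The error made by rounding is bounded by the second moment of \<open>W\<close> between \<open>\<tau>\<close> and its
dyadic approximation. The horizon \<open>N + 1\<close> leaves room for rounding up.\<close>

lemma integral_to_horizon_zero:
  fixes v :: "'w \<Rightarrow> real ^ 'm"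
  assumes \<tau>: "stopping_time F \<tau>" and \<tau>0: "\<And>\<omega>. \<omega> \<in> space M \<Longrightarrow> 0 \<le> \<tau> \<omega>"
    and N: "\<And>\<omega>. \<omega> \<in> space M \<Longrightarrow> \<tau> \<omega> \<le> real N"
    and v: "v \<in> borel_measurable (pre_sigma \<tau>)" and B: "\<And>\<omega>. \<omega> \<in> space M \<Longrightarrow> norm (v \<omega>) \<le> B"
  shows "integrable M (\<lambda>\<omega>. v \<omega> \<bullet> (W (real N + 1) \<omega> - W (\<tau> \<omega>) \<omega>))"
    and "(\<integral>\<omega>. v \<omega> \<bullet> (W (real N + 1) \<omega> - W (\<tau> \<omega>) \<omega>) \<partial>M) = 0"
proof -
  note \<tau>m = measurable_stopping_time_pre_sigma[OF \<tau>]
  note [measurable] = pre_sigma_measurable[OF \<tau> \<tau>m] pre_sigma_measurable[OF \<tau> v]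
  have [measurable]: "(\<lambda>\<omega>. W (\<tau> \<omega>) \<omega>) \<in> borel_measurable M" "(\<lambda>\<omega>. W (dyadic_above i (\<tau> \<omega>)) \<omega>) \<in> borel_measurable M" for i
    by (rule W_random_time; measurable)+
  obtain \<omega>0 where w0: "\<omega>0 \<in> space M" using not_empty by auto
  have B0: "0 \<le> B" using B[OF w0] norm_ge_zero order_trans by blast
  have vD: "integrable M (\<lambda>\<omega>. v \<omega> \<bullet> D \<omega>)" "\<bar>\<integral>\<omega>. v \<omega> \<bullet> D \<omega> \<partial>M\<bar> \<le> B * (\<integral>\<omega>. norm (D \<omega>) \<partial>M)"
    if D: "D \<in> borel_measurable M" "integrable M (\<lambda>\<omega>. norm (D \<omega>))" for D
  proof -
    note [measurable] = D(1)
    have *: "\<bar>v \<omega> \<bullet> D \<omega>\<bar> \<le> B * norm (D \<omega>)" if "\<omega> \<in> space M" for \<omega>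
      using B[OF that] by (intro order_trans[OF Cauchy_Schwarz_ineq2] mult_right_mono) auto
    show i: "integrable M (\<lambda>\<omega>. v \<omega> \<bullet> D \<omega>)"
      by (rule Bochner_Integration.integrable_bound[where f = "\<lambda>\<omega>. B * norm (D \<omega>)"])
        (use D * B0 in \<open>auto intro!: AE_I2\<close>)
    have "\<bar>\<integral>\<omega>. v \<omega> \<bullet> D \<omega> \<partial>M\<bar> \<le> (\<integral>\<omega>. \<bar>v \<omega> \<bullet> D \<omega>\<bar> \<partial>M)" by (rule integral_abs_bound)
    also have "\<dots> \<le> (\<integral>\<omega>. B * norm (D \<omega>) \<partial>M)" by (rule integral_mono) (use i D * in auto)
    finally show "\<bar>\<integral>\<omega>. v \<omega> \<bullet> D \<omega> \<partial>M\<bar> \<le> B * (\<integral>\<omega>. norm (D \<omega>) \<partial>M)" by simp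
  qed
  have inc: "integrable M (\<lambda>\<omega>. norm (W (\<rho> \<omega>) \<omega> - W (\<tau> \<omega>) \<omega>))"
    "(\<integral>\<omega>. norm (W (\<rho> \<omega>) \<omega> - W (\<tau> \<omega>) \<omega>) ^ 2 \<partial>M) \<le> gauss_moment TYPE('m) 1 * b"
    if "\<rho> \<in> borel_measurable (pre_sigma \<tau>)" "\<And>\<omega>. \<omega> \<in> space M \<Longrightarrow> \<tau> \<omega> \<le> \<rho> \<omega>"
     "\<And>\<omega>. \<omega> \<in> space M \<Longrightarrow> \<rho> \<omega> - \<tau> \<omega> \<le> b" "(\<lambda>\<omega>. W (\<rho> \<omega>) \<omega>) \<in> borel_measurable M" for \<rho> b
    using increment_moment_integrable[OF \<tau> \<tau>0 that(1,2) _ that(3), of 1]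
      norm_integral_le_second_moment(1)[of "\<lambda>\<omega>. W (\<rho> \<omega>) \<omega> - W (\<tau> \<omega>) \<omega>"] that(4) by auto
  have dy: "dyadic_above i (\<tau> \<omega>) - \<tau> \<omega> \<le> 1 / 2 ^ i" "\<tau> \<omega> \<le> dyadic_above i (\<tau> \<omega>)" for i \<omega>
    using dyadic_above_bounds[where x = "\<tau> \<omega>" and i = i] by auto
  have dym: "(\<lambda>\<omega>. dyadic_above i (\<tau> \<omega>)) \<in> borel_measurable (pre_sigma \<tau>)" for i
    using \<tau>m by measurable
  have iN: "integrable M (\<lambda>\<omega>. norm (W (real N + 1) \<omega> - W (\<tau> \<omega>) \<omega>))"
    by (rule inc(1)[of "\<lambda>_. real N + 1" "real N + 1"]) (use \<tau>0 N in \<open>auto intro: order_trans[OF N]\<close>)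
  have iD: "integrable M (\<lambda>\<omega>. norm (W (dyadic_above i (\<tau> \<omega>)) \<omega> - W (\<tau> \<omega>) \<omega>))" for i
    by (rule inc(1)[OF dym dy(2) dy(1)]) measurable
  show main: "integrable M (\<lambda>\<omega>. v \<omega> \<bullet> (W (real N + 1) \<omega> - W (\<tau> \<omega>) \<omega>))"
    by (rule vD(1)[OF _ iN]) measurable
  have zero: "(\<integral>\<omega>. v \<omega> \<bullet> (W (real N + 1) \<omega> - W (dyadic_above i (\<tau> \<omega>)) \<omega>) \<partial>M) = 0" for i
  proof -
    define t where "t p = (real p + 1) / 2 ^ i" for p :: nat
    define u where "u p j \<omega> = v \<omega> $ j * indicator {\<omega>. \<lfloor>\<tau> \<omega> * 2 ^ i\<rfloor> = int p} \<omega> * indicator (space M) \<omega>" for p j \<omega>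
    have z: "integrable M (\<lambda>\<omega>. u p j \<omega> * (W (real N + 1) \<omega> - W (t p) \<omega>) $ j)"
        "(\<integral>\<omega>. u p j \<omega> * (W (real N + 1) \<omega> - W (t p) \<omega>) $ j \<partial>M) = 0" if p: "p \<in> {..N * 2 ^ i}" for p j
    proof -
      have "(real p + 1) / 2 ^ i \<le> (real N * 2 ^ i + 2 ^ i) / 2 ^ i"
      proof (intro divide_right_mono add_mono)
        have "real p \<le> real (N * 2 ^ i)" using p by (simp only: of_nat_le_iff atMost_iff)
        then show "real p \<le> real N * 2 ^ i" by simp
      qed auto
      then have tN: "t p \<le> real N + 1" by (simp add: t_def add_divide_distrib)
      have um: "u p j \<in> borel_measurable (F (t p))"
      proof (rule measurable_pre_sigma_before[OF \<tau>])
        note [measurable] = \<tau>m v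
        have "(\<lambda>\<omega>. v \<omega> $ j * indicator {\<omega>. \<lfloor>\<tau> \<omega> * 2 ^ i\<rfloor> = int p} \<omega>) \<in> borel_measurable (pre_sigma \<tau>)" by measurable
        then show "u p j \<in> borel_measurable (pre_sigma \<tau>)"
          unfolding u_def by (rule measurable_cong[THEN iffD1, rotated]) (auto simp: space_pre_sigma)
        fix \<omega> assume "u p j \<omega> \<noteq> 0"
        then have "\<lfloor>\<tau> \<omega> * 2 ^ i\<rfloor> = int p" by (auto simp: u_def split: split_indicator_asm)
        then show "\<tau> \<omega> \<le> t p" using dyadic_above_bounds(1)[of "\<tau> \<omega>" i] by (simp add: t_def dyadic_above_def)
      qed
      have ub: "\<bar>u p j \<omega>\<bar> \<le> B" for \<omega>
        using B[of \<omega>] B0 component_le_norm_cart[of "v \<omega>" j] by (auto simp: u_def split: split_indicator)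
      show "integrable M (\<lambda>\<omega>. u p j \<omega> * (W (real N + 1) \<omega> - W (t p) \<omega>) $ j)"
        "(\<integral>\<omega>. u p j \<omega> * (W (real N + 1) \<omega> - W (t p) \<omega>) $ j \<partial>M) = 0"
        using integral_increment_zero[of "t p" "real N + 1", OF _ _ um ub] tN
        by (cases "t p = real N + 1"; simp add: t_def)+
    qed
    have "v \<omega> \<bullet> (W (real N + 1) \<omega> - W (dyadic_above i (\<tau> \<omega>)) \<omega>) = (\<Sum>p\<le>N * 2 ^ i. \<Sum>j\<in>UNIV. u p j \<omega> * (W (real N + 1) \<omega> - W (t p) \<omega>) $ j)"
      if w: "\<omega> \<in> space M" for \<omega>
    proof -
      define p0 where "p0 = nat \<lfloor>\<tau> \<omega> * 2 ^ i\<rfloor>"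
      have p0: "int p0 = \<lfloor>\<tau> \<omega> * 2 ^ i\<rfloor>" using \<tau>0[OF w] by (simp add: p0_def)
      have "\<tau> \<omega> * 2 ^ i \<le> real (N * 2 ^ i)" using N[OF w] by (simp add: mult_right_mono)
      then have "\<lfloor>\<tau> \<omega> * 2 ^ i\<rfloor> \<le> int (N * 2 ^ i)" by linarith
      then have "int p0 \<le> int (N * 2 ^ i)" using p0 by (simp only:)
      then have p0N: "p0 \<in> {..N * 2 ^ i}" by (simp only: of_nat_le_iff atMost_iff)
      have "(\<Sum>p\<le>N * 2 ^ i. \<Sum>j\<in>UNIV. u p j \<omega> * (W (real N + 1) \<omega> - W (t p) \<omega>) $ j)
          = (\<Sum>p\<le>N * 2 ^ i. if p = p0 then \<Sum>j\<in>UNIV. v \<omega> $ j * (W (real N + 1) \<omega> - W (t p) \<omega>) $ j else 0)"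
        using w by (intro sum.cong) (auto simp: u_def p0[symmetric] split: split_indicator)
      also have "\<dots> = v \<omega> \<bullet> (W (real N + 1) \<omega> - W (t p0) \<omega>)"
        using p0N by (simp add: sum.delta inner_vec_def)
      also have "t p0 = dyadic_above i (\<tau> \<omega>)" by (simp add: t_def dyadic_above_def p0[symmetric])
      finally show ?thesis by simp
    qed
    then have "(\<integral>\<omega>. v \<omega> \<bullet> (W (real N + 1) \<omega> - W (dyadic_above i (\<tau> \<omega>)) \<omega>) \<partial>M)
      = (\<integral>\<omega>. (\<Sum>p\<le>N * 2 ^ i. \<Sum>j\<in>UNIV. u p j \<omega> * (W (real N + 1) \<omega> - W (t p) \<omega>) $ j) \<partial>M)"
      by (intro Bochner_Integration.integral_cong) auto
    also have "\<dots> = (\<Sum>p\<le>N * 2 ^ i. \<Sum>j\<in>UNIV. (\<integral>\<omega>. u p j \<omega> * (W (real N + 1) \<omega> - W (t p) \<omega>) $ j \<partial>M))"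
      using z(1) by (simp add: Bochner_Integration.integral_sum Bochner_Integration.integrable_sum)
    also have "\<dots> = 0" using z(2) by simp
    finally show ?thesis .
  qed
  have le: "\<bar>\<integral>\<omega>. v \<omega> \<bullet> (W (real N + 1) \<omega> - W (\<tau> \<omega>) \<omega>) \<partial>M\<bar> \<le> B * ((1 + gauss_moment TYPE('m) 1) * (1 / 2) ^ j)" for j
  proof -
    let ?i = "2 * j"
    let ?D = "\<lambda>\<omega>. W (dyadic_above ?i (\<tau> \<omega>)) \<omega> - W (\<tau> \<omega>) \<omega>"
    have iv: "integrable M (\<lambda>\<omega>. v \<omega> \<bullet> ?D \<omega>)" by (rule vD(1)[OF _ iD]) measurable
    have "(\<integral>\<omega>. v \<omega> \<bullet> (W (real N + 1) \<omega> - W (\<tau> \<omega>) \<omega>) \<partial>M) - (\<integral>\<omega>. v \<omega> \<bullet> ?D \<omega> \<partial>M)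
       = (\<integral>\<omega>. v \<omega> \<bullet> (W (real N + 1) \<omega> - W (dyadic_above ?i (\<tau> \<omega>)) \<omega>) \<partial>M)"
      by (subst Bochner_Integration.integral_diff[OF main iv, symmetric]) (simp add: inner_diff_right)
    then have "\<bar>\<integral>\<omega>. v \<omega> \<bullet> (W (real N + 1) \<omega> - W (\<tau> \<omega>) \<omega>) \<partial>M\<bar> = \<bar>\<integral>\<omega>. v \<omega> \<bullet> ?D \<omega> \<partial>M\<bar>" by (simp only: zero)
    also have "\<dots> \<le> B * (\<integral>\<omega>. norm (?D \<omega>) \<partial>M)" by (rule vD(2)[OF _ iD]) measurable
    also have "(\<integral>\<omega>. norm (?D \<omega>) \<partial>M) \<le> (1 / 2) ^ j + (\<integral>\<omega>. norm (?D \<omega>) ^ 2 \<partial>M) / (1 / 2) ^ j"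
      using increment_moment_integrable(1)[OF \<tau> \<tau>0 dym dy(2) _ dy(1), of 1 ?i]
      by (intro norm_integral_le_second_moment(2)) auto
    also have "(\<integral>\<omega>. norm (?D \<omega>) ^ 2 \<partial>M) \<le> gauss_moment TYPE('m) 1 * (1 / 2 ^ ?i)"
      by (rule inc(2)[OF dym dy(2) dy(1)]) measurable
    also have "(1 / 2) ^ j + gauss_moment TYPE('m) 1 * (1 / 2 ^ ?i) / (1 / 2) ^ j = (1 + gauss_moment TYPE('m) 1) * (1 / 2) ^ j"
    proof -
      have "(2 :: real) ^ ?i = 2 ^ j * 2 ^ j" by (simp add: mult_2 power_add)
      then show ?thesis by (simp add: field_simps power_one_over)
    qed
    finally show ?thesis using B0 by (simp add: mult_left_mono divide_right_mono)
  qed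
  have "(\<lambda>j. B * ((1 + gauss_moment TYPE('m) 1) * (1 / 2) ^ j)) \<longlonglongrightarrow> B * ((1 + gauss_moment TYPE('m) 1) * 0)"
    by (intro tendsto_intros LIMSEQ_power_zero) simp
  then have "\<bar>\<integral>\<omega>. v \<omega> \<bullet> (W (real N + 1) \<omega> - W (\<tau> \<omega>) \<omega>) \<partial>M\<bar> \<le> 0"
    by (intro LIMSEQ_le_const[of "\<lambda>j. B * ((1 + gauss_moment TYPE('m) 1) * (1 / 2) ^ j)"]) (use le in auto)
  then show "(\<integral>\<omega>. v \<omega> \<bullet> (W (real N + 1) \<omega> - W (\<tau> \<omega>) \<omega>) \<partial>M) = 0" by simp
qed

text \<open>The increment from \<open>\<tau>\<close> to \<open>\<rho>\<close> is the difference of two increments up to a common horizon, and what is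
known at \<open>\<tau>\<close> is known at \<open>\<rho>\<close>.\<close>

lemma increment_mean_zero:
  fixes v :: "'w \<Rightarrow> real ^ 'm"
  assumes \<tau>: "stopping_time F \<tau>" and \<tau>0: "\<And>\<omega>. \<omega> \<in> space M \<Longrightarrow> 0 \<le> \<tau> \<omega>"
    and \<rho>: "\<rho> \<in> borel_measurable (pre_sigma \<tau>)" and le: "\<And>\<omega>. \<omega> \<in> space M \<Longrightarrow> \<tau> \<omega> \<le> \<rho> \<omega>"
    and b: "\<And>\<omega>. \<omega> \<in> space M \<Longrightarrow> \<rho> \<omega> \<le> b"
    and v: "v \<in> borel_measurable (pre_sigma \<tau>)" and B: "\<And>\<omega>. \<omega> \<in> space M \<Longrightarrow> norm (v \<omega>) \<le> B"
  shows "integrable M (\<lambda>\<omega>. v \<omega> \<bullet> (W (\<rho> \<omega>) \<omega> - W (\<tau> \<omega>) \<omega>))"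
    and "(\<integral>\<omega>. v \<omega> \<bullet> (W (\<rho> \<omega>) \<omega> - W (\<tau> \<omega>) \<omega>) \<partial>M) = 0"
proof -
  obtain N :: nat where N: "b \<le> real N" using real_arch_simple by blast
  have N\<rho>: "\<rho> \<omega> \<le> real N" "\<tau> \<omega> \<le> real N" "0 \<le> \<rho> \<omega>" if "\<omega> \<in> space M" for \<omega>
    using N b[OF that] le[OF that] \<tau>0[OF that] by auto
  note \<rho>s = later_stopping_time[OF \<tau> \<rho> le]
  note 1 = integral_to_horizon_zero[OF \<tau> \<tau>0 N\<rho>(2) v B]
  note 2 = integral_to_horizon_zero[OF \<rho>s N\<rho>(3) N\<rho>(1) pre_sigma_later[OF \<tau> \<rho>s le v] B]
  have z1: "(\<integral>\<omega>. v \<omega> \<bullet> (W (real N + 1) \<omega> - W (\<tau> \<omega>) \<omega>) \<partial>M) = 0" using 1(2) .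
  have z2: "(\<integral>\<omega>. v \<omega> \<bullet> (W (real N + 1) \<omega> - W (\<rho> \<omega>) \<omega>) \<partial>M) = 0" using 2(2) .
  have eq: "(\<lambda>\<omega>. v \<omega> \<bullet> (W (\<rho> \<omega>) \<omega> - W (\<tau> \<omega>) \<omega>))
     = (\<lambda>\<omega>. v \<omega> \<bullet> (W (real N + 1) \<omega> - W (\<tau> \<omega>) \<omega>) - v \<omega> \<bullet> (W (real N + 1) \<omega> - W (\<rho> \<omega>) \<omega>))"
    by (simp add: inner_diff_right)
  show "integrable M (\<lambda>\<omega>. v \<omega> \<bullet> (W (\<rho> \<omega>) \<omega> - W (\<tau> \<omega>) \<omega>))"
    unfolding eq by (rule Bochner_Integration.integrable_diff[OF 1(1) 2(1)])
  have "(\<integral>\<omega>. v \<omega> \<bullet> (W (\<rho> \<omega>) \<omega> - W (\<tau> \<omega>) \<omega>) \<partial>M)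
      = (\<integral>\<omega>. v \<omega> \<bullet> (W (real N + 1) \<omega> - W (\<tau> \<omega>) \<omega>) \<partial>M) - (\<integral>\<omega>. v \<omega> \<bullet> (W (real N + 1) \<omega> - W (\<rho> \<omega>) \<omega>) \<partial>M)"
    unfolding eq by (rule Bochner_Integration.integral_diff[OF 1(1) 2(1)])
  then show "(\<integral>\<omega>. v \<omega> \<bullet> (W (\<rho> \<omega>) \<omega> - W (\<tau> \<omega>) \<omega>) \<partial>M) = 0"
    using z1 z2 by linarith
qed

end

section \<open>Even moments after a centred step\<close>

text \<open>Induction on the exponent: multiplying the expansion by \<open>a + b\<close> produces the next one and the extra
term \<open>real (k + 2) * a ^ (k + 1) * b\<^sup>2\<close>. The square in the constant is a convenient bound for the sum of these
coefficients.\<close>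

lemma power_second_order_remainder:
  fixes a b :: real
  shows "\<bar>(a + b) ^ (k + 2) - a ^ (k + 2) - real (k + 2) * a ^ (k + 1) * b\<bar>
    \<le> (real (k + 2))\<^sup>2 * b\<^sup>2 * (\<bar>a\<bar> + \<bar>b\<bar>) ^ k"
proof (induction k)
  case 0
  have "(a + b)\<^sup>2 - a\<^sup>2 - 2 * a * b = b\<^sup>2" by (simp add: power2_sum)
  then have "\<bar>(a + b)\<^sup>2 - a\<^sup>2 - 2 * a * b\<bar> \<le> 4 * b\<^sup>2" by simp
  then show ?case by (simp add: power2_eq_square)
next
  case (Suc k)
  define E where "E = (a + b) ^ (k + 2) - a ^ (k + 2) - real (k + 2) * a ^ (k + 1) * b"
  define S where "S = \<bar>a\<bar> + \<bar>b\<bar>"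
  have S: "0 \<le> S" "\<bar>a + b\<bar> \<le> S" "\<bar>a\<bar> \<le> S" by (auto simp: S_def)
  have "(a + b) ^ (Suc k + 2) - a ^ (Suc k + 2) - real (Suc k + 2) * a ^ (Suc k + 1) * b
      = (a + b) * E + real (k + 2) * a ^ (k + 1) * b\<^sup>2"
    unfolding E_def by (simp add: algebra_simps power2_eq_square)
  also have "\<bar>\<dots>\<bar> \<le> S * ((real (k + 2))\<^sup>2 * b\<^sup>2 * S ^ k) + real (k + 2) * S ^ (k + 1) * b\<^sup>2"
  proof (rule order_trans[OF abs_triangle_ineq add_mono])
    show "\<bar>(a + b) * E\<bar> \<le> S * ((real (k + 2))\<^sup>2 * b\<^sup>2 * S ^ k)"
      unfolding abs_mult using Suc.IH S by (intro mult_mono) (auto simp: E_def S_def)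
    have "\<bar>a\<bar> ^ (k + 1) \<le> S ^ (k + 1)" using S by (intro power_mono) auto
    then show "\<bar>real (k + 2) * a ^ (k + 1) * b\<^sup>2\<bar> \<le> real (k + 2) * S ^ (k + 1) * b\<^sup>2"
      by (simp add: abs_mult power_abs mult_right_mono mult_left_mono del: power_Suc)
  qed
  also have "\<dots> = ((real (k + 2))\<^sup>2 + real (k + 2)) * (b\<^sup>2 * S ^ (k + 1))"
    by (simp add: algebra_simps)
  also have "\<dots> \<le> (real (Suc k + 2))\<^sup>2 * (b\<^sup>2 * S ^ (k + 1))"
  proof (rule mult_right_mono)
    show "(real (k + 2))\<^sup>2 + real (k + 2) \<le> (real (Suc k + 2))\<^sup>2" by (simp add: power2_eq_square algebra_simps)
    show "0 \<le> b\<^sup>2 * S ^ (k + 1)" using S by simp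
  qed
  finally show ?case by (simp add: S_def mult_ac)
qed

lemma power_add_le:
  fixes u v :: real assumes "0 \<le> u" "0 \<le> v" shows "(u + v) ^ j \<le> 2 ^ j * (u ^ j + v ^ j)"
proof -
  have "(u + v) ^ j \<le> (2 * max u v) ^ j" using assms by (intro power_mono) auto
  also have "\<dots> = 2 ^ j * max u v ^ j" by (rule power_mult_distrib)
  also have "\<dots> \<le> 2 ^ j * (u ^ j + v ^ j)" using assms by (intro mult_left_mono) (auto simp: max_def)
  finally show ?thesis .
qed

definition expansion_const :: "nat \<Rightarrow> real" where
  "expansion_const n = real n + (real n)\<^sup>2 * 4 ^ n"

lemma expansion_const_nonneg: "0 \<le> expansion_const n"
  by (simp add: expansion_const_def)

text \<open>Apply the second-order expansion of a power to \<open>|z + d|\<^sup>2 = |z|\<^sup>2 + b\<close> with \<open>b = 2 * (z \<bullet> d) + |d|\<^sup>2\<close>, where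
\<open>|b| \<le> 2 * |d| * (|z| + |d|)\<close>. Only the term linear in \<open>d\<close> is kept with its sign, since it is the one that
disappears in mean.\<close>

lemma norm_power_expansion:
  fixes z d :: "'a::real_inner" assumes n: "1 \<le> n"
  shows "norm (z + d) ^ (2 * n) \<le> norm z ^ (2 * n) + 2 * real n * (norm z ^ (2 * (n - 1)) * (z \<bullet> d))
    + expansion_const n * (norm z ^ (2 * (n - 1)) * (norm d)\<^sup>2 + norm d ^ (2 * n))"
proof -
  have sq: "(norm (z + d))\<^sup>2 = (norm z)\<^sup>2 + (2 * (z \<bullet> d) + (norm d)\<^sup>2)"
    by (simp add: power2_norm_eq_inner inner_add_left inner_add_right inner_commute)
  show ?thesis
  proof (cases "n = 1")
    case True
    have "0 \<le> (norm d)\<^sup>2" by simp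
    then show ?thesis using sq True by (simp add: expansion_const_def)
  next
    case False
    then obtain k where k: "n = k + 2" using n by (metis One_nat_def Suc_1 add.commute le_neq_implies_less le_Suc_ex less_eq_Suc_le)
    define a where "a = (norm z)\<^sup>2"
    define b where "b = 2 * (z \<bullet> d) + (norm d)\<^sup>2"
    define S where "S = norm z + norm d"
    have zd: "\<bar>z \<bullet> d\<bar> \<le> norm z * norm d" by (rule Cauchy_Schwarz_ineq2)
    have b1: "\<bar>b\<bar> \<le> 2 * norm z * norm d + (norm d)\<^sup>2"
      using zd zero_le_power2[of "norm d"] unfolding b_def abs_le_iff by linarith
    have "2 * norm z * norm d + (norm d)\<^sup>2 + (norm d)\<^sup>2 = 2 * norm d * S"
      by (simp add: S_def algebra_simps power2_eq_square)
    then have b2: "\<bar>b\<bar> \<le> 2 * norm d * S" using b1 zero_le_power2[of "norm d"] by linarith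
    have ab: "\<bar>a\<bar> + \<bar>b\<bar> \<le> S\<^sup>2" using b1 by (simp add: a_def S_def power2_sum)
    have S: "0 \<le> S" by (simp add: S_def)
    have "norm (z + d) ^ (2 * n) = (a + b) ^ n" by (simp add: power_mult sq a_def b_def)
    also have "\<dots> \<le> a ^ n + real n * a ^ (n - 1) * b + (real n)\<^sup>2 * b\<^sup>2 * (\<bar>a\<bar> + \<bar>b\<bar>) ^ k"
      using power_second_order_remainder[of a b k] k by (simp add: abs_le_iff)
    also have "real n * a ^ (n - 1) * b = 2 * real n * (norm z ^ (2 * (n - 1)) * (z \<bullet> d)) + real n * (norm z ^ (2 * (n - 1)) * (norm d)\<^sup>2)"
      unfolding a_def b_def power_mult by (simp add: algebra_simps)
    also have "(real n)\<^sup>2 * b\<^sup>2 * (\<bar>a\<bar> + \<bar>b\<bar>) ^ k \<le> (real n)\<^sup>2 * (2 * norm d * S)\<^sup>2 * (S\<^sup>2) ^ k"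
    proof (intro mult_mono power_mono[OF ab])
      show "b\<^sup>2 \<le> (2 * norm d * S)\<^sup>2" using power_mono[OF b2, of 2] by simp
    qed auto
    also have "\<dots> = (real n)\<^sup>2 * 4 * ((norm d)\<^sup>2 * S ^ (2 * (n - 1)))"
    proof -
      have n1: "n - 1 = Suc k" using k by simp
      show ?thesis unfolding n1 power_mult by (simp add: power_mult_distrib)
    qed
    also have "\<dots> \<le> (real n)\<^sup>2 * 4 * ((norm d)\<^sup>2 * (2 ^ (2 * (n - 1)) * (norm z ^ (2 * (n - 1)) + norm d ^ (2 * (n - 1)))))"
      unfolding S_def by (intro mult_left_mono power_add_le) auto
    also have "\<dots> = (real n)\<^sup>2 * 4 ^ n * (norm z ^ (2 * (n - 1)) * (norm d)\<^sup>2 + norm d ^ (2 * n))"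
    proof -
      obtain q where q: "n = Suc q" using n by (cases n) auto
      have 1: "4 * (2 :: real) ^ (2 * q) = 4 ^ n" by (simp add: q power_mult)
      have 2: "norm d ^ (2 * n) = (norm d)\<^sup>2 * norm d ^ (2 * q)" by (simp add: q power2_eq_square)
      show ?thesis unfolding 1[symmetric] 2 by (simp add: q algebra_simps)
    qed
    also have "a ^ n = norm z ^ (2 * n)" by (simp add: a_def power_mult)
    finally have fin: "norm (z + d) ^ (2 * n) \<le> norm z ^ (2 * n)
      + (2 * real n * (norm z ^ (2 * (n - 1)) * (z \<bullet> d)) + real n * (norm z ^ (2 * (n - 1)) * (norm d)\<^sup>2))
      + (real n)\<^sup>2 * 4 ^ n * (norm z ^ (2 * (n - 1)) * (norm d)\<^sup>2 + norm d ^ (2 * n))"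
      by simp
    have "0 \<le> real n * norm d ^ (2 * n)" by simp
    with fin show ?thesis unfolding expansion_const_def distrib_right distrib_left by linarith
  qed
qed

lemma power_product_le_sum:
  fixes u v :: real assumes "0 \<le> u" "0 \<le> v" "1 \<le> n"
  shows "u ^ (2 * (n - 1)) * v\<^sup>2 \<le> u ^ (2 * n) + v ^ (2 * n)"
proof -
  have e: "x ^ (2 * n) = x ^ (2 * (n - 1)) * x\<^sup>2" for x :: real
    using assms(3) by (cases n) (auto simp: power_add power2_eq_square)
  have "u ^ (2 * (n - 1)) * v\<^sup>2 \<le> max u v ^ (2 * (n - 1)) * (max u v)\<^sup>2"
    using assms by (intro mult_mono power_mono) auto
  also have "\<dots> = max u v ^ (2 * n)" by (rule e[symmetric])
  also have "\<dots> \<le> u ^ (2 * n) + v ^ (2 * n)" using assms by (auto simp: max_def)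
  finally show ?thesis .
qed

definition power_step_const :: "nat \<Rightarrow> real \<Rightarrow> real \<Rightarrow> real \<Rightarrow> real" where
  "power_step_const n c1 cn T = expansion_const n * (c1 + cn * T ^ (n - 1))"

context prob_space begin

lemma integral_le_of_nn_integral_le:
  fixes u v :: "'a \<Rightarrow> real"
  assumes u: "u \<in> borel_measurable M" "\<And>\<omega>. \<omega> \<in> space M \<Longrightarrow> 0 \<le> u \<omega>"
    and v: "integrable M v" "\<And>\<omega>. \<omega> \<in> space M \<Longrightarrow> 0 \<le> v \<omega>"
    and le: "(\<integral>\<^sup>+\<omega>. ennreal (u \<omega>) \<partial>M) \<le> (\<integral>\<^sup>+\<omega>. ennreal (v \<omega>) \<partial>M)"
  shows "integrable M u" "(\<integral>\<omega>. u \<omega> \<partial>M) \<le> (\<integral>\<omega>. v \<omega> \<partial>M)"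
proof -
  have vE: "(\<integral>\<^sup>+\<omega>. ennreal (v \<omega>) \<partial>M) = ennreal (\<integral>\<omega>. v \<omega> \<partial>M)"
    using v by (intro nn_integral_eq_integral) auto
  show i: "integrable M u"
  proof (rule integrableI_nonneg)
    show "(\<integral>\<^sup>+\<omega>. ennreal (u \<omega>) \<partial>M) < \<infinity>" using le unfolding vE by (auto simp: le_less_trans)
  qed (use u in auto)
  have "(\<integral>\<^sup>+\<omega>. ennreal (u \<omega>) \<partial>M) = ennreal (\<integral>\<omega>. u \<omega> \<partial>M)"
    using u i by (intro nn_integral_eq_integral) auto
  then show "(\<integral>\<omega>. u \<omega> \<partial>M) \<le> (\<integral>\<omega>. v \<omega> \<partial>M)"
    using le vE v by (simp add: ennreal_le_iff[OF integral_nonneg_AE])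
qed

lemma integrable_bounded_real:
  fixes u :: "'a \<Rightarrow> real"
  assumes "u \<in> borel_measurable M" "\<And>\<omega>. \<omega> \<in> space M \<Longrightarrow> \<bar>u \<omega>\<bar> \<le> B" shows "integrable M u"
  by (rule integrable_const_bound[of _ B]) (use assms in auto)

text \<open>The linear term of \<open>norm_power_expansion\<close> has mean zero, and the two remaining terms involve only the second
and the \<open>2 * n\<close>-th moment of the increment \<open>D\<close>, which are of order \<open>h\<close> with scale \<open>b\<close>. The weight \<open>\<phi>\<close>
localises to an event on which \<open>z\<close> and \<open>b\<close> are bounded, so that all integrals exist.\<close>

lemma power_step:
  fixes z D :: "'a \<Rightarrow> 'b::euclidean_space" and \<phi> b h :: "'a \<Rightarrow> real"
  assumes n: "1 \<le> n"
    and [measurable]: "z \<in> borel_measurable M" "D \<in> borel_measurable M" "\<phi> \<in> borel_measurable M"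
      "b \<in> borel_measurable M" "h \<in> borel_measurable M"
    and \<phi>: "\<And>\<omega>. \<omega> \<in> space M \<Longrightarrow> 0 \<le> \<phi> \<omega>" "\<And>\<omega>. \<omega> \<in> space M \<Longrightarrow> \<phi> \<omega> \<le> c"
    and zB: "\<And>\<omega>. \<omega> \<in> space M \<Longrightarrow> \<phi> \<omega> \<noteq> 0 \<Longrightarrow> norm (z \<omega>) \<le> B"
    and bB: "\<And>\<omega>. \<omega> \<in> space M \<Longrightarrow> \<phi> \<omega> \<noteq> 0 \<Longrightarrow> b \<omega> \<le> B" "\<And>\<omega>. 0 \<le> b \<omega>"
    and h: "\<And>\<omega>. \<omega> \<in> space M \<Longrightarrow> 0 \<le> h \<omega>" "\<And>\<omega>. \<omega> \<in> space M \<Longrightarrow> h \<omega> \<le> T"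
    and c1: "0 \<le> c1" "0 \<le> cn"
    and zero: "integrable M (\<lambda>\<omega>. ((\<phi> \<omega> * norm (z \<omega>) ^ (2 * (n - 1))) *\<^sub>R z \<omega>) \<bullet> D \<omega>)"
      "(\<integral>\<omega>. ((\<phi> \<omega> * norm (z \<omega>) ^ (2 * (n - 1))) *\<^sub>R z \<omega>) \<bullet> D \<omega> \<partial>M) = 0"
    and two: "(\<integral>\<^sup>+\<omega>. ennreal ((\<phi> \<omega> * norm (z \<omega>) ^ (2 * (n - 1))) * (norm (D \<omega>))\<^sup>2) \<partial>M)
      \<le> (\<integral>\<^sup>+\<omega>. ennreal ((\<phi> \<omega> * norm (z \<omega>) ^ (2 * (n - 1))) * (c1 * ((b \<omega>)\<^sup>2 * h \<omega>))) \<partial>M)"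
    and many: "(\<integral>\<^sup>+\<omega>. ennreal (\<phi> \<omega> * norm (D \<omega>) ^ (2 * n)) \<partial>M)
      \<le> (\<integral>\<^sup>+\<omega>. ennreal (\<phi> \<omega> * (cn * (b \<omega> ^ (2 * n) * h \<omega> ^ n))) \<partial>M)"
  shows "integrable M (\<lambda>\<omega>. \<phi> \<omega> * norm (z \<omega> + D \<omega>) ^ (2 * n))"
    and "integrable M (\<lambda>\<omega>. \<phi> \<omega> * (norm (z \<omega>) ^ (2 * n)
            + power_step_const n c1 cn T * h \<omega> * (norm (z \<omega>) ^ (2 * n) + b \<omega> ^ (2 * n))))"
    and "(\<integral>\<omega>. \<phi> \<omega> * norm (z \<omega> + D \<omega>) ^ (2 * n) \<partial>M)
      \<le> (\<integral>\<omega>. \<phi> \<omega> * (norm (z \<omega>) ^ (2 * n)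
            + power_step_const n c1 cn T * h \<omega> * (norm (z \<omega>) ^ (2 * n) + b \<omega> ^ (2 * n))) \<partial>M)"
proof -
  obtain \<omega>0 where w0: "\<omega>0 \<in> space M" using not_empty by auto
  have c0: "0 \<le> c" "0 \<le> T" using \<phi>[OF w0] h[OF w0] by auto
  define B' where "B' = max 0 B"
  have B': "0 \<le> B'" "B \<le> B'" by (auto simp: B'_def)
  define Z where "Z j \<omega> = \<phi> \<omega> * norm (z \<omega>) ^ j" for j \<omega>
  have Z0: "0 \<le> Z j \<omega>" if "\<omega> \<in> space M" for j \<omega> unfolding Z_def using \<phi>(1)[OF that] by simp
  have Zb: "0 \<le> Z j \<omega> * b \<omega> ^ i * h \<omega> ^ k" "Z j \<omega> * b \<omega> ^ i * h \<omega> ^ k \<le> c * B' ^ j * B' ^ i * T ^ k" if w: "\<omega> \<in> space M" for i j k \<omega>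
  proof -
    show "0 \<le> Z j \<omega> * b \<omega> ^ i * h \<omega> ^ k" using Z0[OF w] bB(2) h[OF w] by simp
    show "Z j \<omega> * b \<omega> ^ i * h \<omega> ^ k \<le> c * B' ^ j * B' ^ i * T ^ k"
    proof (cases "\<phi> \<omega> = 0")
      case False
      have "norm (z \<omega>) \<le> B'" "b \<omega> \<le> B'" using zB[OF w False] bB(1)[OF w False] B' by auto
      then show ?thesis unfolding Z_def using \<phi>[OF w] bB(2)[of \<omega>] h[OF w] B' c0
        by (intro mult_mono power_mono) auto
    qed (use B' c0 in \<open>simp add: Z_def\<close>)
  qed
  have [measurable]: "Z j \<in> borel_measurable M" for j unfolding Z_def by measurable
  have Zi: "integrable M (\<lambda>\<omega>. Z j \<omega> * b \<omega> ^ i * h \<omega> ^ k)" for i j k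
    using Zb[of _ j i k] by (intro integrable_bounded_real[where B = "c * B' ^ j * B' ^ i * T ^ k"]) auto
  let ?m = "2 * (n - 1)"
  have i1: "integrable M (\<lambda>\<omega>. c1 * (Z ?m \<omega> * b \<omega> ^ 2 * h \<omega> ^ 1))" "integrable M (\<lambda>\<omega>. cn * (Z 0 \<omega> * b \<omega> ^ (2 * n) * h \<omega> ^ n))"
    by (intro integrable_mult_right Zi)+
  have D2: "0 \<le> Z ?m \<omega> * (norm (D \<omega>))\<^sup>2" "0 \<le> c1 * (Z ?m \<omega> * b \<omega> ^ 2 * h \<omega> ^ 1)"
    "0 \<le> Z 0 \<omega> * norm (D \<omega>) ^ (2 * n)" "0 \<le> cn * (Z 0 \<omega> * b \<omega> ^ (2 * n) * h \<omega> ^ n)" if "\<omega> \<in> space M" for \<omega>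
    using Z0[OF that] h(1)[OF that] bB(2) c1 by (auto intro!: mult_nonneg_nonneg simp del: mult_eq_0_iff)
  have nn: "(\<integral>\<^sup>+\<omega>. ennreal (Z ?m \<omega> * (norm (D \<omega>))\<^sup>2) \<partial>M) \<le> (\<integral>\<^sup>+\<omega>. ennreal (c1 * (Z ?m \<omega> * b \<omega> ^ 2 * h \<omega> ^ 1)) \<partial>M)"
    "(\<integral>\<^sup>+\<omega>. ennreal (Z 0 \<omega> * norm (D \<omega>) ^ (2 * n)) \<partial>M) \<le> (\<integral>\<^sup>+\<omega>. ennreal (cn * (Z 0 \<omega> * b \<omega> ^ (2 * n) * h \<omega> ^ n)) \<partial>M)"
    using two many by (simp_all add: Z_def mult_ac)
  have two': "integrable M (\<lambda>\<omega>. Z ?m \<omega> * (norm (D \<omega>))\<^sup>2)"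
      "(\<integral>\<omega>. Z ?m \<omega> * (norm (D \<omega>))\<^sup>2 \<partial>M) \<le> (\<integral>\<omega>. c1 * (Z ?m \<omega> * b \<omega> ^ 2 * h \<omega> ^ 1) \<partial>M)"
    by (rule integral_le_of_nn_integral_le[OF _ D2(1) i1(1) D2(2) nn(1)], measurable)+
  have many': "integrable M (\<lambda>\<omega>. Z 0 \<omega> * norm (D \<omega>) ^ (2 * n))"
      "(\<integral>\<omega>. Z 0 \<omega> * norm (D \<omega>) ^ (2 * n) \<partial>M) \<le> (\<integral>\<omega>. cn * (Z 0 \<omega> * b \<omega> ^ (2 * n) * h \<omega> ^ n) \<partial>M)"
    by (rule integral_le_of_nn_integral_le[OF _ D2(3) i1(2) D2(4) nn(2)], measurable)+
  let ?E = "expansion_const n"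
  have E0: "0 \<le> ?E" by (rule expansion_const_nonneg)
  define L where "L \<omega> = ((\<phi> \<omega> * norm (z \<omega>) ^ ?m) *\<^sub>R z \<omega>) \<bullet> D \<omega>" for \<omega>
  have L: "integrable M L" "(\<integral>\<omega>. L \<omega> \<partial>M) = 0" using zero by (simp_all add: L_def[abs_def])
  define U where "U \<omega> = Z (2 * n) \<omega> + 2 * real n * L \<omega> + (?E * (Z ?m \<omega> * (norm (D \<omega>))\<^sup>2) + ?E * (Z 0 \<omega> * norm (D \<omega>) ^ (2 * n)))" for \<omega>
  have Z2n: "integrable M (Z (2 * n))" using Zi[of "2 * n" 0 0] by simp
  have Ui: "integrable M U" unfolding U_def
    by (intro Bochner_Integration.integrable_add integrable_mult_right Z2n L two' many')
  have Uint: "(\<integral>\<omega>. U \<omega> \<partial>M) = (\<integral>\<omega>. Z (2 * n) \<omega> \<partial>M) + (?E * (\<integral>\<omega>. Z ?m \<omega> * (norm (D \<omega>))\<^sup>2 \<partial>M) + ?E * (\<integral>\<omega>. Z 0 \<omega> * norm (D \<omega>) ^ (2 * n) \<partial>M))"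
    unfolding U_def
    by (simp only: Bochner_Integration.integral_add Bochner_Integration.integrable_add integrable_mult_right integral_mult_right_zero Z2n L two' many' mult_zero_right add_0_right)
  have le: "\<phi> \<omega> * norm (z \<omega> + D \<omega>) ^ (2 * n) \<le> U \<omega>" if w: "\<omega> \<in> space M" for \<omega>
    using mult_left_mono[OF norm_power_expansion[OF n, of "z \<omega>" "D \<omega>"] \<phi>(1)[OF w]]
    by (simp add: U_def Z_def L_def algebra_simps)
  show i: "integrable M (\<lambda>\<omega>. \<phi> \<omega> * norm (z \<omega> + D \<omega>) ^ (2 * n))"
    by (rule Bochner_Integration.integrable_bound[OF Ui]) (use le \<phi>(1) in \<open>auto intro!: AE_I2 order_trans[OF _ abs_ge_self]\<close>)
    have "integrable M (\<lambda>\<omega>. Z (2 * n) \<omega> + (power_step_const n c1 cn T * (Z (2 * n) \<omega> * b \<omega> ^ 0 * h \<omega> ^ 1) + power_step_const n c1 cn T * (Z 0 \<omega> * b \<omega> ^ (2 * n) * h \<omega> ^ 1)))"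
      by (intro Bochner_Integration.integrable_add integrable_mult_right Z2n Zi)
    then show RHS: "integrable M (\<lambda>\<omega>. \<phi> \<omega> * (norm (z \<omega>) ^ (2 * n) + power_step_const n c1 cn T * h \<omega> * (norm (z \<omega>) ^ (2 * n) + b \<omega> ^ (2 * n))))"
      by (simp add: Z_def algebra_simps)
  have "(\<integral>\<omega>. \<phi> \<omega> * norm (z \<omega> + D \<omega>) ^ (2 * n) \<partial>M) \<le> (\<integral>\<omega>. U \<omega> \<partial>M)"
    by (rule integral_mono[OF i Ui le])
  also have "\<dots> \<le> (\<integral>\<omega>. Z (2 * n) \<omega> \<partial>M) + (?E * (\<integral>\<omega>. c1 * (Z ?m \<omega> * b \<omega> ^ 2 * h \<omega> ^ 1) \<partial>M) + ?E * (\<integral>\<omega>. cn * (Z 0 \<omega> * b \<omega> ^ (2 * n) * h \<omega> ^ n) \<partial>M))"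
    unfolding Uint using two'(2) many'(2) E0 by (intro add_mono mult_left_mono) auto
  also have "\<dots> = (\<integral>\<omega>. Z (2 * n) \<omega> + (?E * (c1 * (Z ?m \<omega> * b \<omega> ^ 2 * h \<omega> ^ 1)) + ?E * (cn * (Z 0 \<omega> * b \<omega> ^ (2 * n) * h \<omega> ^ n))) \<partial>M)"
    by (simp only: Bochner_Integration.integral_add Bochner_Integration.integrable_add integrable_mult_right integral_mult_right_zero Z2n i1)
  also have "\<dots> \<le> (\<integral>\<omega>. \<phi> \<omega> * (norm (z \<omega>) ^ (2 * n)
            + power_step_const n c1 cn T * h \<omega> * (norm (z \<omega>) ^ (2 * n) + b \<omega> ^ (2 * n))) \<partial>M)"
  proof (rule integral_mono)
    show "integrable M (\<lambda>\<omega>. Z (2 * n) \<omega> + (?E * (c1 * (Z ?m \<omega> * b \<omega> ^ 2 * h \<omega> ^ 1)) + ?E * (cn * (Z 0 \<omega> * b \<omega> ^ (2 * n) * h \<omega> ^ n))))"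
      by (intro Bochner_Integration.integrable_add integrable_mult_right Z2n i1)
    show "integrable M (\<lambda>\<omega>. \<phi> \<omega> * (norm (z \<omega>) ^ (2 * n) + power_step_const n c1 cn T * h \<omega> * (norm (z \<omega>) ^ (2 * n) + b \<omega> ^ (2 * n))))"
      by (rule RHS)
    fix \<omega> assume w: "\<omega> \<in> space M"
    have hn: "h \<omega> ^ n \<le> T ^ (n - 1) * h \<omega>"
    proof -
      have "h \<omega> ^ n = h \<omega> ^ (n - 1) * h \<omega>" using n by (cases n) auto
      then show ?thesis using h[OF w] by (auto intro!: mult_right_mono power_mono)
    qed
    have "Z ?m \<omega> * b \<omega> ^ 2 * h \<omega> \<le> \<phi> \<omega> * h \<omega> * (norm (z \<omega>) ^ (2 * n) + b \<omega> ^ (2 * n))"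
      using mult_left_mono[OF power_product_le_sum[of "norm (z \<omega>)" "b \<omega>" n], of "\<phi> \<omega> * h \<omega>"] bB(2) n \<phi>(1)[OF w] h[OF w]
      by (simp add: Z_def mult_ac)
    moreover have "Z 0 \<omega> * b \<omega> ^ (2 * n) * h \<omega> ^ n \<le> T ^ (n - 1) * (\<phi> \<omega> * h \<omega> * (norm (z \<omega>) ^ (2 * n) + b \<omega> ^ (2 * n)))"
    proof -
      have "Z 0 \<omega> * b \<omega> ^ (2 * n) * h \<omega> ^ n \<le> \<phi> \<omega> * b \<omega> ^ (2 * n) * (T ^ (n - 1) * h \<omega>)"
        using mult_left_mono[OF hn, of "\<phi> \<omega> * b \<omega> ^ (2 * n)"] \<phi>(1)[OF w] bB(2)[of \<omega>] by (simp add: Z_def)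
      also have "\<dots> = T ^ (n - 1) * (\<phi> \<omega> * h \<omega> * b \<omega> ^ (2 * n))" by simp
      also have "\<dots> \<le> T ^ (n - 1) * (\<phi> \<omega> * h \<omega> * (norm (z \<omega>) ^ (2 * n) + b \<omega> ^ (2 * n)))"
        using c0 \<phi>(1)[OF w] h[OF w] by (intro mult_left_mono) auto
      finally show ?thesis .
    qed
    ultimately have "?E * (c1 * (Z ?m \<omega> * b \<omega> ^ 2 * h \<omega>)) + ?E * (cn * (Z 0 \<omega> * b \<omega> ^ (2 * n) * h \<omega> ^ n))
      \<le> ?E * (c1 * (\<phi> \<omega> * h \<omega> * (norm (z \<omega>) ^ (2 * n) + b \<omega> ^ (2 * n)))) + ?E * (cn * (T ^ (n - 1) * (\<phi> \<omega> * h \<omega> * (norm (z \<omega>) ^ (2 * n) + b \<omega> ^ (2 * n)))))"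
      using E0 c1 by (intro add_mono mult_left_mono) auto
    also have "\<dots> = \<phi> \<omega> * (power_step_const n c1 cn T * h \<omega> * (norm (z \<omega>) ^ (2 * n) + b \<omega> ^ (2 * n)))"
      by (simp add: power_step_const_def algebra_simps)
    finally show "Z (2 * n) \<omega> + (?E * (c1 * (Z ?m \<omega> * b \<omega> ^ 2 * h \<omega> ^ 1)) + ?E * (cn * (Z 0 \<omega> * b \<omega> ^ (2 * n) * h \<omega> ^ n)))
      \<le> \<phi> \<omega> * (norm (z \<omega>) ^ (2 * n) + power_step_const n c1 cn T * h \<omega> * (norm (z \<omega>) ^ (2 * n) + b \<omega> ^ (2 * n)))"
      by (simp add: Z_def distrib_left)
  qed
  finally show "(\<integral>\<omega>. \<phi> \<omega> * norm (z \<omega> + D \<omega>) ^ (2 * n) \<partial>M)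
      \<le> (\<integral>\<omega>. \<phi> \<omega> * (norm (z \<omega>) ^ (2 * n)
            + power_step_const n c1 cn T * h \<omega> * (norm (z \<omega>) ^ (2 * n) + b \<omega> ^ (2 * n))) \<partial>M)" .
qed

end


section \<open>Mean increments over a random step\<close>

text \<open>Integrate the tangent inequality \<open>a ^ k + real k * a ^ (k - 1) * (x - a) \<le> x ^ k\<close> at the mean \<open>a\<close>.\<close>

lemma power_mean_unit_interval:
  fixes g :: "real \<Rightarrow> real"
  assumes g: "continuous_on UNIV g" "\<And>s. 0 \<le> g s" and k: "1 \<le> k"
  shows "(LBINT s:{0..1}. g s) ^ k \<le> (LBINT s:{0..1}. g s ^ k)"
proof -
  have si: "set_integrable lborel {0..1} u" if "continuous_on UNIV u" for u :: "real \<Rightarrow> real"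
    by (rule borel_integrable_atLeastAtMost'[OF continuous_on_subset[OF that]]) simp
  define a where "a = (LBINT s:{0..1}. g s)"
  have a0: "0 \<le> a" unfolding a_def set_lebesgue_integral_def using g(2) by (intro integral_nonneg_AE) auto
  have one: "(LBINT s:{0..1::real}. (c::real)) = c" for c
    using set_borel_integral_eq_integral(2)[OF si[OF continuous_on_const[of UNIV c]]] by simp
  have tangent: "a ^ k + real k * a ^ (k - 1) * (x - a) \<le> x ^ k" if x: "0 \<le> x" for x
  proof (cases "a = 0")
    case True
    then show ?thesis using x k by (cases "k = 1") (auto simp: power_0_left)
  next
    case False
    then have "-1 \<le> x / a - 1" using x a0 by simp
    from Bernoulli_inequality[OF this, of k] have "a ^ k * (1 + real k * (x / a - 1)) \<le> a ^ k * (x / a) ^ k"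
      using a0 by (intro mult_left_mono) auto
    also have "a ^ k * (x / a) ^ k = x ^ k" using False by (simp add: power_divide)
    also have "a ^ k * (1 + real k * (x / a - 1)) = a ^ k + real k * a ^ (k - 1) * (x - a)"
    proof -
      have "a ^ k * (x / a - 1) = a ^ (k - 1) * (a * (x / a - 1))" using k by (cases k) auto
      also have "a * (x / a - 1) = x - a" using False by (simp add: field_simps)
      finally have *: "a ^ k * (x / a - 1) = a ^ (k - 1) * (x - a)" .
      have "a ^ k * (1 + real k * (x / a - 1)) = a ^ k + real k * (a ^ k * (x / a - 1))" by (simp only: distrib_left mult.left_commute mult_1_right)
      then show ?thesis unfolding * by simp
    qed
    finally show ?thesis .
  qed
  have i1: "set_integrable lborel {0..1} (\<lambda>s. real k * a ^ (k - 1) * (g s - a))" by (intro si continuous_intros g)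
  have ik: "set_integrable lborel {0..1} (\<lambda>s. g s ^ k)" by (intro si continuous_intros g)
  have ic: "set_integrable lborel {0..1} (\<lambda>s::real. a ^ k)" by (rule si[OF continuous_on_const])
  have "(LBINT s:{0..1}. g s - a) = 0"
    using si[OF g(1)] si[OF continuous_on_const[of _ a]] one[of a]
    by (subst set_integral_diff) (auto simp: a_def)
  then have "(LBINT s:{0..1}. a ^ k + real k * a ^ (k - 1) * (g s - a)) = a ^ k"
    by (subst set_integral_add(2)[OF ic i1]) (simp add: one)
  moreover have "(LBINT s:{0..1}. a ^ k + real k * a ^ (k - 1) * (g s - a)) \<le> (LBINT s:{0..1}. g s ^ k)"
    by (rule set_integral_mono[OF set_integral_add(1)[OF ic i1] ik]) (use tangent g(2) in auto)
  ultimately show ?thesis by (simp add: a_def)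
qed

lemma norm_mean_increment_le:
  assumes w: "continuous_on UNIV w"
  shows "(norm (mean_increment w t h))\<^sup>2 \<le> mean_sq_increment w t h"
proof -
  let ?g = "\<lambda>s. norm (w (t + s * h) - w t)"
  have c: "continuous_on UNIV (\<lambda>s. w (t + s * h) - w t)"
    by (intro continuous_intros continuous_on_compose2[OF w]) auto
  have "norm (mean_increment w t h) \<le> (LBINT s:{0..1}. ?g s)"
    unfolding mean_increment_def
    using set_integral_norm_bound[OF borel_integrable_atLeastAtMost'[OF continuous_on_subset[OF c, of "{0..1}"]]] by simp
  then have "(norm (mean_increment w t h))\<^sup>2 \<le> (LBINT s:{0..1}. ?g s)\<^sup>2" by (rule power_mono) simp
  also have "\<dots> \<le> mean_sq_increment w t h"
    unfolding mean_sq_increment_def by (rule power_mean_unit_interval) (auto intro!: continuous_intros c)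
  finally show ?thesis .
qed

context brownian_process begin

text \<open>The clipped argument keeps every intermediate time between \<open>\<tau>\<close> and \<open>\<tau> + h\<close> also outside the unit
interval, so that the integrand is known at the end of the step for each real \<open>s\<close>.\<close>

lemma mean_increment_measurable:
  assumes \<tau>: "stopping_time F \<tau>" and h: "h \<in> borel_measurable (pre_sigma \<tau>)" "\<And>\<omega>. \<omega> \<in> space M \<Longrightarrow> 0 \<le> h \<omega>"
  defines "\<rho> \<equiv> \<lambda>\<omega>. \<tau> \<omega> + h \<omega>"
  shows "(\<lambda>\<omega>. mean_increment (\<lambda>t. W t \<omega>) (\<tau> \<omega>) (h \<omega>)) \<in> borel_measurable (pre_sigma \<rho>)"
    and "(\<lambda>\<omega>. mean_sq_increment (\<lambda>t. W t \<omega>) (\<tau> \<omega>) (h \<omega>)) \<in> borel_measurable (pre_sigma \<rho>)"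
proof -
  note \<tau>m = measurable_stopping_time_pre_sigma[OF \<tau>]
  have \<rho>m: "\<rho> \<in> borel_measurable (pre_sigma \<tau>)" unfolding \<rho>_def using \<tau>m h by measurable
  have \<rho>s: "stopping_time F \<rho>" by (rule later_stopping_time[OF \<tau> \<rho>m]) (use h in \<open>auto simp: \<rho>_def\<close>)
  define clip where "clip s = max 0 (min 1 s)" for s :: real
  have clip: "0 \<le> clip s" "clip s \<le> 1" "s \<in> {0..1} \<Longrightarrow> clip s = s" for s by (auto simp: clip_def)
  have clip_c: "continuous_on UNIV clip" unfolding clip_def by (intro continuous_intros)
  define Z where "Z s \<omega> = W (\<tau> \<omega> + clip s * h \<omega>) \<omega> - W (\<tau> \<omega>) \<omega>" for s \<omega>
  have Zm: "Z s \<in> borel_measurable (pre_sigma \<rho>)" for s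
  proof -
    let ?\<sigma> = "\<lambda>\<omega>. \<tau> \<omega> + clip s * h \<omega>"
    have \<sigma>m: "?\<sigma> \<in> borel_measurable (pre_sigma \<tau>)" using \<tau>m h by measurable
    have \<sigma>s: "stopping_time F ?\<sigma>" by (rule later_stopping_time[OF \<tau> \<sigma>m]) (use h clip in auto)
    have "(\<lambda>\<omega>. W (?\<sigma> \<omega>) \<omega>) \<in> borel_measurable (pre_sigma \<rho>)"
      by (rule pre_sigma_later[OF \<sigma>s \<rho>s _ W_stopped[OF \<sigma>s]]) (use h clip in \<open>auto simp: \<rho>_def mult_left_le_one_le\<close>)
    moreover have "(\<lambda>\<omega>. W (\<tau> \<omega>) \<omega>) \<in> borel_measurable (pre_sigma \<rho>)"
      by (rule pre_sigma_later[OF \<tau> \<rho>s _ W_stopped[OF \<tau>]]) (use h in \<open>auto simp: \<rho>_def\<close>)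
    ultimately show ?thesis unfolding Z_def by (rule borel_measurable_diff)
  qed
  have "(\<lambda>(s, \<omega>). Z s \<omega>) \<in> borel_measurable (borel \<Otimes>\<^sub>M pre_sigma \<rho>)"
  proof (rule caratheodory_measurable[OF Zm])
    fix \<omega> assume "\<omega> \<in> space (pre_sigma \<rho>)"
    then have "\<omega> \<in> space M" by (simp add: space_pre_sigma)
    then show "continuous_on UNIV (\<lambda>s. Z s \<omega>)"
      unfolding Z_def by (intro continuous_intros continuous_on_compose2[OF W_cont] clip_c) auto
  qed
  from measurable_compose[OF measurable_pair_swap' this]
  have [measurable]: "(\<lambda>(\<omega>, s). Z s \<omega>) \<in> borel_measurable (pre_sigma \<rho> \<Otimes>\<^sub>M lborel)"
    by (simp add: split_beta' cong: measurable_cong_sets)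
  have "(\<lambda>\<omega>. \<integral>s. indicator {0..1} s *\<^sub>R Z s \<omega> \<partial>lborel) \<in> borel_measurable (pre_sigma \<rho>)"
    by measurable
  also have "(\<lambda>\<omega>. \<integral>s. indicator {0..1} s *\<^sub>R Z s \<omega> \<partial>lborel) = (\<lambda>\<omega>. mean_increment (\<lambda>t. W t \<omega>) (\<tau> \<omega>) (h \<omega>))"
    unfolding mean_increment_def set_lebesgue_integral_def Z_def
    by (intro ext Bochner_Integration.integral_cong) (auto simp: clip split: split_indicator)
  finally show "(\<lambda>\<omega>. mean_increment (\<lambda>t. W t \<omega>) (\<tau> \<omega>) (h \<omega>)) \<in> borel_measurable (pre_sigma \<rho>)" .
  have "(\<lambda>\<omega>. \<integral>s. indicator {0..1} s *\<^sub>R (norm (Z s \<omega>))\<^sup>2 \<partial>lborel) \<in> borel_measurable (pre_sigma \<rho>)"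
    by measurable
  also have "(\<lambda>\<omega>. \<integral>s. indicator {0..1} s *\<^sub>R (norm (Z s \<omega>))\<^sup>2 \<partial>lborel) = (\<lambda>\<omega>. mean_sq_increment (\<lambda>t. W t \<omega>) (\<tau> \<omega>) (h \<omega>))"
    unfolding mean_sq_increment_def set_lebesgue_integral_def Z_def
    by (intro ext Bochner_Integration.integral_cong) (auto simp: clip split: split_indicator)
  finally show "(\<lambda>\<omega>. mean_sq_increment (\<lambda>t. W t \<omega>) (\<tau> \<omega>) (h \<omega>)) \<in> borel_measurable (pre_sigma \<rho>)" .
qed

lemma random_step_measurable:
  assumes \<tau>: "\<tau> \<in> borel_measurable M" and h: "h \<in> borel_measurable M"
  shows "(\<lambda>(s, \<omega>). W (\<tau> \<omega> + s * h \<omega>) \<omega> - W (\<tau> \<omega>) \<omega>) \<in> borel_measurable (borel \<Otimes>\<^sub>M M)"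
proof (rule caratheodory_measurable)
  note [measurable] = \<tau> h
  show "(\<lambda>\<omega>. W (\<tau> \<omega> + s * h \<omega>) \<omega> - W (\<tau> \<omega>) \<omega>) \<in> borel_measurable M" for s
    by (intro borel_measurable_diff W_random_time) measurable
  show "continuous_on UNIV (\<lambda>s. W (\<tau> \<omega> + s * h \<omega>) \<omega> - W (\<tau> \<omega>) \<omega>)" if "\<omega> \<in> space M" for \<omega>
    by (intro continuous_intros continuous_on_compose2[OF W_cont[OF that]]) auto
qed

text \<open>By convexity and Fubini this reduces to the increment over the fraction \<open>s\<close> of the step, to which
\<open>increment_moment\<close> applies because \<open>\<tau> + s * h\<close> is known at \<open>\<tau>\<close>.\<close>

lemma mean_sq_increment_moment:
  fixes \<phi> :: "'w \<Rightarrow> real"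
  assumes \<tau>: "stopping_time F \<tau>" and \<tau>0: "\<And>\<omega>. \<omega> \<in> space M \<Longrightarrow> 0 \<le> \<tau> \<omega>"
    and h: "h \<in> borel_measurable (pre_sigma \<tau>)" "\<And>\<omega>. \<omega> \<in> space M \<Longrightarrow> 0 \<le> h \<omega>" "\<And>\<omega>. \<omega> \<in> space M \<Longrightarrow> h \<omega> \<le> b"
    and \<phi>: "\<phi> \<in> borel_measurable (pre_sigma \<tau>)" and k: "1 \<le> k"
    and c: "\<And>\<omega>. \<omega> \<in> space M \<Longrightarrow> 0 \<le> \<phi> \<omega>" "\<And>\<omega>. \<omega> \<in> space M \<Longrightarrow> \<phi> \<omega> \<le> c"
  shows "(\<integral>\<^sup>+\<omega>. ennreal (\<phi> \<omega> * mean_sq_increment (\<lambda>t. W t \<omega>) (\<tau> \<omega>) (h \<omega>) ^ k) \<partial>M)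
    \<le> (\<integral>\<^sup>+\<omega>. ennreal (\<phi> \<omega> * (gauss_moment TYPE('m) k * h \<omega> ^ k)) \<partial>M)"
proof -
  note \<tau>m = measurable_stopping_time_pre_sigma[OF \<tau>]
  note [measurable] = pre_sigma_measurable[OF \<tau> \<tau>m] pre_sigma_measurable[OF \<tau> h(1)] pre_sigma_measurable[OF \<tau> \<phi>]
  let ?g = "gauss_moment TYPE('m) k"
  have g0: "0 \<le> ?g" by (rule gauss_moment_nonneg)
  define D where "D s \<omega> = W (\<tau> \<omega> + s * h \<omega>) \<omega> - W (\<tau> \<omega>) \<omega>" for s \<omega>
  have Dm: "(\<lambda>(s, \<omega>). D s \<omega>) \<in> borel_measurable (borel \<Otimes>\<^sub>M M)"
    unfolding D_def by (rule random_step_measurable) measurable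
  have [measurable]: "(\<lambda>p. D (fst p) (snd p)) \<in> borel_measurable (lborel \<Otimes>\<^sub>M M)"
    using Dm by (simp add: split_beta' cong: measurable_cong_sets)
  have Dc: "continuous_on UNIV (\<lambda>s. D s \<omega>)" if "\<omega> \<in> space M" for \<omega>
    unfolding D_def by (intro continuous_intros continuous_on_compose2[OF W_cont[OF that]]) auto
  have pw: "ennreal (\<phi> \<omega> * mean_sq_increment (\<lambda>t. W t \<omega>) (\<tau> \<omega>) (h \<omega>) ^ k)
      \<le> (\<integral>\<^sup>+s. indicator {0..1} s * ennreal (\<phi> \<omega> * norm (D s \<omega>) ^ (2 * k)) \<partial>lborel)" if w: "\<omega> \<in> space M" for \<omega>
  proof -
    have cD: "continuous_on UNIV (\<lambda>s. norm (D s \<omega>) ^ (2 * k))" by (intro continuous_intros Dc w)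
    have "mean_sq_increment (\<lambda>t. W t \<omega>) (\<tau> \<omega>) (h \<omega>) ^ k \<le> (LBINT s:{0..1}. ((norm (D s \<omega>))\<^sup>2) ^ k)"
      unfolding mean_sq_increment_def D_def[symmetric]
      by (rule power_mean_unit_interval) (use k in \<open>auto intro!: continuous_intros Dc w\<close>)
    also have "\<dots> = (LBINT s:{0..1}. norm (D s \<omega>) ^ (2 * k))" by (simp add: power_mult)
    finally have 1: "\<phi> \<omega> * mean_sq_increment (\<lambda>t. W t \<omega>) (\<tau> \<omega>) (h \<omega>) ^ k \<le> \<phi> \<omega> * (LBINT s:{0..1}. norm (D s \<omega>) ^ (2 * k))"
      using c(1)[OF w] by (rule mult_left_mono)
    have si: "set_integrable lborel {0..1} (\<lambda>s. \<phi> \<omega> * norm (D s \<omega>) ^ (2 * k))"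
      by (rule borel_integrable_atLeastAtMost') (intro continuous_intros continuous_on_subset[OF Dc[OF w]]; simp)
    have "(\<integral>\<^sup>+s. indicator {0..1} s * ennreal (\<phi> \<omega> * norm (D s \<omega>) ^ (2 * k)) \<partial>lborel)
      = (\<integral>\<^sup>+s. ennreal (indicator {0..1} s *\<^sub>R (\<phi> \<omega> * norm (D s \<omega>) ^ (2 * k))) \<partial>lborel)"
      by (intro nn_integral_cong) (auto split: split_indicator)
    also have "\<dots> = ennreal (LBINT s:{0..1}. \<phi> \<omega> * norm (D s \<omega>) ^ (2 * k))"
      unfolding set_lebesgue_integral_def using si c(1)[OF w]
      by (intro nn_integral_eq_integral) (auto simp: set_integrable_def)
    finally show ?thesis using 1 by (simp add: ennreal_leI)
  qed
  interpret pair_sigma_finite lborel M ..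
  have inner: "(\<integral>\<^sup>+\<omega>. ennreal (\<phi> \<omega> * norm (D s \<omega>) ^ (2 * k)) \<partial>M) \<le> (\<integral>\<^sup>+\<omega>. ennreal (\<phi> \<omega> * (?g * h \<omega> ^ k)) \<partial>M)" if s: "s \<in> {0..1}" for s
  proof -
    have "(\<integral>\<^sup>+\<omega>. ennreal (\<phi> \<omega> * norm (D s \<omega>) ^ (2 * k)) \<partial>M)
        \<le> (\<integral>\<^sup>+\<omega>. ennreal (\<phi> \<omega> * (?g * (\<tau> \<omega> + s * h \<omega> - \<tau> \<omega>) ^ k)) \<partial>M)"
      unfolding D_def
    proof (rule increment_moment[OF \<tau> \<tau>0 _ _ \<phi> k _ c])
      show "(\<lambda>\<omega>. \<tau> \<omega> + s * h \<omega>) \<in> borel_measurable (pre_sigma \<tau>)" using \<tau>m h(1) by measurable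
      show "\<tau> \<omega> + s * h \<omega> - \<tau> \<omega> \<le> b" if "\<omega> \<in> space M" for \<omega>
        using s h(2,3)[OF that] mult_left_le_one_le[of "h \<omega>" s] by auto
    qed (use s h in auto)
    also have "\<dots> \<le> (\<integral>\<^sup>+\<omega>. ennreal (\<phi> \<omega> * (?g * h \<omega> ^ k)) \<partial>M)"
      using s h(2) c(1) g0 by (intro nn_integral_mono ennreal_leI mult_left_mono power_mono) (auto simp: mult_left_le_one_le)
    finally show ?thesis .
  qed
  have "(\<integral>\<^sup>+\<omega>. ennreal (\<phi> \<omega> * mean_sq_increment (\<lambda>t. W t \<omega>) (\<tau> \<omega>) (h \<omega>) ^ k) \<partial>M)
     \<le> (\<integral>\<^sup>+\<omega>. \<integral>\<^sup>+s. indicator {0..1} s * ennreal (\<phi> \<omega> * norm (D s \<omega>) ^ (2 * k)) \<partial>lborel \<partial>M)"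
    by (rule nn_integral_mono[OF pw])
  also have "\<dots> = (\<integral>\<^sup>+s. \<integral>\<^sup>+\<omega>. indicator {0..1} s * ennreal (\<phi> \<omega> * norm (D s \<omega>) ^ (2 * k)) \<partial>M \<partial>lborel)"
    using Fubini[of "\<lambda>p. indicator {0..1} (fst p) * ennreal (\<phi> (snd p) * norm (D (fst p) (snd p)) ^ (2 * k))"] by simp
  also have "\<dots> \<le> (\<integral>\<^sup>+s. indicator {0..1} (s::real) * (\<integral>\<^sup>+\<omega>. ennreal (\<phi> \<omega> * (?g * h \<omega> ^ k)) \<partial>M) \<partial>lborel)"
  proof (rule nn_integral_mono)
    fix s :: real
    show "(\<integral>\<^sup>+\<omega>. indicator {0..1} s * ennreal (\<phi> \<omega> * norm (D s \<omega>) ^ (2 * k)) \<partial>M) \<le> indicator {0..1} s * (\<integral>\<^sup>+\<omega>. ennreal (\<phi> \<omega> * (?g * h \<omega> ^ k)) \<partial>M)"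
      using inner[of s] by (cases "s \<in> {0..1}") auto
  qed
  also have "\<dots> = (\<integral>\<^sup>+\<omega>. ennreal (\<phi> \<omega> * (?g * h \<omega> ^ k)) \<partial>M)"
    by (subst nn_integral_multc) auto
  finally show ?thesis .
qed

text \<open>Again by Fubini; here integrability on the product space has to be established first.\<close>

lemma mean_increment_mean_zero:
  fixes v :: "'w \<Rightarrow> real ^ 'm"
  assumes \<tau>: "stopping_time F \<tau>" and \<tau>0: "\<And>\<omega>. \<omega> \<in> space M \<Longrightarrow> 0 \<le> \<tau> \<omega>"
    and h: "h \<in> borel_measurable (pre_sigma \<tau>)" "\<And>\<omega>. \<omega> \<in> space M \<Longrightarrow> 0 \<le> h \<omega>" "\<And>\<omega>. \<omega> \<in> space M \<Longrightarrow> h \<omega> \<le> b"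
    and \<tau>b: "\<And>\<omega>. \<omega> \<in> space M \<Longrightarrow> \<tau> \<omega> \<le> b'"
    and v: "v \<in> borel_measurable (pre_sigma \<tau>)" and B: "\<And>\<omega>. \<omega> \<in> space M \<Longrightarrow> norm (v \<omega>) \<le> B"
  shows "integrable M (\<lambda>\<omega>. v \<omega> \<bullet> mean_increment (\<lambda>t. W t \<omega>) (\<tau> \<omega>) (h \<omega>))"
    and "(\<integral>\<omega>. v \<omega> \<bullet> mean_increment (\<lambda>t. W t \<omega>) (\<tau> \<omega>) (h \<omega>) \<partial>M) = 0"
proof -
  note \<tau>m = measurable_stopping_time_pre_sigma[OF \<tau>]
  note [measurable] = pre_sigma_measurable[OF \<tau> \<tau>m] pre_sigma_measurable[OF \<tau> h(1)] pre_sigma_measurable[OF \<tau> v]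
  obtain \<omega>0 where w0: "\<omega>0 \<in> space M" using not_empty by auto
  have B0: "0 \<le> B" using B[OF w0] norm_ge_zero order_trans by blast
  let ?g = "gauss_moment TYPE('m) 1"
  define D where "D s \<omega> = W (\<tau> \<omega> + s * h \<omega>) \<omega> - W (\<tau> \<omega>) \<omega>" for s \<omega>
  have Dm: "(\<lambda>(s, \<omega>). D s \<omega>) \<in> borel_measurable (borel \<Otimes>\<^sub>M M)"
    unfolding D_def by (rule random_step_measurable) measurable
  have [measurable]: "(\<lambda>p. D (fst p) (snd p)) \<in> borel_measurable (lborel \<Otimes>\<^sub>M M)"
    using Dm by (simp add: split_beta' cong: measurable_cong_sets)
  have Dc: "continuous_on UNIV (\<lambda>s. D s \<omega>)" if "\<omega> \<in> space M" for \<omega>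
    unfolding D_def by (intro continuous_intros continuous_on_compose2[OF W_cont[OF that]]) auto
  have \<sigma>m: "(\<lambda>\<omega>. \<tau> \<omega> + s * h \<omega>) \<in> borel_measurable (pre_sigma \<tau>)" for s using \<tau>m h(1) by measurable
  have step: "\<tau> \<omega> \<le> \<tau> \<omega> + s * h \<omega>" "\<tau> \<omega> + s * h \<omega> - \<tau> \<omega> \<le> b" "\<tau> \<omega> + s * h \<omega> \<le> b' + b"
    if "s \<in> {0..1}" "\<omega> \<in> space M" for s \<omega>
    using that h(2,3)[OF that(2)] \<tau>b[OF that(2)] mult_left_le_one_le[of "h \<omega>" s] by auto
  define G where "G p = indicator {0..1} (fst p) * (v (snd p) \<bullet> D (fst p) (snd p))" for p :: "real \<times> 'w"
  have Gm[measurable]: "G \<in> borel_measurable (lborel \<Otimes>\<^sub>M M)" unfolding G_def by measurable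
  interpret P: pair_sigma_finite lborel M ..
  have Gi: "integrable (lborel \<Otimes>\<^sub>M M) G"
  proof (rule integrableI_bounded[OF Gm])
    have inner: "(\<integral>\<^sup>+\<omega>. ennreal (norm (G (s, \<omega>))) \<partial>M) \<le> indicator {0..1} s * ennreal (B * (1 + ?g * b))" for s
    proof (cases "s \<in> {0..1}")
      case s: True
      note st = step[OF s]
      have si: "integrable M (\<lambda>\<omega>. norm (D s \<omega>) ^ 2)"
        using increment_moment_integrable(1)[OF \<tau> \<tau>0 \<sigma>m st(1) _ st(2), of 1] by (simp add: D_def)
      have Ds: "D s \<in> borel_measurable M"
        unfolding D_def by (intro borel_measurable_diff W_random_time) measurable
      note n1 = norm_integral_le_second_moment[OF si Ds]
      have "(\<integral>\<^sup>+\<omega>. ennreal (norm (G (s, \<omega>))) \<partial>M) \<le> (\<integral>\<^sup>+\<omega>. ennreal (B * norm (D s \<omega>)) \<partial>M)"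
        using s by (intro nn_integral_mono ennreal_leI)
          (auto simp: G_def intro!: order_trans[OF Cauchy_Schwarz_ineq2] mult_right_mono B)
      also have "\<dots> = ennreal (\<integral>\<omega>. B * norm (D s \<omega>) \<partial>M)"
        using n1(1) B0 by (intro nn_integral_eq_integral) auto
      also have "\<dots> \<le> ennreal (B * (1 + ?g * b))"
      proof (rule ennreal_leI)
        have "(\<integral>\<omega>. norm (D s \<omega>) \<partial>M) \<le> 1 + (\<integral>\<omega>. norm (D s \<omega>) ^ 2 \<partial>M) / 1" by (rule n1(2)) simp
        also have "(\<integral>\<omega>. norm (D s \<omega>) ^ 2 \<partial>M) \<le> ?g * b"
          using increment_moment_integrable(2)[OF \<tau> \<tau>0 \<sigma>m st(1) _ st(2), of 1] by (simp add: D_def)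
        finally show "(\<integral>\<omega>. B * norm (D s \<omega>) \<partial>M) \<le> B * (1 + ?g * b)"
          using B0 by (simp add: mult_left_mono)
      qed
      finally show ?thesis using s by simp
    qed (simp add: G_def)
    have "(\<integral>\<^sup>+p. ennreal (norm (G p)) \<partial>(lborel \<Otimes>\<^sub>M M)) = (\<integral>\<^sup>+s. \<integral>\<^sup>+\<omega>. ennreal (norm (G (s, \<omega>))) \<partial>M \<partial>lborel)"
      by (rule nn_integral_fst[symmetric]) measurable
    also have "\<dots> \<le> (\<integral>\<^sup>+s. indicator {0..1} (s::real) * ennreal (B * (1 + ?g * b)) \<partial>lborel)"
      by (intro nn_integral_mono inner)
    also have "\<dots> = ennreal (B * (1 + ?g * b))" by (subst nn_integral_multc) auto
    finally show "(\<integral>\<^sup>+p. ennreal (norm (G p)) \<partial>(lborel \<Otimes>\<^sub>M M)) < \<infinity>" by (simp add: le_less_trans)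
  qed
  have eq: "(\<integral>s. G (s, \<omega>) \<partial>lborel) = v \<omega> \<bullet> mean_increment (\<lambda>t. W t \<omega>) (\<tau> \<omega>) (h \<omega>)" if w: "\<omega> \<in> space M" for \<omega>
  proof -
    have "set_integrable lborel {0..1} (\<lambda>s. D s \<omega>)"
      by (rule borel_integrable_atLeastAtMost'[OF continuous_on_subset[OF Dc[OF w]]]) simp
    then have i: "integrable lborel (\<lambda>s. indicator {0..1} s *\<^sub>R D s \<omega>)" by (simp add: set_integrable_def)
    have "(\<integral>s. G (s, \<omega>) \<partial>lborel) = (\<integral>s. v \<omega> \<bullet> (indicator {0..1} s *\<^sub>R D s \<omega>) \<partial>lborel)"
      by (simp add: G_def)
    also have "\<dots> = v \<omega> \<bullet> (\<integral>s. indicator {0..1} s *\<^sub>R D s \<omega> \<partial>lborel)"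
      by (rule integral_inner_right) (use i in auto)
    finally show ?thesis by (simp add: mean_increment_def set_lebesgue_integral_def D_def)
  qed
  have Gi': "integrable (lborel \<Otimes>\<^sub>M M) (case_prod (\<lambda>s \<omega>. G (s, \<omega>)))" using Gi by simp
  have "integrable M (\<lambda>\<omega>. \<integral>s. G (s, \<omega>) \<partial>lborel)"
    using P.integrable_snd[OF Gi'] by simp
  then show "integrable M (\<lambda>\<omega>. v \<omega> \<bullet> mean_increment (\<lambda>t. W t \<omega>) (\<tau> \<omega>) (h \<omega>))"
    by (rule Bochner_Integration.integrable_cong[THEN iffD1, OF refl, rotated]) (simp add: eq)
  have "(\<integral>\<omega>. v \<omega> \<bullet> mean_increment (\<lambda>t. W t \<omega>) (\<tau> \<omega>) (h \<omega>) \<partial>M) = (\<integral>\<omega>. (\<integral>s. G (s, \<omega>) \<partial>lborel) \<partial>M)"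
    by (rule Bochner_Integration.integral_cong) (simp_all add: eq)
  also have "\<dots> = (\<integral>s. (\<integral>\<omega>. G (s, \<omega>) \<partial>M) \<partial>lborel)"
    using P.Fubini_integral[OF Gi'] by simp
  also have "\<dots> = (\<integral>s. 0 \<partial>(lborel :: real measure))"
  proof (rule Bochner_Integration.integral_cong[OF refl])
    fix s :: real
    show "(\<integral>\<omega>. G (s, \<omega>) \<partial>M) = 0"
    proof (cases "s \<in> {0..1}")
      case s: True
      note st = step[OF s]
      have "(\<integral>\<omega>. v \<omega> \<bullet> (W (\<tau> \<omega> + s * h \<omega>) \<omega> - W (\<tau> \<omega>) \<omega>) \<partial>M) = 0"
        by (rule increment_mean_zero(2)[OF \<tau> \<tau>0 \<sigma>m st(1) st(3) v B])
      then show ?thesis using s by (simp add: G_def D_def)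
    qed (simp add: G_def)
  qed
  finally show "(\<integral>\<omega>. v \<omega> \<bullet> mean_increment (\<lambda>t. W t \<omega>) (\<tau> \<omega>) (h \<omega>) \<partial>M) = 0" by simp
qed

end

section \<open>A Lyapunov function for the scheme\<close>

lemma matrix_vector_mult_measurable [measurable (raw)]:
  fixes A :: "'w \<Rightarrow> real ^ 'n ^ 'm" and y :: "'w \<Rightarrow> real ^ 'n"
  assumes [measurable]: "A \<in> borel_measurable M" "y \<in> borel_measurable M"
  shows "(\<lambda>\<omega>. A \<omega> *v y \<omega>) \<in> borel_measurable M"
proof (rule borel_measurable_continuous_Pair[OF assms])
  show "continuous_on UNIV (\<lambda>p. fst p *v snd p :: real ^ 'm)"
    unfolding matrix_vector_mult_def by (intro continuous_intros)
qed

lemma vector_matrix_mult_measurable [measurable (raw)]: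
  fixes A :: "'w \<Rightarrow> real ^ 'n ^ 'm" and y :: "'w \<Rightarrow> real ^ 'm"
  assumes [measurable]: "A \<in> borel_measurable M" "y \<in> borel_measurable M"
  shows "(\<lambda>\<omega>. y \<omega> v* A \<omega>) \<in> borel_measurable M"
proof (rule borel_measurable_continuous_Pair[OF assms])
  show "continuous_on UNIV (\<lambda>p. snd p v* fst p :: real ^ 'n)"
    unfolding vector_matrix_mult_def by (intro continuous_intros)
qed

lemma norm_vector_matrix_mult_le: "norm (y v* A) \<le> norm A * norm y"
  for A :: "real ^ 'n ^ 'm" and y :: "real ^ 'm"
proof (cases "y v* A = 0")
  case False
  have "(norm (y v* A))\<^sup>2 = y \<bullet> (A *v (y v* A))" by (simp add: power2_norm_eq_inner dot_lmul_matrix)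
  also have "\<dots> \<le> norm y * (norm A * norm (y v* A))"
    by (intro order_trans[OF norm_cauchy_schwarz] mult_left_mono norm_matrix_vector_mult_le) auto
  finally show ?thesis using False by (simp add: power2_eq_square mult_ac)
qed simp

text \<open>Convexity of the power, in the form that separates a factor \<open>v\<close>.\<close>

lemma power_add_le_tangent:
  fixes u v :: real assumes "0 \<le> u" "0 \<le> v" "1 \<le> n"
  shows "(u + v) ^ n \<le> u ^ n + real n * v * (u + v) ^ (n - 1)"
  using assms(3,1,2)
proof (induction n rule: nat_induct_at_least)
  case (Suc n)
  have "(u + v) ^ Suc n = u * (u + v) ^ n + v * (u + v) ^ n" by (simp add: algebra_simps)
  also have "\<dots> \<le> u * (u ^ n + real n * v * (u + v) ^ (n - 1)) + v * (u + v) ^ n"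
    using Suc by (intro add_right_mono mult_left_mono) auto
  also have "\<dots> = u ^ Suc n + real n * v * (u * (u + v) ^ (n - 1)) + v * (u + v) ^ n"
    by (simp add: algebra_simps)
  also have "\<dots> \<le> u ^ Suc n + real n * v * ((u + v) * (u + v) ^ (n - 1)) + v * (u + v) ^ n"
    using Suc by (intro add_left_mono add_right_mono mult_left_mono mult_right_mono) auto
  also have "(u + v) * (u + v) ^ (n - 1) = (u + v) ^ n" using Suc by (cases n) auto
  finally show ?case by (simp add: algebra_simps)
qed simp

text \<open>For \<open>y = |x|\<^sup>2\<close> and \<open>y' = |x + H f(x)|\<^sup>2\<close>: the effect of the drift on high powers is of order \<open>H\<close>, uniformly
for \<open>H\<close> in a bounded interval.\<close>

lemma drift_power_le:
  fixes y y' H a T :: real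
  assumes y: "0 \<le> y" "0 \<le> y'" "y' \<le> y + 2 * H * a * (1 + y)" and H: "0 \<le> H" "H \<le> T" and a: "0 \<le> a" and N: "1 \<le> N"
  shows "y' ^ N \<le> y ^ N + H * (2 * a * real N * (1 + 2 * T * a) ^ N * 2 ^ N) * (1 + y ^ N)"
proof -
  define v where "v = 2 * H * a * (1 + y)"
  have v0: "0 \<le> v" using assms by (simp add: v_def)
  have "2 * H * a * (1 + y) \<le> 2 * T * a * (1 + y)" using assms by (intro mult_right_mono) auto
  then have yv: "y + v \<le> (1 + 2 * T * a) * (1 + y)" using y by (simp add: v_def algebra_simps)
  have "y' ^ N \<le> (y + v) ^ N" using y by (intro power_mono) (auto simp: v_def)
  also have "\<dots> \<le> y ^ N + real N * v * (y + v) ^ (N - 1)" by (rule power_add_le_tangent) (use y v0 N in auto)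
  also have "real N * v * (y + v) ^ (N - 1) \<le> real N * v * ((1 + 2 * T * a) * (1 + y)) ^ (N - 1)"
    using y v0 yv by (intro mult_left_mono power_mono) auto
  also have "\<dots> = H * (2 * a * real N * (1 + 2 * T * a) ^ (N - 1)) * (1 + y) ^ N"
    using N by (cases N) (auto simp: v_def power_mult_distrib)
  also have "\<dots> \<le> H * (2 * a * real N * (1 + 2 * T * a) ^ N) * (2 ^ N * (1 ^ N + y ^ N))"
    using y H a by (intro mult_mono mult_left_mono power_increasing power_add_le mult_nonneg_nonneg) auto
  finally show ?thesis by (simp add: mult_ac)
qed

text \<open>The first two summands of the result account for the grid values and the last one for the
martingale part. No quantity depending on \<open>\<delta>\<close> occurs, which is what makes the final constant uniform.\<close>

definition lyapunov_rate :: "'m::finite itself \<Rightarrow> nat \<Rightarrow> nat \<Rightarrow> real \<Rightarrow> real \<Rightarrow> real \<Rightarrow> real" where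
  "lyapunov_rate ty n N T a L =
    (let g = gauss_moment ty; E = 2 * a * real N * (1 + 2 * T * a) ^ N * 2 ^ N
     in E + power_step_const N (g 1) (g N) T * (1 + T * E)
        + power_step_const n (g 1) (g n) T * (1 + (T * L) ^ (2 * n)))"

text \<open>What moment bounds require of the scheme: the dissipativity condition \<open>drift\<close> keeps the values under
control, and the bound \<open>\<delta> * T\<close> for the steps pays for the division by \<open>\<delta>\<close> in \<open>em_mart\<close> and \<open>em_quad\<close>. Taking
\<open>J\<close> as a parameter lets the zero drift with \<open>J = 0\<close> serve for the Brownian motion itself.\<close>

locale em_chain = brownian_process M F W
  for M :: "'w measure" and F :: "real \<Rightarrow> 'w measure" and W :: "real \<Rightarrow> 'w \<Rightarrow> real ^ 'm" +
  fixes f :: "real ^ 'm \<Rightarrow> real ^ 'm" and J :: "real ^ 'm \<Rightarrow> real ^ 'm ^ 'm"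
    and h :: "real ^ 'm \<Rightarrow> real" and x0 :: "real ^ 'm"
    and \<delta> T a L :: real and l :: nat
  assumes \<delta>: "0 < \<delta>" "\<delta> \<le> 1" and T: "0 < T" and a: "0 \<le> a" and L: "0 \<le> L" and l: "1 \<le> l"
    and fm [measurable]: "f \<in> borel_measurable borel" and Jm [measurable]: "J \<in> borel_measurable borel"
    and hm [measurable]: "h \<in> borel_measurable borel"
    and step_pos: "\<And>x. 0 < h x" and step_le: "\<And>x. h x \<le> \<delta> * T"
    and drift: "\<And>x. x \<bullet> f x + 1 / 2 * h x * (norm (f x))\<^sup>2 \<le> a * (1 + (norm x)\<^sup>2)"
    and J_growth: "\<And>R x. 1 \<le> R \<Longrightarrow> norm x \<le> R \<Longrightarrow> norm (J x) \<le> L * R ^ l"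
begin

abbreviation "t j \<omega> \<equiv> em_time f h (\<lambda>s. W s \<omega>) x0 j"
abbreviation "x j \<omega> \<equiv> em_val f h (\<lambda>s. W s \<omega>) x0 j"
abbreviation "m j \<omega> \<equiv> em_mart \<delta> J f h (\<lambda>s. W s \<omega>) x0 j"
abbreviation "r j \<omega> \<equiv> em_quad \<delta> f h (\<lambda>s. W s \<omega>) x0 j"

lemma step_le_T: "h y \<le> T" "h y / \<delta> \<le> T" "0 \<le> h y / \<delta>"
proof -
  have "\<delta> * T \<le> 1 * T" using \<delta> T by (intro mult_right_mono) auto
  then show "h y \<le> T" using step_le[of y] by simp
  show "h y / \<delta> \<le> T" using step_le[of y] \<delta> by (simp add: field_simps)
  show "0 \<le> h y / \<delta>" using step_pos[of y] \<delta> by simp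
qed

lemma t_bounds: "0 \<le> t j \<omega>" "t j \<omega> \<le> real j * T"
proof (induction j)
  case (Suc j)
  show "0 \<le> t (Suc j) \<omega>" "t (Suc j) \<omega> \<le> real (Suc j) * T"
    using Suc step_pos[of "x j \<omega>"] step_le_T(1)[of "x j \<omega>"]
    unfolding em_time_Suc by (auto simp: algebra_simps)
qed auto

lemma t_mono: "i \<le> j \<Longrightarrow> t i \<omega> \<le> t j \<omega>"
  by (rule lift_Suc_mono_le[of "\<lambda>j. t j \<omega>"]) (use step_pos less_imp_le in \<open>auto simp: em_time_Suc simp del: em_grid.simps\<close>)

text \<open>All components have to be treated together, because the next grid time is a stopping time only
by virtue of the adaptedness of the current value.\<close>

lemma adapted:
  "stopping_time F (t j) \<and> x j \<in> borel_measurable (pre_sigma (t j))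
    \<and> m j \<in> borel_measurable (pre_sigma (t j)) \<and> r j \<in> borel_measurable (pre_sigma (t j))"
proof (induction j)
  case 0
  have 0: "t 0 = (\<lambda>_. 0)" "x 0 = (\<lambda>_. x0)" "m 0 = (\<lambda>_. 0)" "r 0 = (\<lambda>_. 0)" by (simp_all add: fun_eq_iff)
  show ?case unfolding 0 using stopping_time_const by auto
next
  case (Suc j)
  then have \<tau>: "stopping_time F (t j)" and [measurable]: "x j \<in> borel_measurable (pre_sigma (t j))"
    "m j \<in> borel_measurable (pre_sigma (t j))" "r j \<in> borel_measurable (pre_sigma (t j))" by auto
  note \<tau>m[measurable] = measurable_stopping_time_pre_sigma[OF \<tau>]
  define H where "H \<omega> = h (x j \<omega>)" for \<omega>
  have Hm[measurable]: "H \<in> borel_measurable (pre_sigma (t j))" unfolding H_def by measurable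
  have H0: "0 \<le> H \<omega>" for \<omega> using step_pos less_imp_le by (auto simp: H_def)
  have tS: "t (Suc j) = (\<lambda>\<omega>. t j \<omega> + H \<omega>)" by (simp add: fun_eq_iff em_time_Suc H_def del: em_grid.simps)
  have tSm: "t (Suc j) \<in> borel_measurable (pre_sigma (t j))" unfolding tS by measurable
  have le: "t j \<omega> \<le> t (Suc j) \<omega>" for \<omega> by (rule t_mono) simp
  have \<rho>: "stopping_time F (t (Suc j))" by (rule later_stopping_time[OF \<tau> tSm le])
  note later = pre_sigma_later[OF \<tau> \<rho> le]
  have [measurable]: "x j \<in> borel_measurable (pre_sigma (t (Suc j)))"
    "m j \<in> borel_measurable (pre_sigma (t (Suc j)))" "r j \<in> borel_measurable (pre_sigma (t (Suc j)))"
    by (rule later; measurable)+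
  have [measurable]: "(\<lambda>\<omega>. W (t (Suc j) \<omega>) \<omega>) \<in> borel_measurable (pre_sigma (t (Suc j)))"
    by (rule W_stopped[OF \<rho>])
  have [measurable]: "(\<lambda>\<omega>. W (t j \<omega>) \<omega>) \<in> borel_measurable (pre_sigma (t (Suc j)))"
    by (rule later[OF W_stopped[OF \<tau>]])
  have [measurable]: "(\<lambda>\<omega>. mean_increment (\<lambda>s. W s \<omega>) (t j \<omega>) (h (x j \<omega>))) \<in> borel_measurable (pre_sigma (t (Suc j)))"
    "(\<lambda>\<omega>. mean_sq_increment (\<lambda>s. W s \<omega>) (t j \<omega>) (h (x j \<omega>))) \<in> borel_measurable (pre_sigma (t (Suc j)))"
    using mean_increment_measurable[OF \<tau> Hm H0] unfolding tS[symmetric] by (simp_all add: H_def)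
  have xS: "x (Suc j) = (\<lambda>\<omega>. x j \<omega> + h (x j \<omega>) *\<^sub>R f (x j \<omega>) + (W (t (Suc j) \<omega>) \<omega> - W (t j \<omega>) \<omega>))"
    by (rule ext) (rule em_val_Suc)
  show ?case
  proof (intro conjI \<rho>)
    show "x (Suc j) \<in> borel_measurable (pre_sigma (t (Suc j)))" unfolding xS by measurable
    show "m (Suc j) \<in> borel_measurable (pre_sigma (t (Suc j)))" unfolding em_mart.simps by measurable
    show "r (Suc j) \<in> borel_measurable (pre_sigma (t (Suc j)))" unfolding em_quad.simps by measurable
  qed
qed

text \<open>The martingale part changes with a scale given by \<open>J (x j)\<close>, of size \<open>|x j| ^ l\<close>; the power of \<open>|x j|\<close> is
chosen \<open>l\<close> times as large to dominate it.\<close>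

definition V :: "nat \<Rightarrow> nat \<Rightarrow> 'w \<Rightarrow> real" where
  "V n j \<omega> = 1 + norm (x j \<omega>) ^ (2 * (n * l)) + norm (m j \<omega>) ^ (2 * n)"

lemma V_ge_1: "1 \<le> V n j \<omega>"
  by (simp add: V_def)


context
  fixes j n :: nat and \<phi> :: "'w \<Rightarrow> real" and c B :: real
  assumes n: "1 \<le> n" and \<phi>m: "\<phi> \<in> borel_measurable (pre_sigma (t j))"
    and \<phi>: "\<And>\<omega>. 0 \<le> \<phi> \<omega>" "\<And>\<omega>. \<phi> \<omega> \<le> c" and B: "1 \<le> B"
    and bounded: "\<And>\<omega>. \<phi> \<omega> \<noteq> 0 \<Longrightarrow> norm (x j \<omega>) \<le> B" "\<And>\<omega>. \<phi> \<omega> \<noteq> 0 \<Longrightarrow> norm (m j \<omega>) \<le> B"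
begin

abbreviation "N \<equiv> n * l"
abbreviation "H \<omega> \<equiv> h (x j \<omega>)"

lemma N: "1 \<le> N" using n l by simp

lemma gm_nonneg: "0 \<le> gauss_moment TYPE('m) k" by (rule gauss_moment_nonneg)

lemma step_facts:
  shows \<tau>: "stopping_time F (t j)" and \<tau>m: "t j \<in> borel_measurable (pre_sigma (t j))"
    and xm: "x j \<in> borel_measurable (pre_sigma (t j))" and mm: "m j \<in> borel_measurable (pre_sigma (t j))"
    and \<tau>M[measurable]: "t j \<in> borel_measurable M"
    and xM[measurable]: "x j \<in> borel_measurable M" and mM[measurable]: "m j \<in> borel_measurable M"
    and \<phi>M[measurable]: "\<phi> \<in> borel_measurable M"
    and Hm: "(\<lambda>\<omega>. H \<omega>) \<in> borel_measurable (pre_sigma (t j))"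
proof -
  show s: "stopping_time F (t j)" and x: "x j \<in> borel_measurable (pre_sigma (t j))"
    and m: "m j \<in> borel_measurable (pre_sigma (t j))" using adapted[of j] by auto
  show t: "t j \<in> borel_measurable (pre_sigma (t j))" by (rule measurable_stopping_time_pre_sigma[OF s])
  show "t j \<in> borel_measurable M" "x j \<in> borel_measurable M" "m j \<in> borel_measurable M"
    "\<phi> \<in> borel_measurable M"
    by (rule pre_sigma_measurable[OF s] t x m \<phi>m)+
  note [measurable] = x
  show "(\<lambda>\<omega>. H \<omega>) \<in> borel_measurable (pre_sigma (t j))" by measurable
qed

text \<open>Outside its support the weight \<open>\<phi>\<close> makes every product vanish, so bounds are only needed where the
state is bounded.\<close>

lemma mult_support_le:
  assumes "\<And>\<omega>. \<phi> \<omega> \<noteq> 0 \<Longrightarrow> 0 \<le> u \<omega>" "\<And>\<omega>. \<phi> \<omega> \<noteq> 0 \<Longrightarrow> u \<omega> \<le> b"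
  shows "0 \<le> \<phi> \<omega> * u \<omega>" "\<phi> \<omega> * u \<omega> \<le> c * max 0 b"
proof -
  show "0 \<le> \<phi> \<omega> * u \<omega>" using assms(1)[of \<omega>] \<phi>(1)[of \<omega>] by (cases "\<phi> \<omega> = 0") auto
  have "0 \<le> c" using \<phi>[of \<omega>] by simp
  then show "\<phi> \<omega> * u \<omega> \<le> c * max 0 b"
    using assms[of \<omega>] \<phi>[of \<omega>] by (cases "\<phi> \<omega> = 0") (auto intro!: mult_mono)
qed

lemma time_Suc: "t (Suc j) \<omega> = t j \<omega> + H \<omega>" by (rule em_time_Suc)

text \<open>The drift moves \<open>x j\<close> to \<open>z\<close>, with \<open>|z|\<^sup>2 \<le> |x j|\<^sup>2 + 2 * H * a * (1 + |x j|\<^sup>2)\<close>: the term \<open>H\<^sup>2 * |f (x j)|\<^sup>2\<close> is what the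
step-size condition compensates. Then a Brownian increment of variance \<open>H\<close> is added to \<open>z\<close>.\<close>

lemma value_step:
  shows "integrable M (\<lambda>\<omega>. \<phi> \<omega> * norm (x (Suc j) \<omega>) ^ (2 * N))"
    and "(\<integral>\<omega>. \<phi> \<omega> * norm (x (Suc j) \<omega>) ^ (2 * N) \<partial>M) \<le> (\<integral>\<omega>. \<phi> \<omega> * (norm (x j \<omega>) ^ (2 * N)
      + (let E = 2 * a * real N * (1 + 2 * T * a) ^ N * 2 ^ N
         in E + power_step_const N (gauss_moment TYPE('m) 1) (gauss_moment TYPE('m) N) T * (1 + T * E)) * H \<omega> * (1 + norm (x j \<omega>) ^ (2 * N))) \<partial>M)"
proof -
  define z where "z \<omega> = x j \<omega> + H \<omega> *\<^sub>R f (x j \<omega>)" for \<omega>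
  define D where "D \<omega> = W (t (Suc j) \<omega>) \<omega> - W (t j \<omega>) \<omega>" for \<omega>
  define E where "E = 2 * a * real N * (1 + 2 * T * a) ^ N * 2 ^ N"
  have E0: "0 \<le> E" using a T by (simp add: E_def)
  have xS: "x (Suc j) \<omega> = z \<omega> + D \<omega>" for \<omega> unfolding z_def D_def by (rule em_val_Suc)
  note H0 = step_pos[of "x j _", THEN less_imp_le] and HT = step_le_T(1)[of "x j _"]
  have zm: "z \<in> borel_measurable (pre_sigma (t j))" unfolding z_def using xm by measurable
  have zM[measurable]: "z \<in> borel_measurable M" by (rule pre_sigma_measurable[OF \<tau> zm])
  have tSm: "t (Suc j) \<in> borel_measurable (pre_sigma (t j))" unfolding time_Suc[abs_def] using \<tau>m Hm by measurable
  note tSM[measurable] = pre_sigma_measurable[OF \<tau> tSm]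
  have DM[measurable]: "D \<in> borel_measurable M"
    unfolding D_def by (intro borel_measurable_diff W_random_time) measurable
  have z2: "(norm (z \<omega>))\<^sup>2 \<le> (norm (x j \<omega>))\<^sup>2 + 2 * H \<omega> * a * (1 + (norm (x j \<omega>))\<^sup>2)" for \<omega>
  proof -
    have "(norm (z \<omega>))\<^sup>2 = (norm (x j \<omega>))\<^sup>2 + 2 * H \<omega> * (x j \<omega> \<bullet> f (x j \<omega>) + 1 / 2 * H \<omega> * (norm (f (x j \<omega>)))\<^sup>2)"
      unfolding z_def power2_norm_eq_inner by (simp add: algebra_simps inner_add_left inner_add_right inner_commute)
    also have "\<dots> \<le> (norm (x j \<omega>))\<^sup>2 + 2 * H \<omega> * (a * (1 + (norm (x j \<omega>))\<^sup>2))"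
      using drift[of "x j \<omega>"] H0 by (intro add_left_mono mult_left_mono) auto
    finally show ?thesis by (simp add: mult_ac)
  qed
  have zN: "norm (z \<omega>) ^ (2 * N) \<le> norm (x j \<omega>) ^ (2 * N) + H \<omega> * E * (1 + norm (x j \<omega>) ^ (2 * N))" for \<omega>
    unfolding power_mult[of _ 2 N] E_def by (rule drift_power_le) (use z2 H0 HT a N in auto)
  define Bz where "Bz = B\<^sup>2 + 2 * T * a * (1 + B\<^sup>2)"
  have zB: "norm (z \<omega>) \<le> max 1 Bz" if "\<phi> \<omega> \<noteq> 0" for \<omega>
  proof -
    have x2: "(norm (x j \<omega>))\<^sup>2 \<le> B\<^sup>2" using bounded(1)[OF that] by (intro power_mono) auto
    have "(norm (z \<omega>))\<^sup>2 \<le> Bz"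
      unfolding Bz_def using x2 H0 HT a T by (intro order_trans[OF z2] add_mono mult_mono) auto
    then show ?thesis
      using self_le_power[of "norm (z \<omega>)" 2] by (cases "norm (z \<omega>) \<le> 1") auto
  qed
  define \<phi>' where "\<phi>' \<omega> = \<phi> \<omega> * norm (z \<omega>) ^ (2 * (N - 1))" for \<omega>
  have \<phi>'m: "\<phi>' \<in> borel_measurable (pre_sigma (t j))" unfolding \<phi>'_def using \<phi>m zm by measurable
  have \<phi>': "0 \<le> \<phi>' \<omega>" "\<phi>' \<omega> \<le> c * max 0 (max 1 Bz ^ (2 * (N - 1)))" for \<omega>
    unfolding \<phi>'_def by (rule mult_support_le; auto intro!: power_mono zB)+
  have vb: "norm (\<phi>' \<omega> *\<^sub>R z \<omega>) \<le> c * max 0 (max 1 Bz ^ (2 * (N - 1)) * max 1 Bz)" for \<omega>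
  proof -
    have "norm (\<phi>' \<omega> *\<^sub>R z \<omega>) = \<phi> \<omega> * (norm (z \<omega>) ^ (2 * (N - 1)) * norm (z \<omega>))"
      using \<phi>(1)[of \<omega>] by (simp add: \<phi>'_def)
    also have "\<dots> \<le> c * max 0 (max 1 Bz ^ (2 * (N - 1)) * max 1 Bz)"
      by (rule mult_support_le(2)) (auto intro!: mult_mono power_mono zB)
    finally show ?thesis .
  qed
  have tle: "t j \<omega> \<le> t (Suc j) \<omega>" "t (Suc j) \<omega> - t j \<omega> \<le> T" "t (Suc j) \<omega> - t j \<omega> = H \<omega>" for \<omega>
    using time_Suc[of \<omega>] H0 HT by auto
  note ps = power_step[OF N zM DM \<phi>M borel_measurable_const[of 1] _ \<phi>(1) \<phi>(2) zB _ _ H0 HT gm_nonneg[of 1] gm_nonneg[of N]]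
  have A: "integrable M (\<lambda>\<omega>. ((\<phi> \<omega> * norm (z \<omega>) ^ (2 * (N - 1))) *\<^sub>R z \<omega>) \<bullet> D \<omega>)"
      "(\<integral>\<omega>. ((\<phi> \<omega> * norm (z \<omega>) ^ (2 * (N - 1))) *\<^sub>R z \<omega>) \<bullet> D \<omega> \<partial>M) = 0"
    unfolding \<phi>'_def[symmetric] D_def
    by (rule increment_mean_zero[OF \<tau> t_bounds(1) tSm tle(1) t_bounds(2) _ vb]; use \<phi>'m zm in measurable)+
  have A2: "(\<integral>\<^sup>+\<omega>. ennreal ((\<phi> \<omega> * norm (z \<omega>) ^ (2 * (N - 1))) * (norm (D \<omega>))\<^sup>2) \<partial>M)
      \<le> (\<integral>\<^sup>+\<omega>. ennreal ((\<phi> \<omega> * norm (z \<omega>) ^ (2 * (N - 1))) * (gauss_moment TYPE('m) 1 * (1\<^sup>2 * H \<omega>))) \<partial>M)"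
    using increment_moment[OF \<tau> t_bounds(1) tSm tle(1) \<phi>'m order_refl tle(2) \<phi>']
    unfolding tle(3) by (simp add: \<phi>'_def D_def)
  have A3: "(\<integral>\<^sup>+\<omega>. ennreal (\<phi> \<omega> * norm (D \<omega>) ^ (2 * N)) \<partial>M)
      \<le> (\<integral>\<^sup>+\<omega>. ennreal (\<phi> \<omega> * (gauss_moment TYPE('m) N * (1 ^ (2 * N) * H \<omega> ^ N))) \<partial>M)"
    using increment_moment[OF \<tau> t_bounds(1) tSm tle(1) \<phi>m N tle(2) \<phi>]
    unfolding tle(3) by (simp add: D_def)
  note ps = power_step[where b = "\<lambda>_. 1" and h = "\<lambda>\<omega>. H \<omega>" and B = "max 1 Bz",
      OF N zM DM \<phi>M borel_measurable_const _ \<phi>(1) \<phi>(2) zB _ _ H0 HT gm_nonneg[of 1] gm_nonneg[of N] A A2 A3]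
  have Hmeas: "(\<lambda>\<omega>. H \<omega>) \<in> borel_measurable M" by measurable
  show "integrable M (\<lambda>\<omega>. \<phi> \<omega> * norm (x (Suc j) \<omega>) ^ (2 * N))"
    unfolding xS by (rule ps(1)[OF Hmeas]) auto
  define K where "K = power_step_const N (gauss_moment TYPE('m) 1) (gauss_moment TYPE('m) N) T"
  have K0: "0 \<le> K" unfolding K_def power_step_const_def using gm_nonneg expansion_const_nonneg T by auto
  define Y where "Y \<omega> = norm (x j \<omega>) ^ (2 * N)" for \<omega>
  have "(\<integral>\<omega>. \<phi> \<omega> * norm (x (Suc j) \<omega>) ^ (2 * N) \<partial>M)
     \<le> (\<integral>\<omega>. \<phi> \<omega> * (norm (z \<omega>) ^ (2 * N) + K * H \<omega> * (norm (z \<omega>) ^ (2 * N) + 1 ^ (2 * N))) \<partial>M)"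
    unfolding xS K_def by (rule ps(3)[OF Hmeas]) auto
  also have "\<dots> \<le> (\<integral>\<omega>. \<phi> \<omega> * (Y \<omega> + (E + K * (1 + T * E)) * H \<omega> * (1 + Y \<omega>)) \<partial>M)"
  proof (rule integral_mono)
    show "integrable M (\<lambda>\<omega>. \<phi> \<omega> * (norm (z \<omega>) ^ (2 * N) + K * H \<omega> * (norm (z \<omega>) ^ (2 * N) + 1 ^ (2 * N))))"
      unfolding K_def by (rule ps(2)[OF Hmeas]) auto
    let ?b = "B ^ (2 * N) + (E + K * (1 + T * E)) * T * (1 + B ^ (2 * N))"
    have u: "0 \<le> Y \<omega> + (E + K * (1 + T * E)) * H \<omega> * (1 + Y \<omega>)"
      "\<phi> \<omega> \<noteq> 0 \<Longrightarrow> Y \<omega> + (E + K * (1 + T * E)) * H \<omega> * (1 + Y \<omega>) \<le> ?b" for \<omega>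
      using E0 K0 T H0[of \<omega>] HT[of \<omega>] bounded(1)[of \<omega>]
      by (auto simp: Y_def intro!: add_mono mult_mono power_mono add_nonneg_nonneg mult_nonneg_nonneg)
    show "integrable M (\<lambda>\<omega>. \<phi> \<omega> * (Y \<omega> + (E + K * (1 + T * E)) * H \<omega> * (1 + Y \<omega>)))"
    proof (rule integrable_bounded_real[where B = "c * max 0 ?b"])
      show "(\<lambda>\<omega>. \<phi> \<omega> * (Y \<omega> + (E + K * (1 + T * E)) * H \<omega> * (1 + Y \<omega>))) \<in> borel_measurable M" unfolding Y_def by measurable
      show "\<bar>\<phi> \<omega> * (Y \<omega> + (E + K * (1 + T * E)) * H \<omega> * (1 + Y \<omega>))\<bar> \<le> c * max 0 ?b" for \<omega>
        using mult_support_le[of "\<lambda>\<omega>. Y \<omega> + (E + K * (1 + T * E)) * H \<omega> * (1 + Y \<omega>)", OF u]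
        by (simp add: abs_of_nonneg)
    qed
    fix \<omega>
    have z1: "norm (z \<omega>) ^ (2 * N) + 1 \<le> (1 + T * E) * (1 + Y \<omega>)"
    proof -
      have "H \<omega> * E * (1 + Y \<omega>) \<le> T * E * (1 + Y \<omega>)" using HT[of \<omega>] E0 by (intro mult_right_mono) (auto simp: Y_def)
      moreover have "norm (z \<omega>) ^ (2 * N) \<le> Y \<omega> + H \<omega> * E * (1 + Y \<omega>)" unfolding Y_def by (rule zN)
      moreover have "(1 + T * E) * (1 + Y \<omega>) = 1 + Y \<omega> + T * E * (1 + Y \<omega>)" by (simp only: distrib_right mult_1_left)
      ultimately show ?thesis by linarith
    qed
    have "norm (z \<omega>) ^ (2 * N) + K * H \<omega> * (norm (z \<omega>) ^ (2 * N) + 1 ^ (2 * N))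
      \<le> (Y \<omega> + H \<omega> * E * (1 + Y \<omega>)) + K * H \<omega> * ((1 + T * E) * (1 + Y \<omega>))"
      using zN[of \<omega>] z1 K0 H0[of \<omega>] by (intro add_mono mult_left_mono) (auto simp: Y_def)
    also have "\<dots> = Y \<omega> + (E + K * (1 + T * E)) * H \<omega> * (1 + Y \<omega>)" by (simp add: algebra_simps)
    finally show "\<phi> \<omega> * (norm (z \<omega>) ^ (2 * N) + K * H \<omega> * (norm (z \<omega>) ^ (2 * N) + 1 ^ (2 * N)))
      \<le> \<phi> \<omega> * (Y \<omega> + (E + K * (1 + T * E)) * H \<omega> * (1 + Y \<omega>))"
      by (rule mult_left_mono[OF _ \<phi>(1)])
  qed
  finally show "(\<integral>\<omega>. \<phi> \<omega> * norm (x (Suc j) \<omega>) ^ (2 * N) \<partial>M) \<le> (\<integral>\<omega>. \<phi> \<omega> * (norm (x j \<omega>) ^ (2 * N)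
      + (let E = 2 * a * real N * (1 + 2 * T * a) ^ N * 2 ^ N
         in E + power_step_const N (gauss_moment TYPE('m) 1) (gauss_moment TYPE('m) N) T * (1 + T * E)) * H \<omega> * (1 + norm (x j \<omega>) ^ (2 * N))) \<partial>M)"
    unfolding Let_def E_def[symmetric] K_def[symmetric] Y_def .
qed


text \<open>The increment \<open>H / \<delta>\<close> times \<open>J (x j)\<close> applied to the mean Brownian increment is bounded by \<open>T * |J (x j)|\<close>
times that mean, because \<open>H \<le> \<delta> * T\<close>: this is where the division by \<open>\<delta>\<close> is paid for.\<close>

lemma mart_step:
  shows "integrable M (\<lambda>\<omega>. \<phi> \<omega> * norm (m (Suc j) \<omega>) ^ (2 * n))"
    and "(\<integral>\<omega>. \<phi> \<omega> * norm (m (Suc j) \<omega>) ^ (2 * n) \<partial>M) \<le> (\<integral>\<omega>. \<phi> \<omega> * (norm (m j \<omega>) ^ (2 * n)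
      + power_step_const n (gauss_moment TYPE('m) 1) (gauss_moment TYPE('m) n) T * H \<omega>
          * (norm (m j \<omega>) ^ (2 * n) + (T * norm (J (x j \<omega>))) ^ (2 * n))) \<partial>M)"
    and "integrable M (\<lambda>\<omega>. \<phi> \<omega> * (norm (m j \<omega>) ^ (2 * n)
      + power_step_const n (gauss_moment TYPE('m) 1) (gauss_moment TYPE('m) n) T * H \<omega>
          * (norm (m j \<omega>) ^ (2 * n) + (T * norm (J (x j \<omega>))) ^ (2 * n))))"
proof -
  define I where "I \<omega> = mean_increment (\<lambda>s. W s \<omega>) (t j \<omega>) (H \<omega>)" for \<omega>
  define Q where "Q \<omega> = mean_sq_increment (\<lambda>s. W s \<omega>) (t j \<omega>) (H \<omega>)" for \<omega>
  define D where "D \<omega> = (H \<omega> / \<delta>) *\<^sub>R (J (x j \<omega>) *v I \<omega>)" for \<omega>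
  define b where "b \<omega> = T * norm (J (x j \<omega>))" for \<omega>
  have mS: "m (Suc j) \<omega> = m j \<omega> + D \<omega>" for \<omega> by (simp add: D_def I_def)
  note H0 = step_pos[of "x j _", THEN less_imp_le] and HT = step_le_T(1)[of "x j _"]
  have tSm: "t (Suc j) \<in> borel_measurable (pre_sigma (t j))" unfolding time_Suc[abs_def] using \<tau>m Hm by measurable
  have \<rho>: "stopping_time F (t (Suc j))" using adapted[of "Suc j"] by blast
  have IM[measurable]: "I \<in> borel_measurable M" and QM[measurable]: "Q \<in> borel_measurable M"
    using mean_increment_measurable[OF \<tau> Hm H0] \<rho> unfolding I_def Q_def time_Suc[abs_def]
    by (auto intro: pre_sigma_measurable)
  have DM[measurable]: "D \<in> borel_measurable M" unfolding D_def by measurable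
  have bm: "b \<in> borel_measurable (pre_sigma (t j))" unfolding b_def using xm by measurable
  have bM[measurable]: "b \<in> borel_measurable M" by (rule pre_sigma_measurable[OF \<tau> bm])
  have b0: "0 \<le> b \<omega>" for \<omega> using T by (simp add: b_def)
  define B' where "B' = max B (T * (L * B ^ l))"
  have bB: "b \<omega> \<le> B'" if "\<phi> \<omega> \<noteq> 0" for \<omega>
    unfolding b_def B'_def using J_growth[OF B bounded(1)[OF that]] T by (intro max.coboundedI2 mult_left_mono) auto
  have mB: "norm (m j \<omega>) \<le> B'" if "\<phi> \<omega> \<noteq> 0" for \<omega> using bounded(2)[OF that] by (simp add: B'_def)
  have B'0: "0 \<le> B'" using B by (simp add: B'_def)
  have Q0: "0 \<le> Q \<omega>" for \<omega> unfolding Q_def by (rule mean_sq_increment_nonneg)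
  have Dle: "norm (D \<omega>) ^ (2 * k) \<le> b \<omega> ^ (2 * k) * Q \<omega> ^ k" if w: "\<omega> \<in> space M" for \<omega> k
  proof -
    have "norm (D \<omega>) \<le> T * (norm (J (x j \<omega>)) * norm (I \<omega>))"
      unfolding D_def norm_scaleR abs_of_nonneg[OF step_le_T(3)]
      using step_le_T(2,3) T by (intro mult_mono norm_matrix_vector_mult_le) auto
    then have "norm (D \<omega>) ^ (2 * k) \<le> (b \<omega> * norm (I \<omega>)) ^ (2 * k)"
      by (intro power_mono) (auto simp: b_def mult_ac)
    also have "\<dots> = b \<omega> ^ (2 * k) * ((norm (I \<omega>))\<^sup>2) ^ k" by (simp add: power_mult_distrib power_mult)
    also have "\<dots> \<le> b \<omega> ^ (2 * k) * Q \<omega> ^ k"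
      unfolding I_def Q_def using b0 by (intro mult_left_mono power_mono norm_mean_increment_le W_cont[OF w]) auto
    finally show ?thesis .
  qed
  have mom: "(\<integral>\<^sup>+\<omega>. ennreal (\<psi> \<omega> * norm (D \<omega>) ^ (2 * k)) \<partial>M)
      \<le> (\<integral>\<^sup>+\<omega>. ennreal (\<psi> \<omega> * (gauss_moment TYPE('m) k * (b \<omega> ^ (2 * k) * H \<omega> ^ k))) \<partial>M)"
    if k: "1 \<le> k" and \<psi>: "\<psi> \<in> borel_measurable (pre_sigma (t j))" "\<And>\<omega>. 0 \<le> \<psi> \<omega>" "\<And>\<omega>. \<psi> \<omega> * b \<omega> ^ (2 * k) \<le> d" for \<psi> k d
  proof -
    have "(\<integral>\<^sup>+\<omega>. ennreal (\<psi> \<omega> * norm (D \<omega>) ^ (2 * k)) \<partial>M) \<le> (\<integral>\<^sup>+\<omega>. ennreal ((\<psi> \<omega> * b \<omega> ^ (2 * k)) * Q \<omega> ^ k) \<partial>M)"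
      using mult_left_mono[OF Dle \<psi>(2)] by (intro nn_integral_mono ennreal_leI) (simp add: mult_ac)
    also have "\<dots> \<le> (\<integral>\<^sup>+\<omega>. ennreal ((\<psi> \<omega> * b \<omega> ^ (2 * k)) * (gauss_moment TYPE('m) k * H \<omega> ^ k)) \<partial>M)"
      unfolding Q_def by (rule mean_sq_increment_moment[OF \<tau> t_bounds(1) Hm H0 HT _ k])
        (use \<psi> bm b0 in \<open>auto intro!: borel_measurable_times borel_measurable_power\<close>)
    finally show ?thesis by (simp add: mult_ac)
  qed
  define \<phi>' where "\<phi>' \<omega> = \<phi> \<omega> * norm (m j \<omega>) ^ (2 * (n - 1))" for \<omega>
  have \<phi>'m: "\<phi>' \<in> borel_measurable (pre_sigma (t j))" unfolding \<phi>'_def using \<phi>m mm by measurable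
  have \<phi>'0: "0 \<le> \<phi>' \<omega>" for \<omega> unfolding \<phi>'_def using \<phi>(1) by simp
  have \<phi>'b: "\<phi>' \<omega> * b \<omega> ^ (2 * 1) \<le> c * max 0 (B' ^ (2 * (n - 1)) * B' ^ (2 * 1))" for \<omega>
    unfolding \<phi>'_def mult.assoc using b0
    by (intro mult_support_le(2)) (auto intro!: mult_mono power_mono mB bB B'0 zero_le_power simp del: power2_eq_square)
  have \<phi>b: "\<phi> \<omega> * b \<omega> ^ (2 * n) \<le> c * max 0 (B' ^ (2 * n))" for \<omega>
    using b0 by (intro mult_support_le(2)) (auto intro!: power_mono bB)
  define v where "v \<omega> = (H \<omega> / \<delta> * \<phi>' \<omega>) *\<^sub>R (m j \<omega> v* J (x j \<omega>))" for \<omega>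
  have vm: "v \<in> borel_measurable (pre_sigma (t j))" unfolding v_def using Hm \<phi>'m mm xm by measurable
  have vb: "norm (v \<omega>) \<le> c * max 0 (B' ^ (2 * (n - 1)) * (B' * B'))" for \<omega>
  proof -
    have "norm (v \<omega>) = (H \<omega> / \<delta>) * \<phi>' \<omega> * norm (m j \<omega> v* J (x j \<omega>))"
      unfolding v_def norm_scaleR
      by (subst abs_of_nonneg[OF mult_nonneg_nonneg[OF step_le_T(3) \<phi>'0]]) (rule refl)
    also have "\<dots> \<le> T * \<phi>' \<omega> * (norm (J (x j \<omega>)) * norm (m j \<omega>))"
      using step_le_T[of "x j \<omega>"] \<phi>'0[of \<omega>] T by (intro mult_mono norm_vector_matrix_mult_le) auto
    also have "\<dots> = \<phi> \<omega> * (norm (m j \<omega>) ^ (2 * (n - 1)) * (b \<omega> * norm (m j \<omega>)))"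
      by (simp add: \<phi>'_def b_def mult_ac)
    also have "\<dots> \<le> c * max 0 (B' ^ (2 * (n - 1)) * (B' * B'))"
      using b0 by (intro mult_support_le(2)) (auto intro!: mult_mono power_mono mB bB B'0)
    finally show ?thesis .
  qed
  have eqv: "((\<phi> \<omega> * norm (m j \<omega>) ^ (2 * (n - 1))) *\<^sub>R m j \<omega>) \<bullet> D \<omega> = v \<omega> \<bullet> I \<omega>" for \<omega>
    unfolding D_def v_def \<phi>'_def by (simp add: dot_lmul_matrix)
  note mi = mean_increment_mean_zero[OF \<tau> t_bounds(1) Hm H0 HT t_bounds(2) vm vb]
  have A: "integrable M (\<lambda>\<omega>. ((\<phi> \<omega> * norm (m j \<omega>) ^ (2 * (n - 1))) *\<^sub>R m j \<omega>) \<bullet> D \<omega>)"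
      "(\<integral>\<omega>. ((\<phi> \<omega> * norm (m j \<omega>) ^ (2 * (n - 1))) *\<^sub>R m j \<omega>) \<bullet> D \<omega> \<partial>M) = 0"
    unfolding eqv using mi by (simp_all add: I_def)
  have A2: "(\<integral>\<^sup>+\<omega>. ennreal ((\<phi> \<omega> * norm (m j \<omega>) ^ (2 * (n - 1))) * (norm (D \<omega>))\<^sup>2) \<partial>M)
      \<le> (\<integral>\<^sup>+\<omega>. ennreal ((\<phi> \<omega> * norm (m j \<omega>) ^ (2 * (n - 1))) * (gauss_moment TYPE('m) 1 * ((b \<omega>)\<^sup>2 * H \<omega>))) \<partial>M)"
    using mom[OF order_refl \<phi>'m \<phi>'0 \<phi>'b] by (simp add: \<phi>'_def)
  note A3 = mom[OF n \<phi>m \<phi>(1) \<phi>b]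
  have Hmeas: "(\<lambda>\<omega>. H \<omega>) \<in> borel_measurable M" by measurable
  note ps = power_step[where h = "\<lambda>\<omega>. H \<omega>" and B = B',
      OF n mM DM \<phi>M bM Hmeas \<phi>(1) \<phi>(2) mB bB b0 H0 HT gm_nonneg[of 1] gm_nonneg[of n] A A2 A3]
  show "integrable M (\<lambda>\<omega>. \<phi> \<omega> * norm (m (Suc j) \<omega>) ^ (2 * n))"
    unfolding mS by (rule ps(1))
  show "(\<integral>\<omega>. \<phi> \<omega> * norm (m (Suc j) \<omega>) ^ (2 * n) \<partial>M) \<le> (\<integral>\<omega>. \<phi> \<omega> * (norm (m j \<omega>) ^ (2 * n)
      + power_step_const n (gauss_moment TYPE('m) 1) (gauss_moment TYPE('m) n) T * H \<omega>
          * (norm (m j \<omega>) ^ (2 * n) + (T * norm (J (x j \<omega>))) ^ (2 * n))) \<partial>M)"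
    using ps(3) unfolding mS b_def by simp
  show "integrable M (\<lambda>\<omega>. \<phi> \<omega> * (norm (m j \<omega>) ^ (2 * n)
      + power_step_const n (gauss_moment TYPE('m) 1) (gauss_moment TYPE('m) n) T * H \<omega>
          * (norm (m j \<omega>) ^ (2 * n) + (T * norm (J (x j \<omega>))) ^ (2 * n))))"
    using ps(2) unfolding b_def by simp
qed

lemma lyapunov_step:
  shows "integrable M (\<lambda>\<omega>. \<phi> \<omega> * V n (Suc j) \<omega>)"
    and "(\<integral>\<omega>. \<phi> \<omega> * V n (Suc j) \<omega> \<partial>M)
      \<le> (\<integral>\<omega>. \<phi> \<omega> * (V n j \<omega> * (1 + lyapunov_rate TYPE('m) n N T a L * H \<omega>)) \<partial>M)"
proof -
  let ?g = "\<lambda>k. gauss_moment TYPE('m) k"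
  define E where "E = 2 * a * real N * (1 + 2 * T * a) ^ N * 2 ^ N"
  define Cx where "Cx = E + power_step_const N (?g 1) (?g N) T * (1 + T * E)"
  define Km where "Km = power_step_const n (?g 1) (?g n) T"
  define C where "C = lyapunov_rate TYPE('m) n N T a L"
  have C: "C = Cx + Km * (1 + (T * L) ^ (2 * n))"
    unfolding C_def lyapunov_rate_def Let_def Cx_def E_def Km_def by simp
  have "0 \<le> E" using a T by (simp add: E_def)
  then have nonneg: "0 \<le> Cx" "0 \<le> Km"
    unfolding Cx_def Km_def power_step_const_def using gm_nonneg expansion_const_nonneg T by auto
  define X where "X \<omega> = norm (x j \<omega>) ^ (2 * N)" for \<omega>
  define Y where "Y \<omega> = norm (m j \<omega>) ^ (2 * n)" for \<omega>
  have pos: "0 \<le> X \<omega>" "0 \<le> Y \<omega>" "0 \<le> H \<omega>" "H \<omega> \<le> T" for \<omega>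
    using step_pos[of "x j \<omega>"] step_le_T(1) by (auto simp: X_def Y_def)
  have V: "V n j \<omega> = 1 + X \<omega> + Y \<omega>" for \<omega> by (simp add: V_def X_def Y_def)
  have bd: "\<phi> \<omega> \<noteq> 0 \<Longrightarrow> X \<omega> \<le> B ^ (2 * N)" "\<phi> \<omega> \<noteq> 0 \<Longrightarrow> Y \<omega> \<le> B ^ (2 * n)" for \<omega>
    using bounded[of \<omega>] by (auto simp: X_def Y_def intro!: power_mono)
  have [measurable]: "X \<in> borel_measurable M" "Y \<in> borel_measurable M"
    unfolding X_def Y_def by measurable
  have \<phi>i: "integrable M \<phi>" using \<phi> by (intro integrable_bounded_real[where B = c]) auto
  have Hb: "\<bar>\<phi> \<omega> * u \<omega>\<bar> \<le> c * max 0 b" if "\<And>\<omega>. \<phi> \<omega> \<noteq> 0 \<Longrightarrow> 0 \<le> u \<omega>" "\<And>\<omega>. \<phi> \<omega> \<noteq> 0 \<Longrightarrow> u \<omega> \<le> b" for u b \<omega>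
    using mult_support_le[of u b \<omega>, OF that] by simp
  have ix: "integrable M (\<lambda>\<omega>. \<phi> \<omega> * (X \<omega> + Cx * H \<omega> * (1 + X \<omega>)))"
  proof (rule integrable_bounded_real[OF _ Hb])
    show "0 \<le> X \<omega> + Cx * H \<omega> * (1 + X \<omega>)" for \<omega> using pos nonneg by simp
    show "X \<omega> + Cx * H \<omega> * (1 + X \<omega>) \<le> B ^ (2 * N) + Cx * T * (1 + B ^ (2 * N))" if "\<phi> \<omega> \<noteq> 0" for \<omega>
      using pos[of \<omega>] nonneg bd[OF that] T by (intro add_mono mult_mono mult_nonneg_nonneg) auto
  qed measurable
  note vs = value_step[unfolded Let_def, folded E_def, folded Cx_def X_def]
  note ms = mart_step[folded Km_def Y_def]
  have eq: "\<phi> \<omega> * V n (Suc j) \<omega> = \<phi> \<omega> + (\<phi> \<omega> * norm (x (Suc j) \<omega>) ^ (2 * N) + \<phi> \<omega> * norm (m (Suc j) \<omega>) ^ (2 * n))" for \<omega>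
    unfolding V_def by (simp only: distrib_left mult_1_right add.assoc)
  show "integrable M (\<lambda>\<omega>. \<phi> \<omega> * V n (Suc j) \<omega>)"
    unfolding eq by (intro Bochner_Integration.integrable_add \<phi>i vs(1) ms(1))
  have "(\<integral>\<omega>. \<phi> \<omega> * V n (Suc j) \<omega> \<partial>M) = (\<integral>\<omega>. \<phi> \<omega> \<partial>M) + ((\<integral>\<omega>. \<phi> \<omega> * norm (x (Suc j) \<omega>) ^ (2 * N) \<partial>M) + (\<integral>\<omega>. \<phi> \<omega> * norm (m (Suc j) \<omega>) ^ (2 * n) \<partial>M))"
    unfolding eq by (simp only: Bochner_Integration.integral_add Bochner_Integration.integrable_add \<phi>i vs(1) ms(1))
  also have "\<dots> \<le> (\<integral>\<omega>. \<phi> \<omega> \<partial>M) + ((\<integral>\<omega>. \<phi> \<omega> * (X \<omega> + Cx * H \<omega> * (1 + X \<omega>)) \<partial>M)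
     + (\<integral>\<omega>. \<phi> \<omega> * (Y \<omega> + Km * H \<omega> * (Y \<omega> + (T * norm (J (x j \<omega>))) ^ (2 * n))) \<partial>M))"
    by (intro add_left_mono add_mono vs(2) ms(2))
  also have "\<dots> = (\<integral>\<omega>. \<phi> \<omega> + (\<phi> \<omega> * (X \<omega> + Cx * H \<omega> * (1 + X \<omega>))
     + \<phi> \<omega> * (Y \<omega> + Km * H \<omega> * (Y \<omega> + (T * norm (J (x j \<omega>))) ^ (2 * n)))) \<partial>M)"
    by (simp only: Bochner_Integration.integral_add Bochner_Integration.integrable_add \<phi>i ix ms(3))
  also have "\<dots> \<le> (\<integral>\<omega>. \<phi> \<omega> * (V n j \<omega> * (1 + C * H \<omega>)) \<partial>M)"
  proof (rule integral_mono)
    show "integrable M (\<lambda>\<omega>. \<phi> \<omega> + (\<phi> \<omega> * (X \<omega> + Cx * H \<omega> * (1 + X \<omega>))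
     + \<phi> \<omega> * (Y \<omega> + Km * H \<omega> * (Y \<omega> + (T * norm (J (x j \<omega>))) ^ (2 * n)))))"
      by (intro Bochner_Integration.integrable_add \<phi>i ix ms(3))
    have C0: "0 \<le> C" unfolding C using nonneg T L by simp
    show "integrable M (\<lambda>\<omega>. \<phi> \<omega> * (V n j \<omega> * (1 + C * H \<omega>)))"
      unfolding V
    proof (rule integrable_bounded_real[OF _ Hb])
      show "0 \<le> (1 + X \<omega> + Y \<omega>) * (1 + C * H \<omega>)" for \<omega> using pos C0 by simp
      show "(1 + X \<omega> + Y \<omega>) * (1 + C * H \<omega>) \<le> (1 + B ^ (2 * N) + B ^ (2 * n)) * (1 + C * T)" if "\<phi> \<omega> \<noteq> 0" for \<omega>
        using pos[of \<omega>] C0 bd[OF that] T B by (intro mult_mono add_mono mult_left_mono add_nonneg_nonneg mult_nonneg_nonneg) auto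
    qed measurable
    fix \<omega>
    have Jb: "(T * norm (J (x j \<omega>))) ^ (2 * n) \<le> (T * L) ^ (2 * n) * (1 + X \<omega>)"
    proof -
      define M1 where "M1 = max 1 (norm (x j \<omega>))"
      have M1: "1 \<le> M1" "norm (x j \<omega>) \<le> M1" by (auto simp: M1_def)
      have "(T * norm (J (x j \<omega>))) ^ (2 * n) \<le> (T * (L * M1 ^ l)) ^ (2 * n)"
        using J_growth[OF M1] T by (intro power_mono mult_left_mono) auto
      also have "\<dots> = (T * L) ^ (2 * n) * M1 ^ (2 * N)"
      proof -
        have "l * (2 * n) = 2 * N" by simp
        then have "(M1 ^ l) ^ (2 * n) = M1 ^ (2 * N)" by (simp only: power_mult[symmetric])
        then show ?thesis by (simp only: mult.assoc[symmetric] power_mult_distrib[of "T * L" "M1 ^ l"])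
      qed
      also have "M1 ^ (2 * N) \<le> 1 + X \<omega>" by (simp add: M1_def X_def max_def)
      finally show ?thesis using T L by (simp add: mult_left_mono)
    qed
    let ?v = "V n j \<omega>"
    have v: "1 \<le> ?v" "1 + X \<omega> \<le> ?v" "Y \<omega> \<le> ?v" using pos[of \<omega>] unfolding V by auto
    have "1 + ((X \<omega> + Cx * H \<omega> * (1 + X \<omega>)) + (Y \<omega> + Km * H \<omega> * (Y \<omega> + (T * norm (J (x j \<omega>))) ^ (2 * n))))
      \<le> 1 + ((X \<omega> + Cx * H \<omega> * ?v) + (Y \<omega> + Km * H \<omega> * (?v + (T * L) ^ (2 * n) * ?v)))"
      using pos[of \<omega>] nonneg v Jb T L
      by (intro add_left_mono add_mono mult_left_mono order_trans[OF Jb]) auto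
    also have "\<dots> = ?v * (1 + C * H \<omega>)" unfolding C by (simp add: V algebra_simps)
    finally have "\<phi> \<omega> * (1 + ((X \<omega> + Cx * H \<omega> * (1 + X \<omega>)) + (Y \<omega> + Km * H \<omega> * (Y \<omega> + (T * norm (J (x j \<omega>))) ^ (2 * n)))))
      \<le> \<phi> \<omega> * (?v * (1 + C * H \<omega>))" by (rule mult_left_mono[OF _ \<phi>(1)])
    then show "\<phi> \<omega> + (\<phi> \<omega> * (X \<omega> + Cx * H \<omega> * (1 + X \<omega>))
     + \<phi> \<omega> * (Y \<omega> + Km * H \<omega> * (Y \<omega> + (T * norm (J (x j \<omega>))) ^ (2 * n)))) \<le> \<phi> \<omega> * (?v * (1 + C * H \<omega>))"
      by (simp only: distrib_left mult_1_right)
  qed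
  finally show "(\<integral>\<omega>. \<phi> \<omega> * V n (Suc j) \<omega> \<partial>M)
      \<le> (\<integral>\<omega>. \<phi> \<omega> * (V n j \<omega> * (1 + lyapunov_rate TYPE('m) n N T a L * H \<omega>)) \<partial>M)"
    unfolding C_def .
qed

end

end

context em_chain begin

section \<open>Maximal inequality and tails\<close>

lemma V_measurable: "V n j \<in> borel_measurable (pre_sigma (t j))"
proof -
  note [measurable] = adapted[of j, THEN conjunct2, THEN conjunct1] adapted[of j, THEN conjunct2, THEN conjunct2, THEN conjunct1]
  show ?thesis unfolding V_def by measurable
qed

lemma V_t_measurable [measurable]: "V n j \<in> borel_measurable M" "t j \<in> borel_measurable M"
  using pre_sigma_measurable[OF _ V_measurable] pre_sigma_measurable[OF _ measurable_stopping_time_pre_sigma] adapted[of j] by auto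

lemma V_bounds:
  assumes n: "1 \<le> n" and V: "V n j \<omega> < c"
  shows "norm (x j \<omega>) \<le> c" "norm (m j \<omega>) \<le> c"
proof -
  have *: "u \<le> c" if "0 \<le> u" "u ^ k < c" "1 \<le> c" "1 \<le> k" for u :: real and k
  proof (cases "u \<le> 1")
    case False
    then have "u \<le> u ^ k" using that by (intro self_le_power) auto
    then show ?thesis using that by simp
  qed (use that in simp)
  have 1: "1 \<le> c" using V_ge_1[of n j \<omega>] V by simp
  have "0 \<le> norm (x j \<omega>) ^ (2 * (n * l))" "0 \<le> norm (m j \<omega>) ^ (2 * n)" by auto
  then have "norm (x j \<omega>) ^ (2 * (n * l)) < c" "norm (m j \<omega>) ^ (2 * n) < c"
    using V unfolding V_def by linarith+
  then show "norm (x j \<omega>) \<le> c" "norm (m j \<omega>) \<le> c"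
    using *[of "norm (x j \<omega>)" "2 * (n * l)"] *[of "norm (m j \<omega>)" "2 * n"] 1 n l
    by auto
qed

lemma lyapunov_rate_nonneg: "0 \<le> lyapunov_rate TYPE('m) n k T a L"
  unfolding lyapunov_rate_def Let_def power_step_const_def
  using gauss_moment_nonneg[where 'm = 'm] expansion_const_nonneg T a L by (auto intro!: add_nonneg_nonneg mult_nonneg_nonneg)

text \<open>Let \<open>G j\<close> be the event that \<open>V\<close> has stayed below the level \<open>c\<close> up to index \<open>j\<close>. On \<open>G j\<close> the state is bounded and
\<open>lyapunov_step\<close> shows that \<open>exp (- C * t j) * V j\<close> does not increase in mean. The part of \<open>G j\<close> on which \<open>V\<close>
reaches \<open>c\<close> at the next step, before time \<open>T\<close>, carries at least \<open>c * exp (- C * T)\<close> times its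
probability; summing over \<open>j\<close> bounds the probability of ever reaching \<open>c\<close> before \<open>T\<close>.\<close>

lemma lyapunov_maximal:
  assumes n: "1 \<le> n" and c: "0 < c"
  shows "prob {\<omega> \<in> space M. \<exists>i\<le>j. t i \<omega> \<le> T \<and> c \<le> V n i \<omega>}
    \<le> exp (lyapunov_rate TYPE('m) n (n * l) T a L * T) * (1 + norm x0 ^ (2 * (n * l))) / c"
proof -
  define C where "C = lyapunov_rate TYPE('m) n (n * l) T a L"
  have C0: "0 \<le> C" unfolding C_def by (rule lyapunov_rate_nonneg)
  define V0 where "V0 = 1 + norm x0 ^ (2 * (n * l))"
  have V0: "V n 0 \<omega> = V0" for \<omega> using n by (simp add: V_def V0_def power_0_left)
  have eT: "1 \<le> exp (C * T)" using C0 T by simp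
  define bad where "bad j = {\<omega> \<in> space M. \<exists>i\<le>j. t i \<omega> \<le> T \<and> c \<le> V n i \<omega>}" for j
  have bad_m[measurable]: "bad j \<in> events" for j unfolding bad_def by measurable
  show ?thesis
  proof (cases "c \<le> V0")
    case True
    have "1 \<le> V0" by (simp add: V0_def)
    have "prob (bad j) \<le> 1" by simp
    also have "1 \<le> exp (C * T) * V0 / c"
      using True eT c mult_mono[of 1 "exp (C * T)" c V0] by simp
    finally show ?thesis unfolding bad_def C_def V0_def .
  next
    case False
    then have l1: "1 \<le> c" by (simp add: V0_def) (smt (verit) zero_le_power norm_ge_zero)
    define G where "G j = {\<omega> \<in> space M. \<forall>i\<le>j. V n i \<omega> < c}" for j
    have G_m[measurable]: "G j \<in> events" for j unfolding G_def by measurable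
    have G_pre: "G j \<in> sets (pre_sigma (t j))" for j
    proof -
      have "V n i \<in> borel_measurable (pre_sigma (t j))" if "i \<le> j" for i
        using pre_sigma_later[OF _ _ t_mono[OF that] V_measurable] adapted by blast
      then have "{\<omega> \<in> space (pre_sigma (t j)). V n i \<omega> < c} \<in> sets (pre_sigma (t j))" if "i \<le> j" for i
        using that by (intro borel_measurable_less) auto
      then have "{\<omega> \<in> space (pre_sigma (t j)). \<forall>i\<in>{..j}. V n i \<omega> < c} \<in> sets (pre_sigma (t j))"
        by (intro sets.sets_Collect_finite_All) auto
      then show ?thesis by (simp only: G_def space_pre_sigma atMost_iff Ball_def)
    qed
    define Z where "Z j \<omega> = exp (- C * t j \<omega>) * V n j \<omega>" for j \<omega>
    have [measurable]: "Z j \<in> borel_measurable M" for j unfolding Z_def by measurable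
    have Z0: "0 \<le> Z j \<omega>" for j \<omega> using V_ge_1[of n j \<omega>] by (simp add: Z_def)
    have step: "integrable M (\<lambda>\<omega>. indicator (G j) \<omega> * Z (Suc j) \<omega>)"
      "(\<integral>\<omega>. indicator (G j) \<omega> * Z (Suc j) \<omega> \<partial>M) \<le> (\<integral>\<omega>. indicator (G j) \<omega> * Z j \<omega> \<partial>M)" for j
    proof -
      \<comment> \<open>The discount at the next grid time is admissible as a weight: that time is known at the current one.\<close>
      define \<phi> where "\<phi> \<omega> = indicator (G j) \<omega> * exp (- C * t (Suc j) \<omega>)" for \<omega>
      have tS: "t (Suc j) \<omega> = t j \<omega> + h (x j \<omega>)" for \<omega> by (rule em_time_Suc)
      note [measurable] = adapted[of j, THEN conjunct2, THEN conjunct1]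
         adapted[of j, THEN conjunct1, THEN measurable_stopping_time_pre_sigma] G_pre
      have \<phi>m: "\<phi> \<in> borel_measurable (pre_sigma (t j))" unfolding \<phi>_def tS by measurable
      have \<phi>01: "0 \<le> \<phi> \<omega>" "\<phi> \<omega> \<le> 1" for \<omega>
        using C0 t_bounds(1)[where j = "Suc j" and \<omega> = \<omega>] by (auto simp: \<phi>_def split: split_indicator simp del: em_grid.simps)
      have sup: "V n j \<omega> < c" if "\<phi> \<omega> \<noteq> 0" for \<omega>
        using that by (auto simp: \<phi>_def G_def split: split_indicator_asm)
      note ls = lyapunov_step[OF n \<phi>m \<phi>01 l1 V_bounds(1)[OF n sup] V_bounds(2)[OF n sup], folded C_def]
      have eqS: "indicator (G j) \<omega> * Z (Suc j) \<omega> = \<phi> \<omega> * V n (Suc j) \<omega>" for \<omega> by (simp add: \<phi>_def Z_def)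
      show "integrable M (\<lambda>\<omega>. indicator (G j) \<omega> * Z (Suc j) \<omega>)" unfolding eqS by (rule ls(1))
      have Hi: "0 \<le> h (x j \<omega>)" for \<omega> using step_pos less_imp_le by auto
      have pw: "\<phi> \<omega> * (V n j \<omega> * (1 + C * h (x j \<omega>))) \<le> indicator (G j) \<omega> * Z j \<omega>" for \<omega>
      proof -
        have "\<phi> \<omega> * (V n j \<omega> * (1 + C * h (x j \<omega>))) \<le> \<phi> \<omega> * (V n j \<omega> * exp (C * h (x j \<omega>)))"
          using \<phi>01(1) V_ge_1[of n j \<omega>] by (intro mult_left_mono exp_ge_add_one_self) auto
        also have "\<dots> = indicator (G j) \<omega> * Z j \<omega>"
        proof -
          have "- C * (t j \<omega> + h (x j \<omega>)) + C * h (x j \<omega>) = - C * t j \<omega>" by (simp add: algebra_simps)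
          then have e: "exp (- C * t (Suc j) \<omega>) * exp (C * h (x j \<omega>)) = exp (- C * t j \<omega>)"
            unfolding tS by (simp only: exp_add[symmetric])
          show ?thesis unfolding Z_def \<phi>_def e[symmetric] by (simp only: mult_ac)
        qed
        finally show ?thesis .
      qed
      have Zb: "indicator (G j) \<omega> * Z j \<omega> \<le> c" "0 \<le> indicator (G j) \<omega> * Z j \<omega>" for \<omega>
      proof -
        show "0 \<le> indicator (G j) \<omega> * Z j \<omega>" using Z0 by simp
        show "indicator (G j) \<omega> * Z j \<omega> \<le> c"
        proof (cases "\<omega> \<in> G j")
          case True
          then have "V n j \<omega> < c" by (auto simp: G_def)
          moreover have "Z j \<omega> \<le> V n j \<omega>"
            unfolding Z_def using C0 t_bounds(1)[where j = j and \<omega> = \<omega>] V_ge_1[of n j \<omega>] by (intro mult_left_le_one_le) auto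
          ultimately show ?thesis using True by simp
        qed (use c in simp)
      qed
      have Zi: "integrable M (\<lambda>\<omega>. indicator (G j) \<omega> * Z j \<omega>)"
        by (rule integrable_bounded_real[where B = c]) (use Zb in \<open>auto simp: abs_of_nonneg\<close>)
      have "integrable M (\<lambda>\<omega>. \<phi> \<omega> * (V n j \<omega> * (1 + C * h (x j \<omega>))))"
      proof (rule Bochner_Integration.integrable_bound[OF Zi])
        note [measurable] = pre_sigma_measurable[OF adapted[of j, THEN conjunct1] \<phi>m]
          pre_sigma_measurable[OF adapted[of j, THEN conjunct1] adapted[of j, THEN conjunct2, THEN conjunct1]]
        show "(\<lambda>\<omega>. \<phi> \<omega> * (V n j \<omega> * (1 + C * h (x j \<omega>)))) \<in> borel_measurable M" by measurable
        have "0 \<le> \<phi> \<omega> * (V n j \<omega> * (1 + C * h (x j \<omega>)))" for \<omega>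
          using \<phi>01(1) V_ge_1[of n j \<omega>] C0 Hi[of \<omega>] by (intro mult_nonneg_nonneg add_nonneg_nonneg) auto
        then show "AE \<omega> in M. norm (\<phi> \<omega> * (V n j \<omega> * (1 + C * h (x j \<omega>)))) \<le> norm (indicator (G j) \<omega> * Z j \<omega>)"
          using pw Zb(2) by (intro AE_I2) (simp only: real_norm_def abs_of_nonneg)
      qed
      from integral_mono[OF this Zi pw] ls(2)
      show "(\<integral>\<omega>. indicator (G j) \<omega> * Z (Suc j) \<omega> \<partial>M) \<le> (\<integral>\<omega>. indicator (G j) \<omega> * Z j \<omega> \<partial>M)"
        unfolding eqS by simp
    qed
    have main: "c * exp (- C * T) * prob (bad j) + (\<integral>\<omega>. indicator (G j) \<omega> * Z j \<omega> \<partial>M) \<le> V0" for j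
    proof (induction j)
      case 0
      have "bad 0 = {}" using False by (auto simp: bad_def V0)
      moreover have "(\<integral>\<omega>. indicator (G 0) \<omega> * Z 0 \<omega> \<partial>M) \<le> (\<integral>\<omega>. V0 \<partial>M)"
      proof (rule integral_mono)
        show "integrable M (\<lambda>\<omega>. indicator (G 0) \<omega> * Z 0 \<omega>)"
          by (rule integrable_bounded_real[where B = V0]) (auto simp: Z_def V0 V0_def split: split_indicator)
      qed (auto simp: Z_def V0 V0_def split: split_indicator)
      ultimately show ?case by (simp add: prob_space)
    next
      case (Suc j)
      define A where "A = {\<omega> \<in> G j. c \<le> V n (Suc j) \<omega> \<and> t (Suc j) \<omega> \<le> T}"
      have A_m[measurable]: "A \<in> events"
      proof -
        have "A = G j \<inter> {\<omega> \<in> space M. c \<le> V n (Suc j) \<omega> \<and> t (Suc j) \<omega> \<le> T}" by (auto simp: A_def G_def)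
        also have "\<dots> \<in> events" by measurable
        finally show ?thesis .
      qed
      have "bad (Suc j) \<subseteq> bad j \<union> A"
      proof
        fix \<omega> assume "\<omega> \<in> bad (Suc j)"
        then obtain i where i: "\<omega> \<in> space M" "i \<le> Suc j" "t i \<omega> \<le> T" "c \<le> V n i \<omega>" by (auto simp: bad_def)
        show "\<omega> \<in> bad j \<union> A"
        proof (cases "\<omega> \<in> bad j")
          case nb: False
          then have iS: "i = Suc j" using i by (auto simp: bad_def le_Suc_eq simp del: em_grid.simps)
          have "V n k \<omega> < c" if "k \<le> j" for k
          proof (rule ccontr)
            assume "\<not> V n k \<omega> < c"
            moreover have "t k \<omega> \<le> T" using t_mono[of k "Suc j" \<omega>] that i iS by (simp del: em_grid.simps)
            ultimately have "\<omega> \<in> bad j" using i that unfolding bad_def by (auto simp: not_less)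
            then show False using nb by simp
          qed
          then show ?thesis using i iS by (auto simp: A_def G_def simp del: em_grid.simps)
        qed simp
      qed
      then have "prob (bad (Suc j)) \<le> prob (bad j \<union> A)" by (intro finite_measure_mono) auto
      also have "\<dots> \<le> prob (bad j) + prob A" by (intro measure_Un_le) auto
      finally have 1: "prob (bad (Suc j)) \<le> prob (bad j) + prob A" .
      have Gi: "integrable M (\<lambda>\<omega>. indicator (G (Suc j)) \<omega> * Z (Suc j) \<omega>)"
        by (rule Bochner_Integration.integrable_bound[OF step(1)[of j]]) (auto simp: G_def split: split_indicator)
      have Ai: "integrable M (\<lambda>\<omega>. c * exp (- C * T) * indicator A \<omega>)"
        by (intro integrable_mult_right integrable_real_indicator A_m) (simp add: less_top[symmetric])
      have "c * exp (- C * T) * prob A + (\<integral>\<omega>. indicator (G (Suc j)) \<omega> * Z (Suc j) \<omega> \<partial>M)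
        = (\<integral>\<omega>. c * exp (- C * T) * indicator A \<omega> + indicator (G (Suc j)) \<omega> * Z (Suc j) \<omega> \<partial>M)"
        by (subst Bochner_Integration.integral_add[OF Ai Gi]) simp
      also have "\<dots> \<le> (\<integral>\<omega>. indicator (G j) \<omega> * Z (Suc j) \<omega> \<partial>M)"
      proof (rule integral_mono[OF _ step(1)])
        show "integrable M (\<lambda>\<omega>. c * exp (- C * T) * indicator A \<omega> + indicator (G (Suc j)) \<omega> * Z (Suc j) \<omega>)"
          by (intro Bochner_Integration.integrable_add Gi Ai)
        fix \<omega>
        have "c * exp (- C * T) \<le> Z (Suc j) \<omega>" if "\<omega> \<in> A"
        proof -
          have "exp (- C * T) * c \<le> exp (- C * t (Suc j) \<omega>) * V n (Suc j) \<omega>"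
            using that C0 c unfolding A_def by (intro mult_mono) (auto intro: mult_left_mono simp del: em_grid.simps)
          then show ?thesis by (simp add: Z_def mult.commute del: em_grid.simps)
        qed
        moreover have "A \<inter> G (Suc j) = {}" "A \<subseteq> G j" "G (Suc j) \<subseteq> G j" by (force simp: A_def G_def)+
        ultimately show "c * exp (- C * T) * indicator A \<omega> + indicator (G (Suc j)) \<omega> * Z (Suc j) \<omega> \<le> indicator (G j) \<omega> * Z (Suc j) \<omega>"
          using Z0[of "Suc j" \<omega>] by (auto split: split_indicator)
      qed
      also have "\<dots> \<le> (\<integral>\<omega>. indicator (G j) \<omega> * Z j \<omega> \<partial>M)" by (rule step(2))
      finally have 2: "c * exp (- C * T) * prob A + (\<integral>\<omega>. indicator (G (Suc j)) \<omega> * Z (Suc j) \<omega> \<partial>M) \<le> (\<integral>\<omega>. indicator (G j) \<omega> * Z j \<omega> \<partial>M)" .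
      have "c * exp (- C * T) * prob (bad (Suc j)) \<le> c * exp (- C * T) * prob (bad j) + c * exp (- C * T) * prob A"
        using mult_left_mono[OF 1, of "c * exp (- C * T)"] c by (simp add: distrib_left)
      then show ?case using 2 Suc.IH by linarith
    qed
    have "0 \<le> (\<integral>\<omega>. indicator (G j) \<omega> * Z j \<omega> \<partial>M)" using Z0 by (intro integral_nonneg_AE) auto
    then have "c * exp (- C * T) * prob (bad j) \<le> V0" using main[of j] by linarith
    then have "prob (bad j) \<le> exp (C * T) * V0 / c"
      using c by (simp add: exp_minus field_simps)
    then show ?thesis unfolding bad_def C_def V0_def .
  qed
qed

text \<open>The index \<open>i\<close> is unbounded: paths whose grid accumulates before \<open>T\<close> are covered as well.\<close>

definition exceeds :: "real \<Rightarrow> 'w set" where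
  "exceeds K = {\<omega> \<in> space M. \<exists>i. t i \<omega> \<le> T \<and> (K < norm (x i \<omega>) \<or> K < norm (m i \<omega>))}"

lemma exceeds_measurable [measurable]: "exceeds K \<in> events"
proof -
  have [measurable]: "x i \<in> borel_measurable M" "m i \<in> borel_measurable M" for i
    using adapted[of i] pre_sigma_measurable by blast+
  show ?thesis unfolding exceeds_def by measurable
qed

text \<open>If one of the two norms exceeds \<open>K \<ge> 1\<close>, then \<open>V\<close> exceeds \<open>K ^ n\<close>.\<close>

lemma exceeds_tail:
  assumes n: "1 \<le> n" and K: "1 \<le> K"
  shows "prob (exceeds K) \<le> exp (lyapunov_rate TYPE('m) n (n * l) T a L * T) * (1 + norm x0 ^ (2 * (n * l))) / K ^ n"
proof -
  define bad where "bad j = {\<omega> \<in> space M. \<exists>i\<le>j. t i \<omega> \<le> T \<and> K ^ n \<le> V n i \<omega>}" for j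
  have [measurable]: "bad j \<in> events" for j unfolding bad_def by measurable
  have "exceeds K \<subseteq> (\<Union>j. bad j)"
  proof
    fix \<omega> assume "\<omega> \<in> exceeds K"
    then obtain i where i: "\<omega> \<in> space M" "t i \<omega> \<le> T" "K < norm (x i \<omega>) \<or> K < norm (m i \<omega>)"
      by (auto simp: exceeds_def)
    have 0: "0 \<le> norm (x i \<omega>) ^ (2 * (n * l))" "0 \<le> norm (m i \<omega>) ^ (2 * n)" by auto
    have *: "K ^ n \<le> u ^ k" if "K < u" "n \<le> k" for u k
    proof -
      have "K ^ n \<le> u ^ n" using that K by (intro power_mono) auto
      also have "\<dots> \<le> u ^ k" using that K by (intro power_increasing) auto
      finally show ?thesis .
    qed
    have nl: "n \<le> 2 * (n * l)" "n \<le> 2 * n" using n l by (auto simp: mult.assoc[symmetric])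
    have "K ^ n \<le> V n i \<omega>"
      using i(3)
    proof (elim disjE)
      assume "K < norm (x i \<omega>)"
      from *[OF this nl(1)] 0 show ?thesis unfolding V_def by linarith
    next
      assume "K < norm (m i \<omega>)"
      from *[OF this nl(2)] 0 show ?thesis unfolding V_def by linarith
    qed
    then show "\<omega> \<in> (\<Union>j. bad j)" using i by (auto simp: bad_def)
  qed
  then have "prob (exceeds K) \<le> prob (\<Union>j. bad j)" by (intro finite_measure_mono) auto
  also have "\<dots> \<le> exp (lyapunov_rate TYPE('m) n (n * l) T a L * T) * (1 + norm x0 ^ (2 * (n * l))) / K ^ n"
  proof (rule LIMSEQ_le_const2[OF finite_Lim_measure_incseq])
    show "incseq bad" unfolding bad_def incseq_def by (auto intro: order_trans)
    show "\<exists>N. \<forall>j\<ge>N. prob (bad j) \<le> exp (lyapunov_rate TYPE('m) n (n * l) T a L * T) * (1 + norm x0 ^ (2 * (n * l))) / K ^ n"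
      unfolding bad_def using lyapunov_maximal[OF n, of "K ^ n"] K by auto
  qed auto
  finally show ?thesis .
qed

text \<open>The steps that start before \<open>T\<close> cover \<open>[0,T]\<close> and at most one further step of length at most \<open>T\<close>.\<close>

lemma steps_sum_le:
  "(\<Sum>i<k. if t i \<omega> \<le> T then h (x i \<omega>) else 0) \<le> 2 * T"
proof -
  have "(\<Sum>i<k. if t i \<omega> \<le> T then h (x i \<omega>) else 0) \<le> t k \<omega>
    \<and> (\<Sum>i<k. if t i \<omega> \<le> T then h (x i \<omega>) else 0) \<le> 2 * T"
  proof (induction k)
    case (Suc k)
    then show ?case
      using step_le_T(1)[of "x k \<omega>"] step_pos[of "x k \<omega>"] by (auto simp: em_time_Suc simp del: em_grid.simps)
  qed (use T in auto)
  then show ?thesis by blast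
qed

definition quad_exceeds :: "real \<Rightarrow> 'w set" where
  "quad_exceeds K = {\<omega> \<in> space M. \<exists>i. t i \<omega> \<le> T \<and> (T + 1) * K < r i \<omega>}"

lemma quad_exceeds_measurable [measurable]: "quad_exceeds K \<in> events"
proof -
  have [measurable]: "r i \<in> borel_measurable M" for i
    using adapted[of i] pre_sigma_measurable by blast
  show ?thesis unfolding quad_exceeds_def by measurable
qed

text \<open>With \<open>Q\<close> the mean square increment divided by \<open>\<delta>\<close>, the accumulated quantity is the sum of the \<open>H * Q\<close>. From
\<open>Q \<le> K + K * (Q / K) ^ n\<close> it is at most \<open>K * T\<close> plus \<open>K / K ^ n\<close> times the sum of the \<open>H * Q ^ n\<close>; the latter increases with the
number of steps and has bounded mean, so that Markov's inequality replaces a maximal inequality.\<close>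

lemma quad_exceeds_tail:
  assumes n: "1 \<le> n" and K: "1 \<le> K"
  shows "prob (quad_exceeds K) \<le> gauss_moment TYPE('m) n * T ^ n * (2 * T) / K ^ n"
proof -
  let ?g = "gauss_moment TYPE('m) n"
  define Q where "Q i \<omega> = mean_sq_increment (\<lambda>s. W s \<omega>) (t i \<omega>) (h (x i \<omega>)) / \<delta>" for i \<omega>
  define H where "H i \<omega> = (if t i \<omega> \<le> T then h (x i \<omega>) else 0)" for i \<omega>
  have Q0: "0 \<le> Q i \<omega>" and H0: "0 \<le> H i \<omega>" "H i \<omega> \<le> T" for i \<omega>
    using T step_pos[THEN less_imp_le] step_le_T(1) \<delta>
    by (auto simp: Q_def H_def intro!: divide_nonneg_nonneg mean_sq_increment_nonneg)
  have stop: "stopping_time F (t i)" for i using adapted by blast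
  have Hp: "H i \<in> borel_measurable (pre_sigma (t i))" and hp: "(\<lambda>\<omega>. h (x i \<omega>)) \<in> borel_measurable (pre_sigma (t i))" for i
  proof -
    note [measurable] = measurable_stopping_time_pre_sigma[OF stop[of i]] adapted[of i, THEN conjunct2, THEN conjunct1]
    show "H i \<in> borel_measurable (pre_sigma (t i))" "(\<lambda>\<omega>. h (x i \<omega>)) \<in> borel_measurable (pre_sigma (t i))"
      unfolding H_def by measurable
  qed
  have [measurable]: "H i \<in> borel_measurable M" for i by (rule pre_sigma_measurable[OF stop Hp])
  have [measurable]: "Q i \<in> borel_measurable M" for i
  proof -
    have "t (Suc i) = (\<lambda>\<omega>. t i \<omega> + h (x i \<omega>))" by (rule ext) (rule em_time_Suc)
    then have "(\<lambda>\<omega>. mean_sq_increment (\<lambda>s. W s \<omega>) (t i \<omega>) (h (x i \<omega>))) \<in> borel_measurable M"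
      using mean_increment_measurable(2)[OF stop[of i] hp less_imp_le[OF step_pos]]
        pre_sigma_measurable[OF stop[of "Suc i"]] by (simp del: em_grid.simps)
    then show ?thesis unfolding Q_def by measurable
  qed
  define S where "S \<omega> = (\<Sum>i. ennreal (H i \<omega> * Q i \<omega> ^ n))" for \<omega>
  have [measurable]: "S \<in> borel_measurable M" unfolding S_def by measurable
  have one: "(\<integral>\<^sup>+\<omega>. ennreal (H i \<omega> * Q i \<omega> ^ n) \<partial>M) \<le> (\<integral>\<^sup>+\<omega>. ennreal (H i \<omega>) * ennreal (?g * T ^ n) \<partial>M)" for i
  proof -
    \<comment> \<open>The weight takes over the division by \<open>\<delta>\<close> inside \<open>Q\<close>.\<close>
    define \<phi> where "\<phi> \<omega> = H i \<omega> / \<delta> ^ n" for \<omega>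
    have "(\<integral>\<^sup>+\<omega>. ennreal (H i \<omega> * Q i \<omega> ^ n) \<partial>M)
      = (\<integral>\<^sup>+\<omega>. ennreal (\<phi> \<omega> * mean_sq_increment (\<lambda>s. W s \<omega>) (t i \<omega>) (h (x i \<omega>)) ^ n) \<partial>M)"
      by (simp add: \<phi>_def Q_def power_divide)
    also have "\<dots> \<le> (\<integral>\<^sup>+\<omega>. ennreal (\<phi> \<omega> * (?g * h (x i \<omega>) ^ n)) \<partial>M)"
    proof (rule mean_sq_increment_moment[OF stop t_bounds(1) hp less_imp_le[OF step_pos] step_le_T(1) _ n])
      show "\<phi> \<in> borel_measurable (pre_sigma (t i))" unfolding \<phi>_def using Hp by measurable
      show "0 \<le> \<phi> \<omega>" "\<phi> \<omega> \<le> T / \<delta> ^ n" for \<omega>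
        using H0 \<delta> by (auto simp: \<phi>_def intro!: divide_right_mono)
    qed
    also have "\<dots> \<le> (\<integral>\<^sup>+\<omega>. ennreal (H i \<omega>) * ennreal (?g * T ^ n) \<partial>M)"
    proof (rule nn_integral_mono)
      fix \<omega>
      have "(h (x i \<omega>) / \<delta>) ^ n \<le> T ^ n" by (intro power_mono step_le_T)
      from mult_left_mono[OF this, of "H i \<omega> * ?g"]
      have "\<phi> \<omega> * (?g * h (x i \<omega>) ^ n) \<le> H i \<omega> * (?g * T ^ n)"
        using H0 gauss_moment_nonneg[where 'm = 'm] by (simp add: \<phi>_def power_divide mult_ac)
      then show "ennreal (\<phi> \<omega> * (?g * h (x i \<omega>) ^ n)) \<le> ennreal (H i \<omega>) * ennreal (?g * T ^ n)"
        using H0(1)[of i \<omega>] gauss_moment_nonneg[where 'm = 'm] T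
        by (subst ennreal_mult[symmetric]) (auto intro: ennreal_leI)
    qed
    finally show ?thesis .
  qed
  have "(\<integral>\<^sup>+\<omega>. S \<omega> \<partial>M) = (\<Sum>i. \<integral>\<^sup>+\<omega>. ennreal (H i \<omega> * Q i \<omega> ^ n) \<partial>M)"
    unfolding S_def by (rule nn_integral_suminf) measurable
  also have "\<dots> \<le> (\<Sum>i. \<integral>\<^sup>+\<omega>. ennreal (H i \<omega>) * ennreal (?g * T ^ n) \<partial>M)"
    by (intro suminf_le one) auto
  also have "\<dots> = (\<integral>\<^sup>+\<omega>. (\<Sum>i. ennreal (H i \<omega>)) * ennreal (?g * T ^ n) \<partial>M)"
    by (subst nn_integral_suminf[symmetric]) auto
  also have "\<dots> \<le> (\<integral>\<^sup>+\<omega>. ennreal (2 * T) * ennreal (?g * T ^ n) \<partial>M)"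
  proof (intro nn_integral_mono mult_right_mono)
    fix \<omega>
    show "(\<Sum>i. ennreal (H i \<omega>)) \<le> ennreal (2 * T)"
    proof (rule suminf_le_const)
      show "(\<Sum>i<k. ennreal (H i \<omega>)) \<le> ennreal (2 * T)" for k
        using steps_sum_le[where k = k and \<omega> = \<omega>] H0 by (simp add: H_def[symmetric] sum_ennreal ennreal_leI)
    qed simp
  qed simp
  also have "\<dots> = ennreal (?g * T ^ n * (2 * T))"
    using T gauss_moment_nonneg[where 'm = 'm] by (simp add: emeasure_space_1 ennreal_mult[symmetric] mult_ac)
  finally have ES: "(\<integral>\<^sup>+\<omega>. S \<omega> \<partial>M) \<le> ennreal (?g * T ^ n * (2 * T))" .
  have sub: "quad_exceeds K \<subseteq> {\<omega> \<in> space M. 1 \<le> ennreal (1 / K ^ n) * S \<omega>}"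
  proof
    fix \<omega> assume "\<omega> \<in> quad_exceeds K"
    then obtain i where i: "\<omega> \<in> space M" "t i \<omega> \<le> T" "(T + 1) * K < r i \<omega>" by (auto simp: quad_exceeds_def)
    have "t k \<omega> = (\<Sum>j<k. h (x j \<omega>)) \<and> r k \<omega> = (\<Sum>j<k. h (x j \<omega>) * Q j \<omega>)" for k
      by (induction k) (auto simp: em_time_Suc Q_def simp del: em_grid.simps(2))
    then have tr: "t i \<omega> = (\<Sum>j<i. h (x j \<omega>))" "r i \<omega> = (\<Sum>j<i. h (x j \<omega>) * Q j \<omega>)" by blast+
    have HH: "h (x j \<omega>) = H j \<omega>" if "j < i" for j
      using t_mono[of j i \<omega>] that i(2) by (simp add: H_def)
    have young: "y \<le> K + K * (y ^ n / K ^ n)" if "0 \<le> y" for y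
    proof (cases "y \<le> K")
      case True
      then show ?thesis using K that by (simp add: add_increasing2)
    next
      case False
      then have "y / K \<le> (y / K) ^ n" using K n by (intro self_le_power) auto
      then have "K * (y / K) \<le> K * (y / K) ^ n" using K by (intro mult_left_mono) auto
      then show ?thesis using K by (simp add: power_divide)
    qed
    have "r i \<omega> \<le> (\<Sum>j<i. h (x j \<omega>) * (K + K * (Q j \<omega> ^ n / K ^ n)))"
      unfolding tr(2) by (intro sum_mono mult_left_mono young Q0 less_imp_le[OF step_pos])
    also have "\<dots> = K * t i \<omega> + K * ((\<Sum>j<i. H j \<omega> * Q j \<omega> ^ n) / K ^ n)"
      unfolding tr(1) by (simp add: HH distrib_left sum.distrib sum_distrib_left sum_divide_distrib mult_ac)
    also have "\<dots> \<le> K * T + K * ((\<Sum>j<i. H j \<omega> * Q j \<omega> ^ n) / K ^ n)" using i(2) K by simp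
    finally have "K * 1 < K * ((\<Sum>j<i. H j \<omega> * Q j \<omega> ^ n) / K ^ n)" using i(3) by (simp add: algebra_simps)
    then have "1 \<le> 1 / K ^ n * (\<Sum>j<i. H j \<omega> * Q j \<omega> ^ n)" using K by (subst (asm) mult_less_cancel_left_pos) auto
    then have "1 \<le> ennreal (1 / K ^ n * (\<Sum>j<i. H j \<omega> * Q j \<omega> ^ n))" by (simp add: ennreal_ge_1)
    also have "\<dots> = ennreal (1 / K ^ n) * (\<Sum>j<i. ennreal (H j \<omega> * Q j \<omega> ^ n))"
    proof -
      have pos: "0 \<le> H j \<omega> * Q j \<omega> ^ n" for j using H0 Q0 by simp
      then have "0 \<le> (\<Sum>j<i. H j \<omega> * Q j \<omega> ^ n)" by (rule sum_nonneg)
      then show ?thesis using K pos by (subst ennreal_mult) (auto simp only: sum_ennreal, simp)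
    qed
    also have "\<dots> \<le> ennreal (1 / K ^ n) * S \<omega>"
      unfolding S_def by (intro mult_left_mono sum_le_suminf) auto
    finally show "\<omega> \<in> {\<omega> \<in> space M. 1 \<le> ennreal (1 / K ^ n) * S \<omega>}" using i(1) by simp
  qed
  have "emeasure M (quad_exceeds K) \<le> emeasure M {\<omega> \<in> space M. 1 \<le> ennreal (1 / K ^ n) * S \<omega>}"
    by (rule emeasure_mono[OF sub]) measurable
  also have "\<dots> \<le> ennreal (1 / K ^ n) * (\<integral>\<^sup>+\<omega>. S \<omega> * indicator (space M) \<omega> \<partial>M)"
    using nn_integral_Markov_inequality[of S "space M" M "ennreal (1 / K ^ n)"] by simp
  also have "(\<integral>\<^sup>+\<omega>. S \<omega> * indicator (space M) \<omega> \<partial>M) = (\<integral>\<^sup>+\<omega>. S \<omega> \<partial>M)"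
    by (rule nn_integral_cong) simp
  also have "ennreal (1 / K ^ n) * (\<integral>\<^sup>+\<omega>. S \<omega> \<partial>M) \<le> ennreal (1 / K ^ n) * ennreal (?g * T ^ n * (2 * T))"
    by (intro mult_left_mono ES) simp
  also have "\<dots> = ennreal (?g * T ^ n * (2 * T) / K ^ n)"
    using K T gauss_moment_nonneg[where 'm = 'm] by (subst ennreal_mult[symmetric]) auto
  finally show ?thesis
    using K T gauss_moment_nonneg[where 'm = 'm] by (simp add: emeasure_eq_measure)
qed

end

section \<open>Brownian motion on a compact interval\<close>

context brownian_process begin

text \<open>Dyadic multiples of \<open>T\<close> suffice by continuity and make the event measurable.\<close>

definition W_exceeds :: "real \<Rightarrow> real \<Rightarrow> 'w set" where
  "W_exceeds T K = {\<omega> \<in> space M. \<exists>i j. j \<le> (2 :: nat) ^ i \<and> K < norm (W (real j / 2 ^ i * T) \<omega>)}"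

lemma W_exceeds_measurable [measurable]: "W_exceeds T K \<in> events"
  unfolding W_exceeds_def by measurable

lemma not_W_exceeds:
  assumes \<omega>: "\<omega> \<in> space M" "\<omega> \<notin> W_exceeds T K" and T: "0 < T" and s: "s \<in> {0..T}"
  shows "norm (W s \<omega>) \<le> K"
proof -
  have grid: "norm (W (real j / 2 ^ i * T) \<omega>) \<le> K" if "j \<le> 2 ^ i" for i j :: nat
    using \<omega> that by (auto simp: W_exceeds_def not_less)
  show ?thesis
  proof (cases "s = T")
    case True
    then show ?thesis using grid[of 1 0] by simp
  next
    case False
    define u where "u i = dyadic_above i (s / T) * T" for i
    have "u \<longlonglongrightarrow> s"
      unfolding u_def using tendsto_mult[OF dyadic_above_tendsto[of "s / T"] tendsto_const[of T]] T by simp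
    then have "(\<lambda>i. norm (W (u i) \<omega>)) \<longlonglongrightarrow> norm (W s \<omega>)"
      by (intro tendsto_norm continuous_on_tendsto_compose[OF W_cont[OF \<omega>(1)]]) auto
    moreover have "norm (W (u i) \<omega>) \<le> K" for i
    proof -
      define j where "j = nat \<lfloor>s / T * 2 ^ i\<rfloor>"
      have "0 \<le> s / T * 2 ^ i" using s T by simp
      then have j: "int j = \<lfloor>s / T * 2 ^ i\<rfloor>" by (simp add: j_def)
      have "s / T * 2 ^ i < 1 * 2 ^ i" using s T False by (intro mult_strict_right_mono) auto
      then have "real_of_int (int j) < 2 ^ i" unfolding j by linarith
      then have "real j < real (2 ^ i)" by simp
      then have "Suc j \<le> 2 ^ i" by (simp only: of_nat_less_iff Suc_le_eq)
      moreover have "u i = real (Suc j) / 2 ^ i * T"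
        unfolding u_def dyadic_above_def j[symmetric] by (simp add: add.commute)
      ultimately show ?thesis using grid[of "Suc j" i] by (simp only:)
    qed
    ultimately show ?thesis by (intro LIMSEQ_le_const2) auto
  qed
qed

text \<open>On the grid of mesh \<open>T / 2 ^ i\<close> the process is the scheme with zero drift and constant steps, whose tail bound
does not depend on \<open>i\<close>.\<close>

lemma W_exceeds_tail:
  assumes T: "0 < T" and n: "1 \<le> n"
  shows "\<exists>C\<ge>0. \<forall>K\<ge>1. prob (W_exceeds T K) \<le> C / K ^ n"
proof -
  define C where "C = exp (lyapunov_rate TYPE('m) n (n * 1) T 0 0 * T)"
  have "prob (W_exceeds T K) \<le> C / K ^ n" if K: "1 \<le> K" for K
  proof -
    define D where "D i = {\<omega> \<in> space M. \<exists>j\<le>(2::nat) ^ i. K < norm (W (real j / 2 ^ i * T) \<omega>)}" for i :: nat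
    have [measurable]: "D i \<in> events" for i unfolding D_def by measurable
    have D_le: "prob (D i) \<le> C / K ^ n" for i
    proof -
      define \<delta> where "\<delta> = 1 / (2::real) ^ i"
      interpret em_chain M F W "\<lambda>_. 0" "\<lambda>_. 0" "\<lambda>_. \<delta> * T" 0 \<delta> T 0 0 1
        by unfold_locales (use T in \<open>auto simp: \<delta>_def\<close>)
      have grid: "t j \<omega> = real j * (\<delta> * T) \<and> x j \<omega> = W (real j * (\<delta> * T)) \<omega>" for j \<omega>
      proof (induction j)
        case (Suc j)
        then show ?case unfolding em_time_Suc em_val_Suc by (simp add: em_time_Suc algebra_simps del: em_grid.simps)
      qed (simp add: W_zero)
      have "D i \<subseteq> exceeds K"
      proof
        fix \<omega> assume "\<omega> \<in> D i"
        then obtain j where j: "\<omega> \<in> space M" "j \<le> 2 ^ i" "K < norm (W (real j / 2 ^ i * T) \<omega>)" by (auto simp: D_def)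
        have "real j \<le> real (2 ^ i)" using j(2) by (simp only: of_nat_le_iff)
        then have "real j * (\<delta> * T) \<le> 2 ^ i * (\<delta> * T)" using T by (intro mult_right_mono) (auto simp: \<delta>_def)
        then have "t j \<omega> \<le> T" using grid[of \<omega> j] by (simp add: \<delta>_def)
        moreover have "K < norm (x j \<omega>)" using j(3) grid[of \<omega> j] by (simp add: \<delta>_def)
        ultimately show "\<omega> \<in> exceeds K" using j(1) by (auto simp: exceeds_def)
      qed
      then have "prob (D i) \<le> prob (exceeds K)" by (intro finite_measure_mono) auto
      also have "\<dots> \<le> C / K ^ n"
        using exceeds_tail[OF n K] n by (simp add: C_def power_0_left)
      finally show ?thesis .
    qed
    have "incseq D"
    proof (rule incseq_SucI, rule subsetI)
      fix i \<omega> assume "\<omega> \<in> D i"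
      then obtain j where j: "\<omega> \<in> space M" "j \<le> 2 ^ i" "K < norm (W (real j / 2 ^ i * T) \<omega>)" by (auto simp: D_def)
      have "real (2 * j) / 2 ^ Suc i = real j / 2 ^ i" by simp
      then show "\<omega> \<in> D (Suc i)" using j unfolding D_def by (intro CollectI conjI exI[of _ "2 * j"]) auto
    qed
    moreover have "W_exceeds T K = (\<Union>i. D i)" by (auto simp: W_exceeds_def D_def)
    ultimately have "(\<lambda>i. prob (D i)) \<longlonglongrightarrow> prob (W_exceeds T K)"
      using finite_Lim_measure_incseq[of D] \<open>\<And>i. D i \<in> events\<close> by (simp add: image_subset_iff)
    then show ?thesis by (rule LIMSEQ_le_const2) (use D_le in auto)
  qed
  then show ?thesis by (intro exI[of _ C]) (simp add: C_def)
qed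

end

section \<open>A continuous version of the Brownian motion\<close>

text \<open>The exceptional set is contained in a null set of \<open>M\<close>, and a normal filtration contains the null
sets of \<open>M\<close> from time zero on; setting the process to zero there does not destroy adaptedness.
Distributions and independence are insensitive to the change.\<close>

lemma continuous_version:
  fixes W :: "real \<Rightarrow> 'w \<Rightarrow> real ^ 'm"
  assumes "prob_space M" and F: "normal_filtration M F" and W: "standard_brownian_motion M F W"
  obtains W' F' where "brownian_process M F' W'" "AE \<omega> in M. W 0 \<omega> = 0 \<and> (\<forall>t\<ge>0. W' t \<omega> = W t \<omega>)"
proof -
  interpret prob_space M by fact
  note F = F[unfolded normal_filtration_def]
  note W = W[unfolded standard_brownian_motion_def]
  have sub: "\<And>t. 0 \<le> t \<Longrightarrow> space (F t) = space M" "\<And>t. 0 \<le> t \<Longrightarrow> sets (F t) \<subseteq> sets M"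
    using F[THEN conjunct1] unfolding subalgebra_def by blast+
  have mono: "\<And>s t. 0 \<le> s \<Longrightarrow> s \<le> t \<Longrightarrow> sets (F s) \<subseteq> sets (F t)"
    using F[THEN conjunct2, THEN conjunct1] by blast
  have null: "null_sets M \<subseteq> sets (F 0)" by (rule F[THEN conjunct2, THEN conjunct2, THEN conjunct1])
  have adapted: "\<And>t. 0 \<le> t \<Longrightarrow> W t \<in> borel_measurable (F t)" using W[THEN conjunct1] by blast
  have good: "AE \<omega> in M. W 0 \<omega> = 0 \<and> continuous_on {0..} (\<lambda>t. W t \<omega>)"
    by (intro AE_conjI W[THEN conjunct2, THEN conjunct1] W[THEN conjunct2, THEN conjunct2, THEN conjunct1])
  have inc: "\<And>s t. 0 \<le> s \<Longrightarrow> s < t \<Longrightarrow>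
        distributed M lborel (\<lambda>\<omega>. W t \<omega> - W s \<omega>) (\<lambda>x. ennreal (\<Prod>i\<in>UNIV. normal_density 0 (sqrt (t - s)) (x $ i)))"
    and ind: "\<And>s t. 0 \<le> s \<Longrightarrow> s < t \<Longrightarrow> indep_set (sets (F s))
          (sets (vimage_algebra (space M) (\<lambda>\<omega>. W t \<omega> - W s \<omega>) borel))"
    using W[THEN conjunct2, THEN conjunct2, THEN conjunct2] by blast+
  from good obtain N where N: "{\<omega> \<in> space M. \<not> (W 0 \<omega> = 0 \<and> continuous_on {0..} (\<lambda>t. W t \<omega>))} \<subseteq> N" "N \<in> null_sets M"
    unfolding eventually_ae_filter by auto
  define W' where "W' t \<omega> = (if \<omega> \<in> N \<or> t \<le> 0 then 0 else W t \<omega>)" for t \<omega>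
  define F' where "F' t = F (max t 0)" for t
  have notN: "W 0 \<omega> = 0" "continuous_on {0..} (\<lambda>t. W t \<omega>)" if "\<omega> \<in> space M" "\<omega> \<notin> N" for \<omega>
    using N(1) that by auto
  have W'_eq: "W' t \<omega> = W (max t 0) \<omega>" if "\<omega> \<in> space M" "\<omega> \<notin> N" for t \<omega>
    using notN(1)[OF that] that(2) by (auto simp: W'_def max_def)
  have ae: "AE \<omega> in M. \<omega> \<notin> N" by (rule AE_not_in[OF N(2)])
  have ae_eq: "AE \<omega> in M. W 0 \<omega> = 0 \<and> (\<forall>t\<ge>0. W' t \<omega> = W t \<omega>)"
    using ae AE_space by eventually_elim (use notN W'_eq in \<open>auto simp: max_def\<close>)
  have NF: "N \<in> sets (F' t)" for t using null N(2) mono[of 0 "max t 0"] by (auto simp: F'_def)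
  have W'm: "W' t \<in> borel_measurable (F' t)" for t
  proof (cases "t \<le> 0")
    case False
    then have "W t \<in> borel_measurable (F' t)" using adapted[of t] by (simp add: F'_def)
    then have "(\<lambda>\<omega>. if \<omega> \<in> N then 0 else W t \<omega>) \<in> borel_measurable (F' t)"
      by (intro measurable_If_set) (use NF sets.sets_into_space in \<open>auto\<close>)
    then show ?thesis using False by (simp add: W'_def[abs_def])
  qed (simp add: W'_def[abs_def])
  have F'_sub: "space (F' t) = space M" "sets (F' t) \<subseteq> sets M" for t using sub by (auto simp: F'_def)
  have W'M: "W' t \<in> borel_measurable M" for t
    using measurable_mono[OF order_refl refl F'_sub(2), of t borel] W'm[of t] F'_sub(1) by auto
  have WM: "W t \<in> borel_measurable M" if "0 \<le> t" for t
    using measurable_mono[OF order_refl refl sub(2)[OF that], of borel] adapted[OF that] sub(1)[OF that] by auto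
  have diff_ae: "AE \<omega> in M. W' t \<omega> - W' s \<omega> = W t \<omega> - W s \<omega>" if "0 \<le> s" "s < t" for s t
    using ae_eq by eventually_elim (use that in auto)
  have "brownian_process M F' W'"
  proof unfold_locales
    show "space (F' t) = space M" "sets (F' t) \<subseteq> sets M" for t by (rule F'_sub)+
    show "sets (F' s) \<subseteq> sets (F' t)" if "s \<le> t" for s t unfolding F'_def by (rule mono) (use that in auto)
    show "W' t \<in> borel_measurable (F' t)" for t by (rule W'm)
    show "W' 0 \<omega> = 0" for \<omega> by (simp add: W'_def)
    show "continuous_on UNIV (\<lambda>t. W' t \<omega>)" if w: "\<omega> \<in> space M" for \<omega>
    proof (cases "\<omega> \<in> N")
      case False
      have "continuous_on UNIV (\<lambda>t. W (max t 0) \<omega>)"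
        by (rule continuous_on_compose2[OF notN(2)[OF w False]]) (auto intro!: continuous_intros)
      then show ?thesis by (simp add: W'_eq[OF w False])
    qed (simp add: W'_def)
    fix s t :: real assume st: "0 \<le> s" "s < t"
    have [measurable]: "W t \<in> borel_measurable M" "W s \<in> borel_measurable M" "W' t \<in> borel_measurable M" "W' s \<in> borel_measurable M"
      using WM st W'M by auto
    have "distr M lborel (\<lambda>\<omega>. W' t \<omega> - W' s \<omega>) = distr M lborel (\<lambda>\<omega>. W t \<omega> - W s \<omega>)"
      by (rule distr_cong_AE[OF refl refl diff_ae[OF st]]) measurable
    then show "distributed M lborel (\<lambda>\<omega>. W' t \<omega> - W' s \<omega>) (\<lambda>x. ennreal (\<Prod>i\<in>UNIV. normal_density 0 (sqrt (t - s)) (x $ i)))"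
      using inc[OF st] unfolding distributed_def by simp
    have Fs: "F' s = F s" using st by (simp add: F'_def)
    show "indep_set (sets (F' s)) (sets (vimage_algebra (space M) (\<lambda>\<omega>. W' t \<omega> - W' s \<omega>) borel))"
    proof (rule indep_setI)
      show "sets (F' s) \<subseteq> events" by (rule F'_sub)
      show "sets (vimage_algebra (space M) (\<lambda>\<omega>. W' t \<omega> - W' s \<omega>) borel) \<subseteq> events"
        by (auto simp: sets_vimage_algebra2)
      fix A B assume A: "A \<in> sets (F' s)" and "B \<in> sets (vimage_algebra (space M) (\<lambda>\<omega>. W' t \<omega> - W' s \<omega>) borel)"
      then obtain E where E: "E \<in> sets borel" "B = (\<lambda>\<omega>. W' t \<omega> - W' s \<omega>) -` E \<inter> space M"
        by (auto simp: sets_vimage_algebra2)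
      define B0 where "B0 = (\<lambda>\<omega>. W t \<omega> - W s \<omega>) -` E \<inter> space M"
      have B0: "B0 \<in> sets (vimage_algebra (space M) (\<lambda>\<omega>. W t \<omega> - W s \<omega>) borel)"
        using E(1) by (auto simp: sets_vimage_algebra2 B0_def)
      have AM: "A \<in> events" using A F'_sub by auto
      have m: "B \<in> events" "B0 \<in> events" unfolding E(2) B0_def using E(1) by (auto intro!: measurable_sets)
      have "AE \<omega> in M. \<omega> \<in> B \<longleftrightarrow> \<omega> \<in> B0"
        using diff_ae[OF st] by eventually_elim (simp add: E(2) B0_def)
      then have eq: "prob B = prob B0" "prob (A \<inter> B) = prob (A \<inter> B0)"
        using m AM by (auto intro!: measure_eq_AE elim!: AE_mp)
      show "prob (A \<inter> B) = prob A * prob B"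
        using indep_setD[OF ind[OF st] _ B0, of A] A unfolding eq Fs by simp
    qed
  qed
  then show thesis using that ae_eq by blast
qed

section \<open>Strong convergence of order one\<close>

lemma em_grid_cong:
  assumes "\<And>s. 0 \<le> s \<Longrightarrow> w s = w' s" and h: "\<And>x. 0 < h x"
  shows "em_grid f h w x0 n = em_grid f h w' x0 n \<and> 0 \<le> em_time f h w x0 n"
proof (induction n)
  case (Suc n)
  have "0 \<le> em_time f h w x0 n + h (em_val f h w x0 n)" using add_nonneg_nonneg[OF conjunct2[OF Suc.IH] less_imp_le[OF h]] .
  then show ?case using Suc assms(1) by (auto simp: Let_def split_beta)
qed simp

lemma em_interpolant_cong:
  assumes w: "\<And>s. 0 \<le> s \<Longrightarrow> w s = w' s" and h: "\<And>x. 0 < h x" and t: "0 \<le> t"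
  shows "em_interpolant f h w x0 t = em_interpolant f h w' x0 t"
proof -
  have g: "em_grid f h w x0 n = em_grid f h w' x0 n" "0 \<le> em_time f h w x0 n" for n
    using em_grid_cong[where w = w and w' = w' and f = f and h = h and ?x0.0 = x0 and n = n] w h by auto
  show ?thesis unfolding em_interpolant_def Let_def using g w t by simp
qed

lemma powr_le_power:
  fixes u R q :: real assumes "0 \<le> u" "u \<le> R" "1 \<le> R" "0 \<le> q"
  shows "u powr q \<le> R ^ nat \<lceil>q\<rceil>"
proof -
  have "u powr q \<le> R powr q" using assms by (intro powr_mono2) auto
  also have "\<dots> \<le> R powr real (nat \<lceil>q\<rceil>)" using assms by (intro powr_mono) (auto simp: of_nat_nat le_of_int_ceiling)
  also have "\<dots> = R ^ nat \<lceil>q\<rceil>" using assms by (intro powr_realpow) auto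
  finally show ?thesis .
qed

text \<open>At a point outside \<open>B K\<close> for the first time at \<open>K = j + 2\<close>, the bound \<open>K ^ \<kappa>\<close> is one of the terms of the sum
of \<open>(j + 2) ^ \<kappa>\<close> over all \<open>j\<close> with the point in \<open>B (j + 1)\<close>. The exponent \<open>\<kappa> + 2\<close> of the tails makes the
expectation of this sum converge. The function \<open>Y\<close> may fail to be measurable.\<close>

lemma (in prob_space) moment_of_tails:
  fixes B :: "nat \<Rightarrow> 'a set" and Y :: "'a \<Rightarrow> ennreal"
  assumes B: "\<And>K. B K \<in> events" and D: "0 \<le> D"
    and tail: "\<And>K. 1 \<le> K \<Longrightarrow> prob (B K) \<le> D / real K ^ (\<kappa> + 2)" and c: "0 \<le> c"
    and Y: "AE \<omega> in M. \<forall>K\<ge>1. \<omega> \<notin> B K \<longrightarrow> Y \<omega> \<le> ennreal (c * real K ^ \<kappa>)"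
  shows "(\<integral>\<^sup>+\<omega>. Y \<omega> \<partial>M) \<le> ennreal (c * (1 + D * 2 ^ \<kappa> * (\<Sum>j. 1 / real (Suc j) ^ 2)))"
proof -
  have sm: "summable (\<lambda>j. 1 / real (Suc j) ^ 2)"
    using inverse_power_summable[of 2, where 'a = real] by (subst summable_Suc_iff) (simp add: inverse_eq_divide power_one_over)
  define g where "g \<omega> = ennreal c * (1 + (\<Sum>j. indicator (B (Suc j)) \<omega> * ennreal (real (Suc (Suc j)) ^ \<kappa>)))" for \<omega>
  have ex: "AE \<omega> in M. \<exists>K\<ge>1. \<omega> \<notin> B K"
  proof -
    have "prob (\<Inter>K\<in>{1..}. B K) \<le> D / real K" if K: "1 \<le> K" for K
    proof -
      have "prob (\<Inter>K\<in>{1..}. B K) \<le> prob (B K)" using K B by (intro finite_measure_mono) auto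
      also have "\<dots> \<le> D / real K ^ (\<kappa> + 2)" by (rule tail[OF K])
      also have "\<dots> \<le> D / real K"
      proof (rule divide_left_mono)
        show "real K \<le> real K ^ (\<kappa> + 2)" by (rule self_le_power) (use K in auto)
      qed (use K D in auto)
      finally show ?thesis .
    qed
    moreover have "(\<lambda>K. D / real K) \<longlonglongrightarrow> 0" by (rule lim_const_over_n)
    ultimately have "prob (\<Inter>K\<in>{1..}. B K) \<le> 0"
      by (intro LIMSEQ_le_const[of "\<lambda>K. D / real K"]) (auto intro!: exI[of _ 1])
    then have "(\<Inter>K\<in>{1..}. B K) \<in> null_sets M"
      using B by (auto simp: null_sets_def emeasure_eq_measure measure_le_0_iff intro!: sets.countable_INT'')
    from AE_not_in[OF this] show ?thesis by eventually_elim auto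
  qed
  have "(\<integral>\<^sup>+\<omega>. Y \<omega> \<partial>M) \<le> (\<integral>\<^sup>+\<omega>. g \<omega> \<partial>M)"
  proof (rule nn_integral_mono_AE)
    show "AE \<omega> in M. Y \<omega> \<le> g \<omega>"
      using Y ex
    proof eventually_elim
      fix \<omega> assume Yw: "\<forall>K\<ge>1. \<omega> \<notin> B K \<longrightarrow> Y \<omega> \<le> ennreal (c * real K ^ \<kappa>)" and "\<exists>K\<ge>1. \<omega> \<notin> B K"
      then obtain K0 where K0: "1 \<le> K0 \<and> \<omega> \<notin> B K0" by auto
      define K where "K = (LEAST K. 1 \<le> K \<and> \<omega> \<notin> B K)"
      have K: "1 \<le> K" "\<omega> \<notin> B K" using LeastI[of "\<lambda>K. 1 \<le> K \<and> \<omega> \<notin> B K", OF K0] by (auto simp: K_def)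
      have le: "Y \<omega> \<le> ennreal c * ennreal (real K ^ \<kappa>)"
        using Yw K c by (simp add: ennreal_mult)
      have "ennreal (real K ^ \<kappa>) \<le> 1 + (\<Sum>j. indicator (B (Suc j)) \<omega> * ennreal (real (Suc (Suc j)) ^ \<kappa>))"
      proof (cases "K = 1")
        case False
        define j where "j = K - 2"
        have j: "K = Suc (Suc j)" using False K(1) unfolding j_def by linarith
        have "\<omega> \<in> B (Suc j)"
          using not_less_Least[of "Suc j" "\<lambda>K. 1 \<le> K \<and> \<omega> \<notin> B K"] j by (auto simp: K_def)
        then have "ennreal (real K ^ \<kappa>) = indicator (B (Suc j)) \<omega> * ennreal (real (Suc (Suc j)) ^ \<kappa>)" by (simp add: j)
        also have "\<dots> \<le> (\<Sum>j. indicator (B (Suc j)) \<omega> * ennreal (real (Suc (Suc j)) ^ \<kappa>))"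
        proof -
          have "u j \<le> (\<Sum>j. u j)" for u :: "nat \<Rightarrow> ennreal" using sum_le_suminf[of u "{j}"] by simp
          then show ?thesis .
        qed
        finally show ?thesis by (rule add_increasing[OF zero_le])
      qed simp
      then show "Y \<omega> \<le> g \<omega>" unfolding g_def by (intro order_trans[OF le] mult_left_mono) auto
    qed
  qed
  also have "\<dots> = ennreal c * (1 + (\<Sum>j. emeasure M (B (Suc j)) * ennreal (real (Suc (Suc j)) ^ \<kappa>)))"
    unfolding g_def using B
    by (simp add: nn_integral_cmult nn_integral_add nn_integral_suminf nn_integral_multc emeasure_space_1)
  also have "\<dots> \<le> ennreal c * (1 + (\<Sum>j. ennreal (D * 2 ^ \<kappa> * (1 / real (Suc j) ^ 2))))"
  proof (intro mult_left_mono add_left_mono suminf_le allI)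
    fix j
    have "prob (B (Suc j)) * real (Suc (Suc j)) ^ \<kappa> \<le> D / real (Suc j) ^ (\<kappa> + 2) * (2 * real (Suc j)) ^ \<kappa>"
      using tail[of "Suc j"] D by (intro mult_mono power_mono) auto
    also have "\<dots> = D * 2 ^ \<kappa> * (1 / real (Suc j) ^ 2)"
      by (simp add: power_add power_mult_distrib divide_simps power2_eq_square del: of_nat_Suc)
    finally show "emeasure M (B (Suc j)) * ennreal (real (Suc (Suc j)) ^ \<kappa>) \<le> ennreal (D * 2 ^ \<kappa> * (1 / real (Suc j) ^ 2))"
      unfolding emeasure_eq_measure by (subst ennreal_mult[symmetric]) (auto intro: ennreal_leI)
  qed auto
  also have "(\<Sum>j. ennreal (D * 2 ^ \<kappa> * (1 / real (Suc j) ^ 2))) = ennreal (D * 2 ^ \<kappa> * (\<Sum>j. 1 / real (Suc j) ^ 2))"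
  proof -
    have "(\<Sum>j. ennreal (D * 2 ^ \<kappa> * (1 / real (Suc j) ^ 2))) = ennreal (\<Sum>j. D * 2 ^ \<kappa> * (1 / real (Suc j) ^ 2))"
      using D by (intro suminf_ennreal2 summable_mult[OF sm] mult_nonneg_nonneg) auto
    then show ?thesis by (simp only: suminf_mult[OF sm])
  qed
  also have "ennreal c * (1 + ennreal (D * 2 ^ \<kappa> * (\<Sum>j. 1 / real (Suc j) ^ 2)))
      = ennreal (c * (1 + D * 2 ^ \<kappa> * (\<Sum>j. 1 / real (Suc j) ^ 2)))"
  proof -
    define S where "S = D * 2 ^ \<kappa> * (\<Sum>j. 1 / real (Suc j) ^ 2)"
    have "0 \<le> S" unfolding S_def using D by (intro mult_nonneg_nonneg suminf_nonneg[OF sm]) auto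
    then show ?thesis unfolding S_def[symmetric] using c by (simp add: ennreal_mult)
  qed
  finally show ?thesis .
qed

theorem theorem4:
  fixes M :: "'w measure" and F :: "real \<Rightarrow> 'w measure"
    and W X :: "real \<Rightarrow> 'w \<Rightarrow> real ^ 'm"
    and f :: "real ^ 'm \<Rightarrow> real ^ 'm" and x0 :: "real ^ 'm"
    and h :: "real ^ 'm \<Rightarrow> real" and h\<delta> :: "real \<Rightarrow> real ^ 'm \<Rightarrow> real"
    and T \<alpha> \<gamma> \<mu> q \<alpha>' \<beta>' :: real
  assumes prob: "prob_space M"
    and filtration: "normal_filtration M F"
    and brownian: "standard_brownian_motion M F W"
    and T: "0 < T"
    and constants: "0 < \<alpha>" "0 < \<gamma>" "0 < \<mu>" "0 < q"
    and differentiable: "\<And>x. f differentiable (at x)"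
    and one_sided_lipschitz: "\<And>x y. (x - y) \<bullet> (f x - f y) \<le> 1 / 2 * \<alpha> * (norm (x - y))\<^sup>2"
    and polynomial_lipschitz:
      "\<And>x y. norm (f x - f y) + norm (jacobian f (at x) - jacobian f (at y))
         \<le> (\<gamma> * (norm x powr q + norm y powr q) + \<mu>) * norm (x - y)"
    and h_continuous: "continuous_on UNIV h"
    and h_pos: "\<And>x. 0 < h x"
    and constants': "0 < \<alpha>'" "0 < \<beta>'"
    and h_bound: "\<And>x. x \<bullet> f x + 1 / 2 * h x * (norm (f x))\<^sup>2 \<le> \<alpha>' * (norm x)\<^sup>2 + \<beta>'"
    and h\<delta>_measurable: "\<And>\<delta>. 0 < \<delta> \<Longrightarrow> \<delta> \<le> 1 \<Longrightarrow> h\<delta> \<delta> \<in> borel_measurable borel"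
    and h\<delta>_pos: "\<And>\<delta> x. 0 < \<delta> \<Longrightarrow> \<delta> \<le> 1 \<Longrightarrow> 0 < h\<delta> \<delta> x"
    and h\<delta>_lower: "\<And>\<delta> x. 0 < \<delta> \<Longrightarrow> \<delta> \<le> 1 \<Longrightarrow> \<delta> * min T (h x) \<le> h\<delta> \<delta> x"
    and h\<delta>_upper: "\<And>\<delta> x. 0 < \<delta> \<Longrightarrow> \<delta> \<le> 1 \<Longrightarrow> h\<delta> \<delta> x \<le> min (\<delta> * T) (h x)"
    and solution: "additive_sde_solution M F W f x0 T X"
  shows "\<forall>p>0. \<exists>C::real. \<forall>\<delta>. 0 < \<delta> \<and> \<delta> \<le> 1 \<longrightarrow>
    (\<integral>\<^sup>+ \<omega>. (SUP t\<in>{0..T}.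
        ennreal (norm (em_interpolant f (h\<delta> \<delta>) (\<lambda>s. W s \<omega>) x0 t - X t \<omega>) powr p)) \<partial>M)
      \<le> ennreal (C * \<delta> powr p)"
proof (intro allI impI)
  fix p :: real assume p: "0 < p"
  \<comment> \<open>The exponent exceeds that of the Lipschitz condition by one, so that on the ball of radius
    \<open>R \<ge> 1\<close> a single expression \<open>L * R ^ l\<close> bounds \<open>f\<close>, its Jacobian and their Lipschitz constants.\<close>
  define J where "J x = jacobian f (at x)" for x
  define l where "l = Suc (nat \<lceil>q\<rceil>)"
  define c where "c = 2 * \<gamma> + \<mu>"
  define L where "L = max 1 (norm (f 0) + norm (J 0) + c)"
  define a where "a = \<alpha>' + \<beta>'"
  have c0: "0 < c" using constants by (simp add: c_def)
  have L1: "1 \<le> L" and l1: "1 \<le> l" and a0: "0 \<le> a" using constants' by (auto simp: L_def l_def a_def)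
  have deriv: "(f has_derivative ((*v) (J x))) (at x)" for x
    using differentiable[of x] unfolding jacobian_works J_def .
  have lip: "norm (f x - f y) + norm (J x - J y) \<le> c * R ^ nat \<lceil>q\<rceil> * norm (x - y)"
    if R: "1 \<le> R" "norm x \<le> R" "norm y \<le> R" for R x y
  proof -
    have "\<gamma> * (norm x powr q + norm y powr q) \<le> \<gamma> * (R ^ nat \<lceil>q\<rceil> + R ^ nat \<lceil>q\<rceil>)"
      using powr_le_power[of "norm x" R q] powr_le_power[of "norm y" R q] R constants
      by (intro mult_left_mono add_mono) auto
    moreover have "\<mu> * 1 \<le> \<mu> * R ^ nat \<lceil>q\<rceil>" using constants R by (intro mult_left_mono one_le_power) auto
    ultimately have "\<gamma> * (norm x powr q + norm y powr q) + \<mu> \<le> c * R ^ nat \<lceil>q\<rceil>"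
      by (simp add: c_def algebra_simps)
    then show ?thesis using polynomial_lipschitz[of x y] unfolding J_def
      by (elim order_trans) (rule mult_right_mono, auto)
  qed
  have pow: "R ^ nat \<lceil>q\<rceil> \<le> R ^ l" "1 \<le> R ^ l" if "1 \<le> R" for R :: real
  proof -
    have "nat \<lceil>q\<rceil> \<le> l" unfolding l_def by (rule le_SucI[OF order_refl])
    then show "R ^ nat \<lceil>q\<rceil> \<le> R ^ l" using that by (rule power_increasing)
    show "1 \<le> R ^ l" by (rule one_le_power[OF that])
  qed
  have lipL: "norm (f x - f y) \<le> L * R ^ l * norm (x - y)" "norm (J x - J y) \<le> L * R ^ l * norm (x - y)"
    if R: "1 \<le> R" "norm x \<le> R" "norm y \<le> R" for R x y
  proof -
    have cL: "c \<le> L" by (simp add: L_def le_max_iff_disj)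
    have "c * R ^ nat \<lceil>q\<rceil> \<le> L * R ^ l"
      using pow[OF R(1)] c0 cL R by (intro mult_mono) auto
    then have "c * R ^ nat \<lceil>q\<rceil> * norm (x - y) \<le> L * R ^ l * norm (x - y)" by (rule mult_right_mono) simp
    then show "norm (f x - f y) \<le> L * R ^ l * norm (x - y)" "norm (J x - J y) \<le> L * R ^ l * norm (x - y)"
      using lip[OF R] norm_ge_zero[of "f x - f y"] norm_ge_zero[of "J x - J y"] by linarith+
  qed
  have grow: "norm (f x) \<le> L * R ^ l" "norm (J x) \<le> L * R ^ l" if R: "1 \<le> R" "norm x \<le> R" for R x
  proof -
    have "c * R ^ nat \<lceil>q\<rceil> * norm (x - 0) \<le> c * R ^ nat \<lceil>q\<rceil> * R" using R c0 by (intro mult_left_mono) auto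
    also have "\<dots> = c * R ^ l" by (simp add: l_def)
    finally have *: "norm (f x - f 0) + norm (J x - J 0) \<le> c * R ^ l" using lip[OF R(1,2), of 0] R by simp
    have "norm (f 0) * 1 \<le> norm (f 0) * R ^ l" "norm (J 0) * 1 \<le> norm (J 0) * R ^ l"
      using pow(2)[OF R(1)] by (intro mult_left_mono; simp)+
    moreover have "norm (f x) \<le> norm (f 0) + norm (f x - f 0)" "norm (J x) \<le> norm (J 0) + norm (J x - J 0)"
      by (rule norm_triangle_sub)+
    moreover have "(norm (f 0) + norm (J 0) + c) * R ^ l \<le> L * R ^ l"
      using R by (intro mult_right_mono) (auto simp: L_def)
    then have "norm (f 0) * R ^ l + norm (J 0) * R ^ l + c * R ^ l \<le> L * R ^ l" by (simp only: distrib_right)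
    moreover have "0 \<le> norm (f 0) * R ^ l" "0 \<le> norm (J 0) * R ^ l" using R by auto
    ultimately show "norm (f x) \<le> L * R ^ l" "norm (J x) \<le> L * R ^ l"
      using * norm_ge_zero[of "f x - f 0"] norm_ge_zero[of "J x - J 0"] by linarith+
  qed
  have fc: "continuous_on UNIV f"
    by (meson deriv continuous_at_imp_continuous_on has_derivative_continuous)
  have Jc: "continuous_on UNIV J"
  proof (rule continuous_at_imp_continuous_on, rule ballI)
    fix x :: "real ^ 'm"
    have "(L * (norm x + 1) ^ l)-lipschitz_on (cball 0 (norm x + 1)) J"
      using L1 by (intro lipschitz_onI) (auto simp: dist_norm intro!: lipL(2))
    from lipschitz_on_continuous_on[OF this] show "isCont J x"
      by (rule continuous_on_interior) simp
  qed
  have fm: "f \<in> borel_measurable borel" and Jm: "J \<in> borel_measurable borel"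
    using fc Jc by (auto intro: borel_measurable_continuous_onI)
  have step_lower: "\<exists>e>0. \<forall>x. norm x \<le> K \<longrightarrow> e \<le> h\<delta> \<delta> x" if \<delta>: "0 < \<delta>" "\<delta> \<le> 1" and K: "1 \<le> K" for \<delta> K
  proof -
    have "compact (cball (0 :: real ^ 'm) K)" "cball (0 :: real ^ 'm) K \<noteq> {}" using K by auto
    from continuous_attains_inf[OF this continuous_on_subset[OF h_continuous]]
    obtain y where "\<forall>x\<in>cball 0 K. h y \<le> h x" by blast
    then have y: "h y \<le> h x" if "norm x \<le> K" for x using that by simp
    have "\<delta> * min T (h y) \<le> h\<delta> \<delta> x" if "norm x \<le> K" for x
      using h\<delta>_lower[OF \<delta>, of x] y[OF that] \<delta> by (elim order_trans[rotated]) (intro mult_left_mono, auto)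
    then show ?thesis using \<delta> T h_pos[of y] by (intro exI[of _ "\<delta> * min T (h y)"]) auto
  qed
  have drift: "x \<bullet> f x + 1 / 2 * h\<delta> \<delta> x * (norm (f x))\<^sup>2 \<le> a * (1 + (norm x)\<^sup>2)" if \<delta>: "0 < \<delta>" "\<delta> \<le> 1" for \<delta> x
  proof -
    have "1 / 2 * h\<delta> \<delta> x * (norm (f x))\<^sup>2 \<le> 1 / 2 * h x * (norm (f x))\<^sup>2"
      using h\<delta>_upper[OF \<delta>, of x] by (intro mult_right_mono) auto
    moreover have "\<alpha>' * (norm x)\<^sup>2 + \<beta>' \<le> a * (1 + (norm x)\<^sup>2)" using constants' by (simp add: a_def algebra_simps)
    ultimately show ?thesis using h_bound[of x] by linarith
  qed
  \<comment> \<open>From here on the paths are those of a version that is continuous everywhere.\<close>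
  obtain W' F' where B: "brownian_process M F' W'"
    and W': "AE \<omega> in M. W 0 \<omega> = 0 \<and> (\<forall>t\<ge>0. W' t \<omega> = W t \<omega>)"
    using continuous_version[OF prob filtration brownian] .
  interpret B: brownian_process M F' W' by (rule B)
  obtain Cp k where Cp: "\<And>K. 1 \<le> K \<Longrightarrow> 0 \<le> error_factor T L l \<alpha> K \<and> error_factor T L l \<alpha> K \<le> Cp * K ^ k"
    using poly_bounded_error_factor[of T L l \<alpha>] T L1 unfolding poly_bounded_def by auto
  have Cp0: "0 \<le> Cp" using Cp[of 1] by simp
  define \<kappa> where "\<kappa> = nat \<lceil>real k * p\<rceil>"
  have powp: "(K ^ k) powr p \<le> K ^ \<kappa>" if K: "1 \<le> K" for K :: real
  proof -
    have "(K ^ k) powr p = K powr (real k * p)" using K by (simp add: powr_realpow[symmetric] powr_powr)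
    also have "\<dots> \<le> K ^ \<kappa>" unfolding \<kappa>_def using K p by (intro powr_le_power) auto
    finally show ?thesis .
  qed
  \<comment> \<open>Two more powers than needed for integrability, for summability over the levels \<open>K\<close>.\<close>
  define n where "n = \<kappa> + 2"
  have n1: "1 \<le> n" by (simp add: n_def)
  obtain C2 where C2: "0 \<le> C2" "\<And>K. 1 \<le> K \<Longrightarrow> B.prob (B.W_exceeds T K) \<le> C2 / K ^ n"
    using B.W_exceeds_tail[OF T n1] by auto
  define C1 where "C1 = exp (lyapunov_rate TYPE('m) n (n * l) T a L * T) * (1 + norm x0 ^ (2 * (n * l)))"
  define C3 where "C3 = gauss_moment TYPE('m) n * T ^ n * (2 * T)"
  have C30: "0 \<le> C3" unfolding C3_def using gauss_moment_nonneg[where 'm = 'm] T by auto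
  define D where "D = C1 + C3 + C2"
  have C10: "0 \<le> C1" unfolding C1_def by (intro mult_nonneg_nonneg add_nonneg_nonneg) auto
  define S where "S = 1 + D * 2 ^ \<kappa> * (\<Sum>j. 1 / real (Suc j) ^ 2)"
  show "\<exists>C::real. \<forall>\<delta>. 0 < \<delta> \<and> \<delta> \<le> 1 \<longrightarrow>
    (\<integral>\<^sup>+ \<omega>. (SUP t\<in>{0..T}.
        ennreal (norm (em_interpolant f (h\<delta> \<delta>) (\<lambda>s. W s \<omega>) x0 t - X t \<omega>) powr p)) \<partial>M)
      \<le> ennreal (C * \<delta> powr p)"
  proof (intro exI[of _ "Cp powr p * S"] allI impI, elim conjE)
    fix \<delta> :: real assume \<delta>: "0 < \<delta>" "\<delta> \<le> 1"
    have step: "0 < h\<delta> \<delta> x" "h\<delta> \<delta> x \<le> \<delta> * T" for x using h\<delta>_pos[OF \<delta>] h\<delta>_upper[OF \<delta>, of x] by auto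
    interpret E: em_chain M F' W' f J "h\<delta> \<delta>" x0 \<delta> T a L l
      by unfold_locales (use \<delta> T a0 L1 l1 fm Jm h\<delta>_measurable[OF \<delta>] step drift[OF \<delta>] grow(2) in auto)
    \<comment> \<open>Off this event the random quantities in the pathwise estimate are bounded by \<open>K\<close>.\<close>
    define A where "A K = E.exceeds (real K) \<union> E.quad_exceeds (real K) \<union> B.W_exceeds T (real K)" for K :: nat
    define Y where "Y \<omega> = (SUP t\<in>{0..T}. ennreal (norm (em_interpolant f (h\<delta> \<delta>) (\<lambda>s. W s \<omega>) x0 t - X t \<omega>) powr p))" for \<omega>
    have "(\<integral>\<^sup>+\<omega>. Y \<omega> \<partial>M) \<le> ennreal ((\<delta> * Cp) powr p * S)"
      unfolding S_def
    proof (rule B.moment_of_tails[where B = A])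
      show "A K \<in> B.events" for K unfolding A_def by measurable
      show "0 \<le> D" using C10 C2 C30 by (simp add: D_def)
      show "B.prob (A K) \<le> D / real K ^ (\<kappa> + 2)" if K: "1 \<le> K" for K
      proof -
        have "B.prob (A K) \<le> B.prob (E.exceeds (real K)) + B.prob (E.quad_exceeds (real K)) + B.prob (B.W_exceeds T (real K))"
          unfolding A_def by (intro order_trans[OF measure_Un_le] add_right_mono measure_Un_le) auto
        also have "\<dots> \<le> C1 / real K ^ n + C3 / real K ^ n + C2 / real K ^ n"
          using E.exceeds_tail[OF n1, of "real K"] E.quad_exceeds_tail[OF n1, of "real K"] C2(2)[of "real K"] K
          by (intro add_mono) (auto simp: C1_def C3_def)
        finally show ?thesis by (simp add: D_def n_def add_divide_distrib)
      qed
      show "0 \<le> (\<delta> * Cp) powr p" by simp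
      have X: "AE \<omega> in M. continuous_on {0..T} (\<lambda>t. X t \<omega>)"
        "AE \<omega> in M. (\<lambda>s. f (X s \<omega>)) absolutely_integrable_on {0..T} \<and>
          (\<forall>t\<in>{0..T}. X t \<omega> = x0 + integral {0..t} (\<lambda>s. f (X s \<omega>)) + (W t \<omega> - W 0 \<omega>))"
        using solution unfolding additive_sde_solution_def by blast+
      show "AE \<omega> in M. \<forall>K\<ge>1. \<omega> \<notin> A K \<longrightarrow> Y \<omega> \<le> ennreal ((\<delta> * Cp) powr p * real K ^ \<kappa>)"
        using X W' AE_space
      proof eventually_elim
        fix \<omega> assume Xc: "continuous_on {0..T} (\<lambda>t. X t \<omega>)"
          and Xe: "(\<lambda>s. f (X s \<omega>)) absolutely_integrable_on {0..T} \<and>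
            (\<forall>t\<in>{0..T}. X t \<omega> = x0 + integral {0..t} (\<lambda>s. f (X s \<omega>)) + (W t \<omega> - W 0 \<omega>))"
          and W\<omega>: "W 0 \<omega> = 0 \<and> (\<forall>t\<ge>0. W' t \<omega> = W t \<omega>)" and \<omega>: "\<omega> \<in> space M"
        show "\<forall>K\<ge>1. \<omega> \<notin> A K \<longrightarrow> Y \<omega> \<le> ennreal ((\<delta> * Cp) powr p * real K ^ \<kappa>)"
        proof (intro allI impI)
          fix K :: nat assume K: "1 \<le> K" and A: "\<omega> \<notin> A K"
          have K1: "1 \<le> real K" using K by simp
          have notE: "\<omega> \<notin> E.exceeds (real K)" "\<omega> \<notin> E.quad_exceeds (real K)" and notW: "\<omega> \<notin> B.W_exceeds T (real K)" using A by (auto simp: A_def)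
          interpret em_path f J "h\<delta> \<delta>" "\<lambda>s. W' s \<omega>" x0 \<delta> T L \<alpha> "real K" l
          proof
            show "\<exists>c>0. \<forall>x. norm x \<le> real K \<longrightarrow> c \<le> h\<delta> \<delta> x" by (rule step_lower[OF \<delta> K1])
            show "continuous_on UNIV (\<lambda>s. W' s \<omega>)" by (rule B.W_cont[OF \<omega>])
            show "(x - y) \<bullet> (f x - f y) \<le> \<alpha> / 2 * (norm (x - y))\<^sup>2" for x y using one_sided_lipschitz[of x y] by simp
            show "norm (W' s \<omega>) \<le> real K" if "s \<in> {0..T}" for s by (rule B.not_W_exceeds[OF \<omega> notW T that])
          qed (use \<delta> T L1 l1 constants K1 step deriv grow lipL notE \<omega> B.W_zero in
              \<open>auto simp: E.exceeds_def E.quad_exceeds_def not_less\<close>)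
          show "Y \<omega> \<le> ennreal ((\<delta> * Cp) powr p * real K ^ \<kappa>)"
            unfolding Y_def
          proof (rule SUP_least)
            fix s assume s: "s \<in> {0..T}"
            have "norm (em_interpolant f (h\<delta> \<delta>) (\<lambda>s. W' s \<omega>) x0 s - X s \<omega>) \<le> \<delta> * error_factor T L l \<alpha> (real K)"
              by (rule error_bound[OF Xc _ s]) (use Xe W\<omega> in auto)
            also have "\<dots> \<le> \<delta> * (Cp * real K ^ k)" using Cp[OF K1] \<delta> by (intro mult_left_mono) auto
            finally have "norm (em_interpolant f (h\<delta> \<delta>) (\<lambda>s. W' s \<omega>) x0 s - X s \<omega>) powr p \<le> (\<delta> * (Cp * real K ^ k)) powr p"
              using p by (intro powr_mono2) auto
            also have "\<dots> = (\<delta> * Cp) powr p * (real K ^ k) powr p"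
              using \<delta> Cp0 by (subst powr_mult[symmetric]) (auto simp: mult.assoc)
            also have "\<dots> \<le> (\<delta> * Cp) powr p * real K ^ \<kappa>"
              by (intro mult_left_mono powp K1) simp
            finally have *: "norm (em_interpolant f (h\<delta> \<delta>) (\<lambda>s. W' s \<omega>) x0 s - X s \<omega>) powr p \<le> (\<delta> * Cp) powr p * real K ^ \<kappa>" .
            have "em_interpolant f (h\<delta> \<delta>) (\<lambda>s. W s \<omega>) x0 s = em_interpolant f (h\<delta> \<delta>) (\<lambda>s. W' s \<omega>) x0 s"
              by (rule em_interpolant_cong) (use W\<omega> step s in auto)
            with * show "ennreal (norm (em_interpolant f (h\<delta> \<delta>) (\<lambda>s. W s \<omega>) x0 s - X s \<omega>) powr p) \<le> ennreal ((\<delta> * Cp) powr p * real K ^ \<kappa>)"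
              by (simp add: ennreal_leI)
          qed
        qed
      qed
    qed
    also have "(\<delta> * Cp) powr p * S = Cp powr p * S * \<delta> powr p"
      using \<delta> Cp0 by (simp add: powr_mult mult_ac)
    finally show "(\<integral>\<^sup>+ \<omega>. (SUP t\<in>{0..T}.
        ennreal (norm (em_interpolant f (h\<delta> \<delta>) (\<lambda>s. W s \<omega>) x0 t - X t \<omega>) powr p)) \<partial>M)
      \<le> ennreal (Cp powr p * S * \<delta> powr p)" unfolding Y_def .
  qed
qed

end
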